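(* For every positive integer $k$, MacMahon's functions $A_k(q), B_k(q), \dots, H_k(q)$ are quasi-modular forms as follows: $$A_k(q) \in \widetilde{\mathcal{M}}(\mathrm{SL}_2(\mathbb{Z})), \quad B_k(q) \in \widetilde{\mathcal{M}}(\Gamma_0(2)), \quad C_k(q) \in \widetilde{\mathcal{M}}(\Gamma_0(2)), \quad D_k(q) \in \widetilde{\mathcal{M}}(\Gamma_0(4)),$$ $$E_k(q) \in \widetilde{\mathcal{M}}(\Gamma_1(5)), \quad F_k(q) \in \widetilde{\mathcal{M}}(\Gamma_1(10)), \quad G_k(q) \in \widetilde{\mathcal{M}}(\Gamma_1(5)), \quad H_k(q) \in \widetilde{\mathcal{M}}(\Gamma_1(10)).$$
   Context: For a positive integer $N$, a non-empty subset $S \subset \mathbb{Z}/N\mathbb{Z}$, a positive integer $k$ and $\epsilon \in \{-1,1\}$, put $$A_{S, N, \epsilon, k}(q) := \sum_{\substack{0 < m_1 < m_2 < \cdots < m_k \\ m_i \in S\ (1 \le i \le k)}} \frac{\epsilon^k q^{m_1 + m_2 + \cdots + m_k}}{(1 - \epsilon q^{m_1})^2 (1- \epsilon q^{m_2})^2 \cdots (1 - \epsilon q^{m_k})^2},$$ where $m \in S$ for an integer $m$ means that the image of $m$ in $\mathbb{Z}/N\mathbb{Z}$ lies in $S$. MacMahon's functions are $$A_k(q) = A_{\{0\}, 1, 1, k}(q), \quad B_k(q) = (-1)^k A_{\{0\}, 1, -1, k}(q),$$ $$C_k(q) = A_{\{1\}, 2, 1, k}(q), \quad D_k(q) = (-1)^k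 A_{\{1\}, 2, -1, k}(q),$$ $$E_k(q) = A_{\{1,4\}, 5, 1, k}(q), \quad F_k(q) = (-1)^k A_{\{1,4\}, 5, -1, k}(q),$$ $$G_k(q) = A_{\{2,3\}, 5, 1, k}(q), \quad H_k(q) = (-1)^k A_{\{2,3\}, 5, -1, k}(q).$$ (Here $E_k(q)$ and $G_k(q)$ denote these MacMahon functions, not Eisenstein series.) They are regarded as functions of $z$ in the upper half-plane $\mathbb{H}$ via $q = e^{2\pi i z}$. $\Gamma_0(N)$ is the group of $\begin{pmatrix} a & b \\ c & d\end{pmatrix} \in \mathrm{SL}_2(\mathbb{Z})$ with $c \equiv 0 \pmod N$, and $\Gamma_1(N)$ is the subgroup of those with moreover $a \equiv d \equiv 1 \pmod N$. $\mathcal{M}_k(\Gamma)$ is the $\mathbb{C}$-vector space of holomorphic modular forms of weight $k$ on $\Gamma$ (holomorphic on $\mathbb{H}$ and at all cusps). The algebra of (mixed weight) quasi-modular forms on $\Gamma$ is $\widetilde{\mathcal{M}}(\Gamma) := \bigl(\bigoplus_{k \in \mathbb{Z}} \mathcal{M}_k(\Gamma)\bigr) \otimes \mathbb{C}[\phi]$, i.e. the functions that are polynomials in $\phi$ with coefficients in $\bigoplus_{k} \mathcal{M}_k(\Gamma)$, where $\phi(z) := 1 - 24\sum_{n=1}^\infty \bigl(\sum_{d \mid n} d\bigr) q^n$ is the weight $2$ Eisenstein series. *)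

theory Defs
  imports "HOL-Complex_Analysis.Complex_Analysis" "HOL-Number_Theory.Cong"
begin

section \<open>MacMahon's functions\<close>

text \<open>
  A subset of \<open>\<int>/N\<int>\<close> is given by a set \<open>S\<close> of representatives, and a tuple
  \<open>0 < m\<^sub>1 < \<dots> < m\<^sub>k\<close> by a strictly increasing list. For \<open>\<bar>q\<bar> < 1\<close> and \<open>\<epsilon> = \<plusminus>1\<close>
  the family below is absolutely summable and no denominator vanishes.
\<close>

definition mac_tuples :: "nat set \<Rightarrow> nat \<Rightarrow> nat \<Rightarrow> nat list set" where
  "mac_tuples S N k =
     {ms. length ms = k \<and> sorted_wrt (<) ms \<and> (\<forall>m\<in>set ms. 0 < m \<and> (\<exists>s\<in>S. [m = s] (mod N)))}"

definition mac_sum :: "nat set \<Rightarrow> nat \<Rightarrow> complex \<Rightarrow> nat \<Rightarrow> complex \<Rightarrow> complex" where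
  "mac_sum S N \<epsilon> k q =
     (\<Sum>\<^sub>\<infinity>ms\<in>mac_tuples S N k. \<epsilon> ^ k * q ^ sum_list ms / (\<Prod>m\<leftarrow>ms. (1 - \<epsilon> * q ^ m)\<^sup>2))"

definition mac_A :: "nat \<Rightarrow> complex \<Rightarrow> complex" where
  "mac_A k q = mac_sum {0} 1 1 k q"

definition mac_B :: "nat \<Rightarrow> complex \<Rightarrow> complex" where
  "mac_B k q = (-1) ^ k * mac_sum {0} 1 (-1) k q"

definition mac_C :: "nat \<Rightarrow> complex \<Rightarrow> complex" where
  "mac_C k q = mac_sum {1} 2 1 k q"

definition mac_D :: "nat \<Rightarrow> complex \<Rightarrow> complex" where
  "mac_D k q = (-1) ^ k * mac_sum {1} 2 (-1) k q"

definition mac_E :: "nat \<Rightarrow> complex \<Rightarrow> complex" where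
  "mac_E k q = mac_sum {1, 4} 5 1 k q"

definition mac_F :: "nat \<Rightarrow> complex \<Rightarrow> complex" where
  "mac_F k q = (-1) ^ k * mac_sum {1, 4} 5 (-1) k q"

definition mac_G :: "nat \<Rightarrow> complex \<Rightarrow> complex" where
  "mac_G k q = mac_sum {2, 3} 5 1 k q"

definition mac_H :: "nat \<Rightarrow> complex \<Rightarrow> complex" where
  "mac_H k q = (-1) ^ k * mac_sum {2, 3} 5 (-1) k q"


section \<open>Modular and quasi-modular forms\<close>

text \<open>
  Functions on the upper half-plane are represented by total functions on the complex numbers;
  their values off the upper half-plane are irrelevant and left unconstrained throughout.
\<close>

definition upper_half_plane :: "complex set" where
  "upper_half_plane = {z. Im z > 0}"

definition nome :: "complex \<Rightarrow> complex" where
  "nome z = exp (2 * of_real pi * \<i> * z)"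

definition SL2Z :: "(int^2^2) set" where
  "SL2Z = {A. det A = 1}"

definition Gamma0 :: "nat \<Rightarrow> (int^2^2) set" where
  "Gamma0 N = {A \<in> SL2Z. [A$2$1 = 0] (mod int N)}"

definition Gamma1 :: "nat \<Rightarrow> (int^2^2) set" where
  "Gamma1 N = {A \<in> Gamma0 N. [A$1$1 = 1] (mod int N) \<and> [A$2$2 = 1] (mod int N)}"

definition slash :: "int \<Rightarrow> (complex \<Rightarrow> complex) \<Rightarrow> int^2^2 \<Rightarrow> complex \<Rightarrow> complex" where
  "slash k f A z =
     (of_int (A$2$1) * z + of_int (A$2$2)) powi (-k)
       * f (moebius (of_int (A$1$1)) (of_int (A$1$2)) (of_int (A$2$1)) (of_int (A$2$2)) z)"

text \<open>
  Holomorphy at \<open>\<i>\<infinity>\<close>: for some width \<open>h\<close>, the function is a holomorphic function of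
  \<open>exp (2\<pi>\<i>z/h)\<close> on the unit disc, centre included.
\<close>

definition holomorphic_at_ii_inf :: "(complex \<Rightarrow> complex) \<Rightarrow> bool" where
  "holomorphic_at_ii_inf f \<longleftrightarrow>
     (\<exists>h::nat. h > 0 \<and> (\<exists>g. g holomorphic_on ball 0 1 \<and>
        (\<forall>z\<in>upper_half_plane. f z = g (nome (z / of_nat h)))))"

text \<open>
  Every cusp is of the form \<open>A(\<i>\<infinity>)\<close> with \<open>A\<close> in \<open>SL\<^sub>2(\<int>)\<close>, so holomorphy at all cusps
  is a condition on \<open>slash k f A\<close> for every such \<open>A\<close>.
\<close>

definition modular_forms :: "int \<Rightarrow> (int^2^2) set \<Rightarrow> (complex \<Rightarrow> complex) set" where
  "modular_forms k \<Gamma> =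
     {f. f holomorphic_on upper_half_plane \<and>
         (\<forall>A\<in>\<Gamma>. \<forall>z\<in>upper_half_plane. slash k f A z = f z) \<and>
         (\<forall>A\<in>SL2Z. holomorphic_at_ii_inf (slash k f A))}"

definition mixed_weight_modular_forms :: "(int^2^2) set \<Rightarrow> (complex \<Rightarrow> complex) set" where
  "mixed_weight_modular_forms \<Gamma> =
     {f. \<exists>(K::int set) g. finite K \<and> (\<forall>k\<in>K. g k \<in> modular_forms k \<Gamma>) \<and>
           (\<forall>z\<in>upper_half_plane. f z = (\<Sum>k\<in>K. g k z))}"

definition eisenstein_phi :: "complex \<Rightarrow> complex" where
  "eisenstein_phi z = 1 - 24 * (\<Sum>\<^sub>\<infinity>n\<in>{1..}. of_nat (\<Sum>d | d dvd n. d) * nome z ^ n)"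

definition quasimodular_forms :: "(int^2^2) set \<Rightarrow> (complex \<Rightarrow> complex) set" where
  "quasimodular_forms \<Gamma> =
     {f. \<exists>(n::nat) c. (\<forall>j\<le>n. c j \<in> mixed_weight_modular_forms \<Gamma>) \<and>
           (\<forall>z\<in>upper_half_plane. f z = (\<Sum>j\<le>n. c j z * eisenstein_phi z ^ j))}"

end

theory Submission
  imports Defs "HOL-Real_Asymp.Real_Asymp"
begin

(* frees the dollar sign for the entries of matrices *)
unbundle no Formal_Power_Series.fps_syntax

text \<open>
  MacMahon's function of index \<open>k\<close> is the \<open>k\<close>-th elementary symmetric function of the quantities
  \<open>x\<^sub>m = \<epsilon> q\<^sup>m / (1 - \<epsilon> q\<^sup>m)\<^sup>2\<close>, with \<open>m\<close> running through the positive integers in the residue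
  classes of \<open>S\<close>. By Newton's identities (\<open>newton_identity\<close>) it is a polynomial in the power sums
  of the \<open>x\<^sub>m\<close>. The function \<open>f(t) = t / (1 - t)\<^sup>2\<close> satisfies
  \<open>D\<^sup>2 f\<^sup>r = r\<^sup>2 f\<^sup>r + 2 r (2 r + 1) f\<^sup>r\<^sup>+\<^sup>1\<close> for \<open>D = t d/dt\<close>, so \<open>f\<^sup>r\<close> is a linear combination
  of the series \<open>\<Sum>n. n\<^sup>i t\<^sup>n\<close> with \<open>i\<close> odd (\<open>power_polylog_neg_1_eq_combination\<close>), and the
  \<open>r\<close>-th power sum is a linear combination of the series \<open>\<Sum>m\<in>S. \<Sum>n. n\<^sup>i \<epsilon>\<^sup>n q\<^sup>m\<^sup>n\<close>. Quasi-modular forms are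
  an algebra, so it is enough to treat these series. The case \<open>\<epsilon> = -1\<close> follows from \<open>\<epsilon> = 1\<close> at
  \<open>q\<close> and \<open>q\<^sup>2\<close> by separating the even \<open>n\<close> (\<open>polylog_neg_minus\<close>); passing to \<open>q\<^sup>2\<close> doubles the level.

  The sets \<open>S\<close> in question are stable under \<open>m \<mapsto> -m\<close>, so the sum over \<open>m \<in> S\<close> is half the sum of the
  two-sided series \<open>T(a) = \<Sum>m \<equiv> a (mod D), m \<noteq> 0. \<Sum>n. n\<^sup>i q\<^sup>\<bar>\<^sup>m\<^sup>\<bar>\<^sup>n\<close> over the classes \<open>a\<close> in \<open>S\<close>. Put
  \<open>k = i + 1\<close>, which is even. By the Lipschitz formula (\<open>lipschitz_formula\<close>), \<open>T(a)\<close> is up to constants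
  the Fourier expansion of the sum of \<open>((m + a) z + n)\<^sup>-\<^sup>k\<close> over \<open>m \<in> D\<int>\<close> and \<open>n \<in> \<int>\<close>. For \<open>k \<ge> 4\<close> this
  converges absolutely and is a modular form of weight \<open>k\<close>. For \<open>k = 2\<close> one subtracts \<open>(m z + n)\<^sup>-\<^sup>2\<close> from
  each term; for \<open>a\<close> not divisible by \<open>D\<close> the result is the value at the \<open>D\<close>-division point \<open>a z\<close> of the
  Weierstrass function of the lattice \<open>\<int> D z + \<int>\<close>. It again converges absolutely and is modular of
  weight 2, and it expands to \<open>T(a) - T(0)\<close> up to constants. Summing this over all \<open>a\<close> modulo \<open>D\<close> expresses \<open>T(0)\<close> by a modular form
  and the sum over all \<open>m \<noteq> 0\<close>, and the latter is \<open>(1 - \<phi>) / 12\<close>. This is the only point at which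
  \<open>\<phi>\<close> enters (\<open>residue_class_sum_quasimodular\<close>).

  Modularity only needs that the matrices lie in \<open>\<plusminus>\<Gamma>\<^sub>1(D)\<close>: they map the lattice \<open>D\<int> \<times> \<int>\<close> to itself and
  change the shift \<open>(a, 0)\<close> by a lattice vector, up to a sign that is invisible because \<open>k\<close> is even.
  All groups in the theorem satisfy this for the level \<open>D\<close> that occurs. For holomorphy at the cusps no
  Fourier expansion is computed: every transform of a lattice sum is again a lattice sum, it is periodic,
  and it grows at most linearly in \<open>z\<close> towards \<open>\<i>\<infinity>\<close>, which already makes the singularity of the
  corresponding function of the nome removable (\<open>holomorphic_at_ii_infI\<close>).
\<close>

section \<open>Elementary symmetric functions and Newton's identities\<close>

definition elem_sym :: "('a \<Rightarrow> complex) \<Rightarrow> 'a set \<Rightarrow> nat \<Rightarrow> complex" where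
  "elem_sym x I k = (\<Sum>\<^sub>\<infinity>A\<in>{A. A \<subseteq> I \<and> finite A \<and> card A = k}. \<Prod>m\<in>A. x m)"

lemma fps_prod_nth_eq_sum_subsets:
  fixes x :: "'a \<Rightarrow> complex"
  assumes "finite J"
  shows "fps_nth (\<Prod>m\<in>J. 1 + fps_const (x m) * fps_X) k =
           (\<Sum>A\<in>{A. A \<subseteq> J \<and> finite A \<and> card A = k}. \<Prod>m\<in>A. x m)"
proof -
  have "(\<Prod>m\<in>J. 1 + fps_const (x m) * fps_X) = (\<Prod>m\<in>J. fps_const (x m) * fps_X + 1)"
    by (simp add: add.commute)
  also have "\<dots> = (\<Sum>A\<in>Pow J. \<Prod>m\<in>A. fps_const (x m) * fps_X)"
    by (subst prod_add) (use assms in auto)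
  also have "\<dots> = (\<Sum>A\<in>Pow J. fps_const (\<Prod>m\<in>A. x m) * fps_X ^ card A)"
  proof (intro sum.cong refl)
    fix A show "(\<Prod>m\<in>A. fps_const (x m) * fps_X) = fps_const (\<Prod>m\<in>A. x m) * fps_X ^ card A"
      by (induction A rule: infinite_finite_induct) (simp_all add: mult_ac flip: fps_const_mult)
  qed
  also have "fps_nth \<dots> k = (\<Sum>A\<in>Pow J. if card A = k then \<Prod>m\<in>A. x m else 0)"
    by (auto simp: fps_sum_nth fps_X_power_nth intro!: sum.cong)
  also have "\<dots> = (\<Sum>A\<in>{A \<in> Pow J. card A = k}. \<Prod>m\<in>A. x m)"
    using assms by (subst sum.inter_filter) auto
  also have "{A \<in> Pow J. card A = k} = {A. A \<subseteq> J \<and> finite A \<and> card A = k}"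
    using assms finite_subset by blast
  finally show ?thesis .
qed

text \<open>
  The logarithmic derivative of \<open>\<Prod>(1 + x\<^sub>m X)\<close> is \<open>\<Sum> x\<^sub>m / (1 + x\<^sub>m X)\<close>; the geometric series is
  written out in order to stay within power series. Comparing coefficients gives Newton's identities.
\<close>

lemma fps_deriv_prod_linear:
  fixes x :: "'a \<Rightarrow> complex"
  assumes "finite J"
  shows "fps_deriv (\<Prod>m\<in>J. 1 + fps_const (x m) * fps_X) =
           (\<Prod>m\<in>J. 1 + fps_const (x m) * fps_X) * (\<Sum>m\<in>J. Abs_fps (\<lambda>i. (-1) ^ i * x m ^ Suc i))"
  using assms
proof (induction J)
  case (insert y J)
  define E where "E = (\<Prod>m\<in>J. 1 + fps_const (x m) * fps_X)"
  define P where "P = (\<Sum>m\<in>J. Abs_fps (\<lambda>i. (-1) ^ i * x m ^ Suc i))"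
  define G where "G = Abs_fps (\<lambda>i. (-1) ^ i * x y ^ Suc i)"
  have G: "(1 + fps_const (x y) * fps_X) * G = fps_const (x y)"
  proof (rule fps_ext)
    fix n show "fps_nth ((1 + fps_const (x y) * fps_X) * G) n = fps_nth (fps_const (x y)) n"
      by (cases n) (simp_all add: ring_distribs mult.assoc G_def)
  qed
  have "fps_deriv ((1 + fps_const (x y) * fps_X) * E) =
          (1 + fps_const (x y) * fps_X) * (E * P) + E * fps_const (x y)"
    using insert.IH by (simp add: E_def P_def mult_ac)
  hence deriv: "fps_deriv ((1 + fps_const (x y) * fps_X) * E) =
                  ((1 + fps_const (x y) * fps_X) * E) * (G + P)"
    using G by algebra
  have prod_eq: "(\<Prod>m\<in>insert y J. 1 + fps_const (x m) * fps_X) = (1 + fps_const (x y) * fps_X) * E"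
    unfolding E_def using insert.hyps by (subst prod.insert) auto
  have sum_eq: "(\<Sum>m\<in>insert y J. Abs_fps (\<lambda>i. (-1) ^ i * x m ^ Suc i)) = G + P"
    unfolding P_def G_def using insert.hyps by (subst sum.insert) auto
  show ?case
    unfolding prod_eq sum_eq by (rule deriv)
qed auto

lemma newton_identity_finite:
  fixes x :: "'a \<Rightarrow> complex"
  assumes "finite J"
  shows "of_nat (Suc k) * (\<Sum>A\<in>{A. A \<subseteq> J \<and> finite A \<and> card A = Suc k}. \<Prod>m\<in>A. x m) =
           (\<Sum>i\<le>k. (\<Sum>A\<in>{A. A \<subseteq> J \<and> finite A \<and> card A = k - i}. \<Prod>m\<in>A. x m) *
                    ((-1) ^ i * (\<Sum>m\<in>J. x m ^ Suc i)))"
proof -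
  define E where "E = (\<Prod>m\<in>J. 1 + fps_const (x m) * fps_X)"
  have "of_nat (Suc k) * fps_nth E (Suc k) = fps_nth (fps_deriv E) k"
    by simp
  also have "\<dots> = (\<Sum>i\<le>k. fps_nth E (k - i) * ((-1) ^ i * (\<Sum>m\<in>J. x m ^ Suc i)))"
    unfolding E_def fps_deriv_prod_linear [OF assms]
    by (subst mult.commute, subst fps_mult_nth)
       (simp add: fps_sum_nth sum_distrib_left sum_distrib_right atMost_atLeast0 mult_ac)
  finally show ?thesis
    unfolding E_def fps_prod_nth_eq_sum_subsets [OF assms] .
qed

text \<open>
  A finite family of subsets of \<open>I\<close> lies in the power set of its finite union \<open>J\<close>, and the products over
  all subsets of \<open>J\<close> add up to \<open>\<Prod>(1 + \<bar>x\<^sub>m\<bar>) \<le> exp (\<Sum>\<bar>x\<^sub>m\<bar>)\<close>.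
\<close>

lemma summable_on_elem_sym:
  fixes x :: "'a \<Rightarrow> complex"
  assumes "(\<lambda>m. norm (x m)) summable_on I"
  shows "(\<lambda>A. \<Prod>m\<in>A. x m) summable_on {A. A \<subseteq> I \<and> finite A \<and> card A = k}"
proof -
  let ?S = "{A. A \<subseteq> I \<and> finite A \<and> card A = k}"
  have "(\<lambda>A. norm (\<Prod>m\<in>A. x m)) summable_on ?S"
  proof (rule nonneg_bdd_above_summable_on)
    show "bdd_above (sum (\<lambda>A. norm (\<Prod>m\<in>A. x m)) ` {F. F \<subseteq> ?S \<and> finite F})"
    proof (rule bdd_aboveI2)
      fix F assume "F \<in> {F. F \<subseteq> ?S \<and> finite F}"
      hence F: "F \<subseteq> ?S" "finite F" by auto
      define J where "J = \<Union>F"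
      have J: "finite J" "J \<subseteq> I" using F by (auto simp: J_def)
      have "(\<Sum>A\<in>F. norm (\<Prod>m\<in>A. x m)) \<le> (\<Sum>A\<in>Pow J. norm (\<Prod>m\<in>A. x m))"
        using J F by (intro sum_mono2) (auto simp: J_def)
      also have "\<dots> = (\<Prod>m\<in>J. norm (x m) + 1)"
        using J by (subst prod_add) (auto simp: prod_norm)
      also have "\<dots> \<le> (\<Prod>m\<in>J. exp (norm (x m)))"
        by (intro prod_mono conjI) (auto simp: exp_ge_add_one_self add.commute)
      also have "\<dots> = exp (\<Sum>m\<in>J. norm (x m))"
        using J by (simp add: exp_sum)
      also have "\<dots> \<le> exp (infsum (\<lambda>m. norm (x m)) I)"
        using finite_sum_le_infsum [OF assms J] by simp
      finally show "(\<Sum>A\<in>F. norm (\<Prod>m\<in>A. x m)) \<le> exp (infsum (\<lambda>m. norm (x m)) I)" .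
    qed
  qed auto
  thus ?thesis by (rule abs_summable_summable)
qed

text \<open>
  As \<open>J\<close> exhausts \<open>I\<close>, the \<open>k\<close>-subsets of \<open>J\<close> exhaust the \<open>k\<close>-subsets of \<open>I\<close>. This carries identities
  for finitely many variables over to infinitely many.
\<close>

lemma tendsto_elem_sym:
  fixes x :: "'a \<Rightarrow> complex"
  assumes "(\<lambda>m. norm (x m)) summable_on I"
  shows "((\<lambda>J. \<Sum>A\<in>{A. A \<subseteq> J \<and> finite A \<and> card A = k}. \<Prod>m\<in>A. x m) \<longlongrightarrow> elem_sym x I k)
           (finite_subsets_at_top I)"
proof -
  let ?S = "\<lambda>I. {A. A \<subseteq> I \<and> finite A \<and> card A = k}"
  have "((\<lambda>F. \<Sum>A\<in>F. \<Prod>m\<in>A. x m) \<longlongrightarrow> elem_sym x I k) (finite_subsets_at_top (?S I))"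
    unfolding elem_sym_def by (intro infsum_tendsto summable_on_elem_sym assms)
  moreover have "filterlim ?S (finite_subsets_at_top (?S I)) (finite_subsets_at_top I)"
    unfolding filterlim_iff
  proof (intro allI impI)
    fix P assume "eventually P (finite_subsets_at_top (?S I))"
    then obtain X where X: "finite X" "X \<subseteq> ?S I"
        "\<forall>Y. finite Y \<and> X \<subseteq> Y \<and> Y \<subseteq> ?S I \<longrightarrow> P Y"
      unfolding eventually_finite_subsets_at_top by (elim exE conjE)
    show "eventually (\<lambda>J. P (?S J)) (finite_subsets_at_top I)"
      unfolding eventually_finite_subsets_at_top
    proof (intro exI[of _ "\<Union>X"] conjI allI impI)
      show "finite (\<Union>X)" "\<Union>X \<subseteq> I" using X(1,2) by auto
      fix Y assume Y: "finite Y \<and> \<Union>X \<subseteq> Y \<and> Y \<subseteq> I"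
      show "P (?S Y)"
      proof (rule X(3) [rule_format], intro conjI)
        show "finite (?S Y)" by (rule finite_subset [of _ "Pow Y"]) (use Y in auto)
      qed (use X(2) Y in auto)
    qed
  qed
  ultimately show ?thesis
    by (rule filterlim_compose)
qed

theorem newton_identity:
  fixes x :: "'a \<Rightarrow> complex"
  assumes "(\<lambda>m. norm (x m)) summable_on I"
  shows "of_nat (Suc k) * elem_sym x I (Suc k) =
           (\<Sum>i\<le>k. elem_sym x I (k - i) * ((-1) ^ i * (\<Sum>\<^sub>\<infinity>m\<in>I. x m ^ Suc i)))"
proof -
  have power_summable: "(\<lambda>m. x m ^ Suc i) summable_on I" for i
  proof -
    define B where "B = infsum (\<lambda>m. norm (x m)) I"
    have le: "norm (x m) \<le> B" if "m \<in> I" for m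
      using finite_sum_le_infsum [OF assms, of "{m}"] that by (simp add: B_def)
    have "(\<lambda>m. norm (x m) * B ^ i) summable_on I"
      by (intro summable_on_cmult_left assms)
    hence "(\<lambda>m. norm (x m ^ Suc i)) summable_on I"
      by (rule Infinite_Sum.abs_summable_on_comparison_test')
         (use le in \<open>auto simp: norm_mult norm_power intro!: mult_left_mono power_mono\<close>)
    thus ?thesis by (rule abs_summable_summable)
  qed
  let ?e = "\<lambda>k J. \<Sum>A\<in>{A. A \<subseteq> J \<and> finite A \<and> card A = k}. \<Prod>m\<in>A. x m"
  have "((\<lambda>J. of_nat (Suc k) * ?e (Suc k) J) \<longlongrightarrow> of_nat (Suc k) * elem_sym x I (Suc k))
          (finite_subsets_at_top I)"
    by (intro tendsto_intros tendsto_elem_sym assms)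
  moreover have "((\<lambda>J. \<Sum>i\<le>k. ?e (k - i) J * ((-1) ^ i * (\<Sum>m\<in>J. x m ^ Suc i))) \<longlongrightarrow>
       (\<Sum>i\<le>k. elem_sym x I (k - i) * ((-1) ^ i * (\<Sum>\<^sub>\<infinity>m\<in>I. x m ^ Suc i))))
          (finite_subsets_at_top I)"
    by (intro tendsto_intros tendsto_elem_sym assms infsum_tendsto power_summable)
  moreover have "eventually (\<lambda>J. of_nat (Suc k) * ?e (Suc k) J =
        (\<Sum>i\<le>k. ?e (k - i) J * ((-1) ^ i * (\<Sum>m\<in>J. x m ^ Suc i)))) (finite_subsets_at_top I)"
    by (intro eventually_finite_subsets_at_top_weakI newton_identity_finite)
  ultimately show ?thesis
    using tendsto_cong tendsto_unique [OF finite_subsets_at_top_neq_bot] by fast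
qed

lemma elem_sym_0 [simp]: "elem_sym x I 0 = 1"
proof -
  have "{A. A \<subseteq> I \<and> finite A \<and> card A = 0} = {{}}"
    by auto
  thus ?thesis by (simp add: elem_sym_def)
qed

text \<open>
  A strictly increasing tuple is determined by its set of entries.
\<close>

lemma mac_sum_eq_elem_sym:
  "mac_sum S N \<epsilon> k q =
     elem_sym (\<lambda>m. \<epsilon> * q ^ m / (1 - \<epsilon> * q ^ m)\<^sup>2) {m. 0 < m \<and> (\<exists>s\<in>S. [m = s] (mod N))} k"
proof -
  let ?x = "\<lambda>m. \<epsilon> * q ^ m / (1 - \<epsilon> * q ^ m)\<^sup>2"
  let ?I = "{m. 0 < m \<and> (\<exists>s\<in>S. [m = s] (mod N))}"
  have term_eq: "\<epsilon> ^ k * q ^ sum_list ms / (\<Prod>m\<leftarrow>ms. (1 - \<epsilon> * q ^ m)\<^sup>2) = (\<Prod>m\<in>set ms. ?x m)"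
    if "ms \<in> mac_tuples S N k" for ms
  proof -
    have "length ms = k" "distinct ms"
      using that by (auto simp: mac_tuples_def strict_sorted_iff)
    moreover have "\<epsilon> ^ length ms * q ^ sum_list ms / (\<Prod>m\<leftarrow>ms. (1 - \<epsilon> * q ^ m)\<^sup>2) = (\<Prod>m\<leftarrow>ms. ?x m)"
    proof (induction ms)
      case (Cons m ms)
      have "\<epsilon> ^ length (m # ms) * q ^ sum_list (m # ms) / (\<Prod>m\<leftarrow>m # ms. (1 - \<epsilon> * q ^ m)\<^sup>2) =
              ?x m * (\<epsilon> ^ length ms * q ^ sum_list ms / (\<Prod>m\<leftarrow>ms. (1 - \<epsilon> * q ^ m)\<^sup>2))"
        by (simp add: power_add)
      thus ?case using Cons.IH by simp
    qed auto
    ultimately show ?thesis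
      by (simp add: prod.distinct_set_conv_list)
  qed
  have "bij_betw set (mac_tuples S N k) {A. A \<subseteq> ?I \<and> finite A \<and> card A = k}"
  proof (rule bij_betwI [where g = sorted_list_of_set])
    show "set \<in> mac_tuples S N k \<rightarrow> {A. A \<subseteq> ?I \<and> finite A \<and> card A = k}"
      by (auto simp: mac_tuples_def strict_sorted_iff distinct_card)
    show "sorted_list_of_set \<in> {A. A \<subseteq> ?I \<and> finite A \<and> card A = k} \<rightarrow> mac_tuples S N k"
      by (auto simp: mac_tuples_def)
  qed (auto simp: mac_tuples_def strict_sorted_iff sorted_list_of_set.idem_if_sorted_distinct)
  hence "elem_sym ?x ?I k = (\<Sum>\<^sub>\<infinity>ms\<in>mac_tuples S N k. \<Prod>m\<in>set ms. ?x m)"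
    unfolding elem_sym_def by (rule infsum_reindex_bij_betw [symmetric])
  also have "\<dots> = mac_sum S N \<epsilon> k q"
    unfolding mac_sum_def by (intro infsum_cong) (simp add: term_eq)
  finally show ?thesis ..
qed

section \<open>Polylogarithms of negative order\<close>

text \<open>
  For \<open>i > 0\<close> this is the polylogarithm of order \<open>-i\<close>; for \<open>i = 0\<close> the term \<open>n = 0\<close> makes it \<open>1 / (1 - t)\<close>.
\<close>

definition polylog_neg :: "nat \<Rightarrow> complex \<Rightarrow> complex" where
  "polylog_neg i t = (\<Sum>n. of_nat n ^ i * t ^ n)"

lemma summable_power_times_powser:
  fixes t :: "'a :: {real_normed_field, banach}"
  assumes "norm t < 1"
  shows "summable (\<lambda>n. of_nat n ^ i * t ^ n)"
  using assms
proof (induction i arbitrary: t)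
  case 0
  thus ?case by (simp add: summable_geometric)
next
  case (Suc i)
  let ?c = "\<lambda>n. of_nat n ^ i :: 'a"
  have "summable (\<lambda>n. diffs ?c n * t ^ n)"
    by (rule termdiff_converges [of _ 1]) (use Suc in auto)
  hence "summable (\<lambda>n. of_nat n * ?c n * t ^ (n - Suc 0))"
    using diffs_equiv sums_summable by blast
  hence "summable (\<lambda>n. t * (of_nat n * ?c n * t ^ (n - Suc 0)))"
    by (rule summable_mult)
  also have "(\<lambda>n. t * (of_nat n * ?c n * t ^ (n - Suc 0))) = (\<lambda>n. of_nat n ^ Suc i * t ^ n)"
  proof
    fix n show "t * (of_nat n * ?c n * t ^ (n - Suc 0)) = of_nat n ^ Suc i * t ^ n"
      by (cases n) (auto simp: mult_ac)
  qed
  finally show ?case .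
qed

lemma polylog_neg_sums: "norm t < 1 \<Longrightarrow> (\<lambda>n. of_nat n ^ i * t ^ n) sums polylog_neg i t"
  unfolding polylog_neg_def by (intro summable_sums summable_power_times_powser)

lemma polylog_neg_has_sum:
  assumes "norm t < 1" "i > 0"
  shows "((\<lambda>n. of_nat n ^ i * t ^ n) has_sum polylog_neg i t) {1..}"
proof -
  have "((\<lambda>n. of_nat n ^ i * t ^ n) has_sum polylog_neg i t) UNIV"
  proof (rule norm_summable_imp_has_sum)
    have "summable (\<lambda>n. of_nat n ^ i * norm t ^ n)"
      by (rule summable_power_times_powser) (use assms in auto)
    thus "summable (\<lambda>n. norm (of_nat n ^ i * t ^ n))"
      by (simp add: norm_mult norm_power)
  qed (use polylog_neg_sums assms in auto)
  also have "?this \<longleftrightarrow> ?thesis"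
    by (rule has_sum_cong_neutral) (use assms in \<open>auto simp: Suc_le_eq\<close>)
  finally show ?thesis .
qed

text \<open>
  The operator \<open>t d/dt\<close> raises \<open>i\<close> by one. In the coordinate \<open>t = exp (c u)\<close> it is an ordinary
  derivative, which is the form needed both for \<open>t = exp u\<close> and for the nome.
\<close>

lemma polylog_neg_exp_has_field_derivative:
  assumes "norm (exp (c * u)) < 1"
  shows "((\<lambda>u. polylog_neg i (exp (c * u))) has_field_derivative c * polylog_neg (Suc i) (exp (c * u))) (at u)"
proof -
  define t where "t = exp (c * u)"
  have t: "norm t < 1" using assms by (simp add: t_def)
  let ?c = "\<lambda>n. of_nat n ^ i :: complex"
  define D where "D = (\<Sum>n. diffs ?c n * t ^ n)"
  have der: "((\<lambda>t. \<Sum>n. ?c n * t ^ n) has_field_derivative D) (at t)"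
    unfolding D_def by (rule termdiffs_strong' [of 1]) (use t summable_power_times_powser in auto)
  have "summable (\<lambda>n. diffs ?c n * t ^ n)"
    by (rule termdiff_converges [of _ 1]) (use t summable_power_times_powser in auto)
  hence "(\<lambda>n. of_nat n * ?c n * t ^ (n - Suc 0)) sums D"
    unfolding D_def by (rule diffs_equiv)
  hence "(\<lambda>n. t * (of_nat n * ?c n * t ^ (n - Suc 0))) sums (t * D)"
    by (rule sums_mult)
  also have "(\<lambda>n. t * (of_nat n * ?c n * t ^ (n - Suc 0))) = (\<lambda>n. of_nat n ^ Suc i * t ^ n)"
  proof
    fix n show "t * (of_nat n * ?c n * t ^ (n - Suc 0)) = of_nat n ^ Suc i * t ^ n"
      by (cases n) (auto simp: mult_ac)
  qed
  finally have D: "t * D = polylog_neg (Suc i) t"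
    using polylog_neg_sums [OF t] sums_unique2 by blast
  have "((\<lambda>u. polylog_neg i (exp (c * u))) has_field_derivative (D * (exp (c * u) * c))) (at u)"
    unfolding polylog_neg_def
    by (rule DERIV_chain2 [where f = "\<lambda>t. \<Sum>n. of_nat n ^ i * t ^ n" and g = "\<lambda>u. exp (c * u)"])
       (use der in \<open>auto simp: t_def intro!: derivative_eq_intros\<close>)
  also have "D * (exp (c * u) * c) = c * (t * D)"
    by (simp add: t_def)
  finally show ?thesis using D by (simp add: t_def)
qed

lemma polylog_neg_1: 
  assumes "norm t < 1"
  shows "polylog_neg 1 t = t / (1 - t)\<^sup>2"
proof -
  have "(\<lambda>n. t * (of_nat (Suc n) * t ^ n)) sums (t * (1 / (1 - t)\<^sup>2))"
    by (intro sums_mult geometric_deriv_sums assms)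
  hence "(\<lambda>n. of_nat (Suc n) * t ^ Suc n) sums (t / (1 - t)\<^sup>2)"
    by (simp add: mult_ac)
  hence "(\<lambda>n. of_nat n * t ^ n) sums (t / (1 - t)\<^sup>2)"
    by (subst (asm) sums_Suc_iff) simp
  thus ?thesis using polylog_neg_sums [OF assms, of 1] sums_unique2 by simp blast
qed

lemma polylog_neg_0_right [simp]: "i > 0 \<Longrightarrow> polylog_neg i 0 = 0"
  unfolding polylog_neg_def by (subst suminf_finite [of "{0}"]) auto

text \<open>
  In the coordinate \<open>t = exp u\<close>, \<open>f = t / (1 - t)\<^sup>2\<close> and \<open>g = (1 + t) / (1 - t)\<close> satisfy \<open>f' = f g\<close>,
  \<open>g' = 2 f\<close> and \<open>g\<^sup>2 = 1 + 4 f\<close>, so that \<open>(f\<^sup>r)'' = r\<^sup>2 f\<^sup>r + 2 r (2 r + 1) f\<^sup>r\<^sup>+\<^sup>1\<close>. Two derivatives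
  raise the index of the polylogarithm by 2, which preserves its parity.
\<close>

lemma power_polylog_neg_1_eq_combination:
  assumes "r > 0"
  shows "\<exists>c. \<forall>t. norm t < 1 \<longrightarrow> (t / (1 - t)\<^sup>2) ^ r = (\<Sum>j<r. c j * polylog_neg (2 * j + 1) t)"
  using assms
proof (induction r rule: nat_induct_non_zero)
  case 1
  show ?case by (intro exI [of _ "\<lambda>_. 1"]) (auto simp: polylog_neg_1 [unfolded One_nat_def])
next
  case (Suc r)
  then obtain c where c: "\<And>t. norm t < 1 \<Longrightarrow> (t / (1 - t)\<^sup>2) ^ r = (\<Sum>j<r. c j * polylog_neg (2 * j + 1) t)"
    by auto
  define f where "f = (\<lambda>u::complex. exp u / (1 - exp u)\<^sup>2)"
  define g where "g = (\<lambda>u::complex. (1 + exp u) / (1 - exp u))"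
  have neq: "1 - exp u \<noteq> 0" if "Re u < 0" for u :: complex
    using that by (metis eq_iff_diff_eq_0 norm_exp_eq_Re norm_one exp_less_one_iff less_irrefl)
  have f': "(f has_field_derivative f u * g u) (at u)" if "Re u < 0" for u
  proof -
    define E d where "E = exp u" and "d = 1 - exp u"
    have d: "d \<noteq> 0" "E = 1 - d" using neq [OF that] by (auto simp: E_def d_def)
    have "(f has_field_derivative (E * d\<^sup>2 - E * (2 * d * (- E))) / (d\<^sup>2 * d\<^sup>2)) (at u)"
      unfolding f_def E_def d_def using neq [OF that]
      by (auto intro!: derivative_eq_intros simp: power2_eq_square)
    also have "(E * d\<^sup>2 - E * (2 * d * (- E))) / (d\<^sup>2 * d\<^sup>2) = E / d\<^sup>2 * ((1 + E) / d)"
      using d(1) unfolding d(2) by (simp add: divide_simps) algebra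
    finally show ?thesis by (simp add: f_def g_def E_def d_def)
  qed
  have g': "(g has_field_derivative 2 * f u) (at u)" if "Re u < 0" for u
  proof -
    define E d where "E = exp u" and "d = 1 - exp u"
    have d: "d \<noteq> 0" "E = 1 - d" using neq [OF that] by (auto simp: E_def d_def)
    have "(g has_field_derivative (E * d - (1 + E) * (- E)) / (d * d)) (at u)"
      unfolding g_def E_def d_def using neq [OF that]
      by (auto intro!: derivative_eq_intros)
    also have "(E * d - (1 + E) * (- E)) / (d * d) = 2 * (E / d\<^sup>2)"
      using d(1) unfolding d(2) by (simp add: divide_simps) algebra
    finally show ?thesis by (simp add: f_def E_def d_def)
  qed
  have g_sq: "g u ^ 2 = 1 + 4 * f u" if "Re u < 0" for u
    proof -
    define d where "d = 1 - exp u"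
    have d: "d \<noteq> 0" "exp u = 1 - d" using neq [OF that] by (auto simp: d_def)
    show ?thesis unfolding f_def g_def d(2) using d(1) by (simp add: divide_simps) algebra
  qed
  have op: "open {u::complex. Re u < 0}"
    by (rule open_halfspace_Re_lt)
  let ?S = "\<lambda>k u. \<Sum>j<r. c j * polylog_neg (2 * j + 1 + k) (exp u)"
  have S': "(?S k has_field_derivative ?S (Suc k) u) (at u)" if "Re u < 0" for k u
  proof -
    have "((\<lambda>u. polylog_neg (2 * j + 1 + k) (exp u)) has_field_derivative polylog_neg (Suc (2 * j + 1 + k)) (exp u)) (at u)" for j
      using polylog_neg_exp_has_field_derivative [of 1 u "2 * j + 1 + k"] that by simp
    hence "((\<lambda>u. c j * polylog_neg (2 * j + 1 + k) (exp u)) has_field_derivative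
             c j * polylog_neg (2 * j + 1 + Suc k) (exp u)) (at u)" for j
      by (intro DERIV_cmult) simp
    thus ?thesis by (intro DERIV_sum)
  qed
  have fr: "f u ^ r = ?S 0 u" if "Re u < 0" for u
    using c [of "exp u"] that by (simp add: f_def)
  have pow': "((\<lambda>u. f u ^ r) has_field_derivative of_nat r * f u ^ r * g u) (at u)" if "Re u < 0" for u
  proof -
    have "f u ^ r = f u ^ (r - Suc 0) * f u"
      using Suc.hyps by (metis power_minus_mult One_nat_def)
    thus ?thesis
      using DERIV_power [OF f' [OF that], of r] by (simp add: mult_ac)
  qed
  have fr1: "of_nat r * f u ^ r * g u = ?S 1 u" if "Re u < 0" for u
  proof (rule DERIV_unique [OF pow' [OF that]])
    show "((\<lambda>u. f u ^ r) has_field_derivative ?S 1 u) (at u)"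
      by (rule has_field_derivative_transform_within_open [OF _ op])
         (use S' [of u 0] that fr in auto)
  qed
  have fr2: "of_nat r * (of_nat r * f u ^ r * g u) * g u + of_nat r * f u ^ r * (2 * f u) = ?S 2 u"
    if "Re u < 0" for u
  proof (rule DERIV_unique)
    show "((\<lambda>u. of_nat r * f u ^ r * g u) has_field_derivative
            of_nat r * (of_nat r * f u ^ r * g u) * g u + of_nat r * f u ^ r * (2 * f u)) (at u)"
      using DERIV_mult [OF DERIV_cmult [OF pow' [OF that], of "of_nat r"] g' [OF that]]
      by (simp add: algebra_simps)
    show "((\<lambda>u. of_nat r * f u ^ r * g u) has_field_derivative ?S 2 u) (at u)"
      by (rule has_field_derivative_transform_within_open [OF _ op])
         (use S' [of u 1] that fr1 in \<open>auto simp: numeral_2_eq_2\<close>)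
  qed
  \<comment> \<open>solving the second derivative of the inductive hypothesis for the next power\<close>
  define K :: complex where "K = 1 / (2 * of_nat r * (2 * of_nat r + 1))"
  define c' where "c' = (\<lambda>j. K * ((if j = 0 then 0 else c (j - 1)) - (if j < r then of_nat r ^ 2 * c j else 0)))"
  have K: "K * (2 * of_nat r * (2 * of_nat r + 1)) = 1"
  proof -
    have "2 * of_nat r + 1 \<noteq> (0::complex)"
      by (metis of_nat_1 of_nat_add of_nat_eq_0_iff of_nat_mult of_nat_numeral add_is_0 one_neq_zero)
    thus ?thesis using Suc.hyps by (simp add: K_def)
  qed
  show ?case
  proof (intro exI [of _ c'] allI impI)
    fix t :: complex assume t: "norm t < 1"
    show "(t / (1 - t)\<^sup>2) ^ Suc r = (\<Sum>j<Suc r. c' j * polylog_neg (2 * j + 1) t)"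
    proof (cases "t = 0")
      case False
      then obtain u where u: "t = exp u" by (metis exp_Ln)
      have Re: "Re u < 0" using t by (simp add: u)
      have "?S 2 u - of_nat r ^ 2 * ?S 0 u =
              of_nat r ^ 2 * f u ^ r * (g u ^ 2 - 1) + 2 * of_nat r * f u ^ Suc r"
        unfolding fr2 [OF Re, symmetric] fr [OF Re, symmetric]
        by (simp add: algebra_simps power2_eq_square)
      also have "\<dots> = 2 * of_nat r * (2 * of_nat r + 1) * f u ^ Suc r"
        unfolding g_sq [OF Re] by (simp add: algebra_simps power2_eq_square)
      finally have "K * (?S 2 u - of_nat r ^ 2 * ?S 0 u) = (K * (2 * of_nat r * (2 * of_nat r + 1))) * f u ^ Suc r"
        by (simp only: mult.assoc)
      hence eq: "f u ^ Suc r = K * (?S 2 u - of_nat r ^ 2 * ?S 0 u)"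
        unfolding K by simp
      have "(\<Sum>j<Suc r. c' j * polylog_neg (2 * j + 1) t) =
              K * ((\<Sum>j<Suc r. (if j = 0 then 0 else c (j - 1)) * polylog_neg (2 * j + 1) t) -
                   (\<Sum>j<Suc r. (if j < r then of_nat r ^ 2 * c j else 0) * polylog_neg (2 * j + 1) t))"
        by (simp add: c'_def sum_distrib_left sum_subtractf algebra_simps)
      also have "(\<Sum>j<Suc r. (if j = 0 then 0 else c (j - 1)) * polylog_neg (2 * j + 1) t) = ?S 2 u"
        by (subst sum.lessThan_Suc_shift) (simp add: u)
      also have "(\<Sum>j<Suc r. (if j < r then of_nat r ^ 2 * c j else 0) * polylog_neg (2 * j + 1) t) =
                   of_nat r ^ 2 * ?S 0 u"
        by (simp add: u sum_distrib_left mult_ac)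
      finally show ?thesis using eq by (simp add: f_def u)
    qed auto
  qed
qed

text \<open>
  Adding the series at \<open>t\<close> and \<open>-t\<close> kills the odd \<open>n\<close> and doubles the even ones, for which
  \<open>(2 n)\<^sup>i t\<^sup>2\<^sup>n = 2\<^sup>i n\<^sup>i (t\<^sup>2)\<^sup>n\<close>.
\<close>

lemma polylog_neg_minus:
  assumes "norm t < 1"
  shows "polylog_neg i (-t) = 2 ^ Suc i * polylog_neg i (t\<^sup>2) - polylog_neg i t"
proof -
  have t2: "norm (t\<^sup>2) < 1"
    using assms by (simp add: norm_power power_less_one_iff)
  have "(\<lambda>n. 2 ^ Suc i * (of_nat n ^ i * (t\<^sup>2) ^ n)) sums (2 ^ Suc i * polylog_neg i (t\<^sup>2))"
    by (intro sums_mult polylog_neg_sums t2)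
  also have "(\<lambda>n. 2 ^ Suc i * (of_nat n ^ i * (t\<^sup>2) ^ n)) =
               (\<lambda>n. of_nat (2 * n) ^ i * t ^ (2 * n) + of_nat (2 * n) ^ i * (-t) ^ (2 * n))"
    by (simp add: power_mult_distrib mult_ac flip: power_mult)
  finally have "(\<lambda>n. of_nat n ^ i * t ^ n + of_nat n ^ i * (-t) ^ n) sums (2 ^ Suc i * polylog_neg i (t\<^sup>2))"
  proof (subst (asm) sums_mono_reindex)
    fix n :: nat assume "n \<notin> range (\<lambda>n. 2 * n)"
    hence "odd n" by (auto elim: evenE)
    thus "of_nat n ^ i * t ^ n + of_nat n ^ i * (-t) ^ n = 0" by simp
  qed (auto simp: strict_mono_def)
  moreover have "(\<lambda>n. of_nat n ^ i * t ^ n + of_nat n ^ i * (-t) ^ n) sums (polylog_neg i t + polylog_neg i (-t))"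
    by (intro sums_add polylog_neg_sums) (use assms in auto)
  ultimately show ?thesis
    using sums_unique2 by (fastforce simp: algebra_simps)
qed

text \<open>
  For \<open>i > 0\<close> the series starts with the term \<open>t\<close>. The bound makes sums over \<open>t = q\<^sup>m\<close> converge.
\<close>

lemma norm_polylog_neg_le:
  assumes "i > 0" "0 \<le> \<rho>" "\<rho> < 1"
  shows "\<exists>C\<ge>0. \<forall>t. norm t \<le> \<rho> \<longrightarrow> norm (polylog_neg i t) \<le> C * norm t"
proof -
  have summ: "summable (\<lambda>n. of_nat n ^ i * \<rho> ^ n)" 
    by (rule summable_power_times_powser) (use assms in auto)
  define a where "a = (\<lambda>n. real (Suc n) ^ i * \<rho> ^ n)"
  have a: "summable a"
  proof (cases "\<rho> = 0")
    case True
    thus ?thesis unfolding a_def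
      by (intro summable_finite [of "{0}"]) auto
  next
    case False
    have "summable (\<lambda>n. inverse \<rho> * (real (Suc n) ^ i * \<rho> ^ Suc n))"
      using summ by (intro summable_mult) (subst summable_Suc_iff)
    also have "(\<lambda>n. inverse \<rho> * (real (Suc n) ^ i * \<rho> ^ Suc n)) = a"
      using False by (auto simp: a_def)
    finally show ?thesis .
  qed
  show ?thesis
  proof (intro exI [of _ "suminf a"] conjI allI impI)
    show "suminf a \<ge> 0" using a by (intro suminf_nonneg) (auto simp: a_def assms)
    fix t :: complex assume t: "norm t \<le> \<rho>"
    have "(\<lambda>n. of_nat n ^ i * t ^ n) sums polylog_neg i t"
      by (intro polylog_neg_sums) (use t assms in auto)
    hence "(\<lambda>n. of_nat (Suc n) ^ i * t ^ Suc n) sums polylog_neg i t"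
      by (subst sums_Suc_iff) (use assms in \<open>auto simp: zero_power\<close>)
    hence eq: "polylog_neg i t = (\<Sum>n. of_nat (Suc n) ^ i * t ^ Suc n)"
      by (simp add: sums_iff)
    have "norm (polylog_neg i t) \<le> (\<Sum>n. norm t * a n)"
      unfolding eq
    proof (rule norm_suminf_le)
      fix n
      have "norm (of_nat (Suc n) ^ i * t ^ Suc n) = norm t * (real (Suc n) ^ i * norm t ^ n)"
        by (simp only: norm_mult norm_power norm_of_nat power_Suc mult_ac)
      also have "\<dots> \<le> norm t * a n"
        unfolding a_def by (intro mult_left_mono power_mono t) auto
      finally show "norm (of_nat (Suc n) ^ i * t ^ Suc n) \<le> norm t * a n" .
    qed (intro summable_mult a)
    thus "norm (polylog_neg i t) \<le> suminf a * norm t"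
      using a by (simp add: suminf_mult mult.commute)
  qed
qed

lemma abs_summable_polylog_neg_power:
  assumes "norm q < 1" "i > 0" "I \<subseteq> {0<..}" "norm \<epsilon> = 1"
  shows "(\<lambda>m. norm (polylog_neg i (\<epsilon> * q ^ m))) summable_on I"
proof -
  obtain C where C: "C \<ge> 0" "\<And>t. norm t \<le> norm q \<Longrightarrow> norm (polylog_neg i t) \<le> C * norm t"
    using norm_polylog_neg_le [of i "norm q"] assms by auto
  have "(\<lambda>m. norm q ^ m) summable_on (UNIV :: nat set)"
    by (intro norm_summable_imp_summable_on) (use assms in \<open>auto simp: norm_power\<close>)
  hence "(\<lambda>m. C * norm q ^ m) summable_on I"
    by (intro summable_on_cmult_right) (auto intro: summable_on_subset)
  thus ?thesis
  proof (rule Infinite_Sum.abs_summable_on_comparison_test')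
    fix m assume m: "m \<in> I"
    have "norm q ^ m \<le> norm q ^ 1"
      using m assms by (intro power_decreasing) auto
    thus "norm (polylog_neg i (\<epsilon> * q ^ m)) \<le> C * norm q ^ m"
      using C(2) [of "\<epsilon> * q ^ m"] assms by (simp add: norm_mult norm_power)
  qed
qed

text \<open>
  The Lambert series of the divisor sum: collect the pairs \<open>(m, d)\<close> by their product \<open>n = m d\<close>.
\<close>

lemma infsum_divisor_sum_eq_polylog_neg:
  assumes "norm q < 1"
  shows "(\<Sum>\<^sub>\<infinity>n\<in>{1..}. of_nat (\<Sum>d | d dvd n. d) * q ^ n) = (\<Sum>\<^sub>\<infinity>m\<in>{1..}. polylog_neg 1 (q ^ m))"
proof -
  let ?f = "\<lambda>(m, d). of_nat d * q ^ (m * d) :: complex"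
  have inner: "((\<lambda>d. ?f (m, d)) has_sum polylog_neg 1 (q ^ m)) {1..}" if "m \<ge> 1" for m
    using polylog_neg_has_sum [of "q ^ m" 1] assms that
    by (simp add: norm_power power_less_one_iff flip: power_mult)
  have norm_inner: "((\<lambda>d. norm (?f (m, d))) has_sum Re (polylog_neg 1 (of_real (norm q ^ m)))) {1..}" if "m \<ge> 1" for m
  proof -
    have "((\<lambda>d. of_nat d ^ 1 * of_real (norm q ^ m) ^ d) has_sum polylog_neg 1 (of_real (norm q ^ m))) {1..}"
      by (rule polylog_neg_has_sum) (use assms that in \<open>auto simp: norm_power power_less_one_iff\<close>)
    hence "((\<lambda>d. Re (of_nat d ^ 1 * of_real (norm q ^ m) ^ d)) has_sum Re (polylog_neg 1 (of_real (norm q ^ m)))) {1..}"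
      by (rule has_sum_Re)
    also have "(\<lambda>d. Re (of_nat d ^ 1 * of_real (norm q ^ m) ^ d)) = (\<lambda>d. norm (?f (m, d)))"
      by (simp add: norm_mult norm_power power_mult flip: of_real_power)
    finally show ?thesis .
  qed
  have "(\<lambda>p. norm (?f p)) summable_on {1..} \<times> {1..}"
  proof (rule summable_on_SigmaI)
    have "(\<lambda>m. polylog_neg 1 (1 * of_real (norm q) ^ m)) summable_on {1..}"
      by (rule abs_summable_summable, rule abs_summable_polylog_neg_power) (use assms in auto)
    thus "(\<lambda>m. Re (polylog_neg 1 (of_real (norm q ^ m)))) summable_on {1..}"
      by (intro summable_on_Re) simp
  qed (use norm_inner in auto)
  hence summ: "?f summable_on {1..} \<times> {1..}" by (rule abs_summable_summable)
  have "(\<Sum>\<^sub>\<infinity>m\<in>{1..}. polylog_neg 1 (q ^ m)) = (\<Sum>\<^sub>\<infinity>m\<in>{1..}. \<Sum>\<^sub>\<infinity>d\<in>{1..}. ?f (m, d))"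
    by (intro infsum_cong infsumI [symmetric] inner) auto
  also have "\<dots> = infsum ?f ({1..} \<times> {1..})"
    using infsum_Sigma_banach [OF summ] by simp
  finally have "(\<Sum>\<^sub>\<infinity>m\<in>{1..}. polylog_neg 1 (q ^ m)) = infsum ?f ({1..} \<times> {1..})" .
  have dvd_facts: "d \<ge> 1" "n div d \<ge> 1" "n div d * d = n" if "n \<ge> 1" "d dvd n" for n d :: nat
    using that by (auto simp: Suc_le_eq dvd_pos_nat elim!: dvdE)
  note \<open>(\<Sum>\<^sub>\<infinity>m\<in>{1..}. polylog_neg 1 (q ^ m)) = infsum ?f ({1..} \<times> {1..})\<close>
  also have "infsum ?f ({1..} \<times> {1..}) = infsum (\<lambda>(n, d). of_nat d * q ^ n) (Sigma {1..} (\<lambda>n. {d. d dvd n}))"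
    by (rule infsum_reindex_bij_witness [where j = "\<lambda>(m, d). (m * d, d)" and i = "\<lambda>(n, d). (n div d, d)"])
       (use dvd_facts in \<open>force simp: Suc_le_eq\<close>)+
  also have "\<dots> = (\<Sum>\<^sub>\<infinity>n\<in>{1..}. \<Sum>\<^sub>\<infinity>d\<in>{d. d dvd n}. of_nat d * q ^ n)"
  proof (rule infsum_Sigma'_banach [symmetric])
    show "(\<lambda>(n, d). of_nat d * q ^ n) summable_on (Sigma {1..} (\<lambda>n. {d. d dvd n}))"
      by (rule summable_on_reindex_bij_witness [where j = "\<lambda>(m, d). (m * d, d)" and i = "\<lambda>(n, d). (n div d, d)", THEN iffD1, OF _ _ _ _ _ summ])
       (use dvd_facts in \<open>force simp: Suc_le_eq\<close>)+
  qed
  also have "\<dots> = (\<Sum>\<^sub>\<infinity>n\<in>{1..}. of_nat (\<Sum>d | d dvd n. d) * q ^ n)"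
    by (intro infsum_cong) (simp add: sum_distrib_right)
  finally show ?thesis ..
qed

section \<open>The Lipschitz formula\<close>

text \<open>
  The constant is uniform on a half-strip, so that it serves both for local uniform convergence and for the
  behaviour towards \<open>\<i>\<infinity>\<close>: \<open>\<bar>x\<bar>\<close> is controlled by the imaginary part, and then \<open>\<bar>y\<bar>\<close> by the real part.
\<close>

lemma norm_linear_form_lower_bound:
  assumes "\<epsilon> > 0" "R \<ge> 0"
  shows "\<exists>c>0. \<forall>z x y. Im z \<ge> \<epsilon> \<longrightarrow> \<bar>Re z\<bar> \<le> R \<longrightarrow>
           c * (\<bar>x\<bar> + \<bar>y\<bar>) \<le> norm (of_real x * z + of_real y)"
proof (intro exI conjI allI impI)
  define K where "K = 1 / \<epsilon> + 1 + R / \<epsilon>"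
  show K: "1 / K > 0" unfolding K_def using assms by (simp add: add_pos_nonneg)
  fix z :: complex and x y :: real assume z: "Im z \<ge> \<epsilon>" "\<bar>Re z\<bar> \<le> R"
  define w where "w = of_real x * z + of_real y"
  have "\<bar>x\<bar> * \<epsilon> \<le> \<bar>x\<bar> * Im z"
    using z by (intro mult_left_mono) auto
  also have "\<dots> = \<bar>Im w\<bar>" using z assms by (simp add: w_def abs_mult)
  also have "\<dots> \<le> norm w" by (rule abs_Im_le_cmod)
  finally have 1: "\<bar>x\<bar> \<le> norm w / \<epsilon>" using assms by (simp add: field_simps)
  have "\<bar>y\<bar> \<le> \<bar>Re w\<bar> + \<bar>x * Re z\<bar>" by (simp add: w_def)
  also have "\<dots> \<le> norm w + \<bar>x\<bar> * R"
    unfolding abs_mult by (intro add_mono abs_Re_le_cmod mult_left_mono z) auto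
  also have "\<dots> \<le> norm w + norm w / \<epsilon> * R"
    using 1 assms by (intro add_mono mult_right_mono) auto
  finally have "\<bar>x\<bar> + \<bar>y\<bar> \<le> norm w * K"
    using 1 by (simp add: K_def algebra_simps)
  thus "1 / K * (\<bar>x\<bar> + \<bar>y\<bar>) \<le> norm (of_real x * z + of_real y)"
    using K by (simp add: w_def field_simps)
qed

lemma has_sum_int_split:
  fixes f :: "int \<Rightarrow> 'a :: topological_comm_monoid_add"
  assumes "((\<lambda>n::nat. f (int n)) has_sum a) UNIV" "((\<lambda>n::nat. f (- int (Suc n))) has_sum b) UNIV"
  shows "(f has_sum (a + b)) UNIV"
proof -
  have "(f has_sum a) (range int)"
    using assms(1) by (subst has_sum_reindex) (auto simp: o_def)
  moreover have "(f has_sum b) (range (\<lambda>n. - int (Suc n)))"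
    using assms(2) by (subst has_sum_reindex) (auto simp: o_def inj_def)
  ultimately have "(f has_sum (a + b)) (range int \<union> range (\<lambda>n. - int (Suc n)))"
    by (rule has_sum_Un_disjoint) auto
  moreover have "range int \<union> range (\<lambda>n. - int (Suc n)) = UNIV"
    using int_cases by blast
  ultimately show ?thesis by simp
qed

text \<open>
  The product of two such weights is a summable majorant on \<open>\<int>\<^sup>2\<close> for the inverse cube of the norm of
  lattice points; the factorisation makes summability a one-dimensional question.
\<close>

definition lattice_weight :: "int \<Rightarrow> real" where
  "lattice_weight n = (1 + \<bar>of_int n\<bar>) powr (-3/2)"

lemma lattice_weight_summable: "lattice_weight summable_on UNIV"
proof -
  have "summable (\<lambda>n. real (Suc n) powr (-3/2))"
    by (subst summable_Suc_iff) (simp add: summable_real_powr_iff)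
  hence *: "(\<lambda>n. real (Suc n) powr (-3/2)) summable_on UNIV"
    by (intro norm_summable_imp_summable_on) simp
  have "summable (\<lambda>n. real (Suc (Suc n)) powr (-3/2))"
    by (subst summable_Suc_iff, subst summable_Suc_iff) (simp add: summable_real_powr_iff)
  hence **: "(\<lambda>n. real (Suc (Suc n)) powr (-3/2)) summable_on UNIV"
    by (intro norm_summable_imp_summable_on) simp
  have "(lattice_weight has_sum (\<Sum>\<^sub>\<infinity>n. real (Suc n) powr (-3/2)) + (\<Sum>\<^sub>\<infinity>n. real (Suc (Suc n)) powr (-3/2))) UNIV"
    by (rule has_sum_int_split)
       (use has_sum_infsum [OF *] has_sum_infsum [OF **] in \<open>simp_all add: lattice_weight_def add_ac\<close>)
  thus ?thesis by (auto simp: summable_on_def)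
qed

lemma lattice_weight_nonneg [simp]: "lattice_weight n \<ge> 0"
  by (simp add: lattice_weight_def)

text \<open>
  This is \<open>(1 + \<bar>m\<bar>) (1 + \<bar>n\<bar>) \<le> (1 + \<bar>m\<bar> + \<bar>n\<bar>)\<^sup>2\<close>, raised to the power \<open>-3/2\<close>.
\<close>

lemma inverse_cube_le_lattice_weight:
  "1 / (1 + \<bar>of_int m\<bar> + \<bar>of_int n\<bar>) ^ 3 \<le> lattice_weight m * lattice_weight n"
proof -
  define a b where "a = \<bar>of_int m :: real\<bar>" and "b = \<bar>of_int n :: real\<bar>"
  have ab: "a \<ge> 0" "b \<ge> 0" by (auto simp: a_def b_def)
  have "lattice_weight m * lattice_weight n = 1 / ((1 + a) * (1 + b)) powr (3/2)"
    using ab by (simp add: lattice_weight_def powr_mult powr_minus_divide flip: a_def b_def)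
  moreover have "((1 + a) * (1 + b)) powr (3/2) \<le> ((1 + a + b) ^ 2) powr (3/2)"
    using ab by (intro powr_mono2) (auto simp: algebra_simps power2_eq_square)
  moreover have "((1 + a + b) ^ 2) powr (3/2) = (1 + a + b) ^ 3"
    using ab by (simp add: powr_powr flip: powr_numeral)
  moreover have "((1 + a) * (1 + b)) powr (3/2) > 0"
    using ab by (simp add: add_nonneg_eq_0_iff)
  ultimately show ?thesis
    unfolding a_def [symmetric] b_def [symmetric] by (simp add: frac_le)
qed

definition lipschitz_const :: "nat \<Rightarrow> complex" where
  "lipschitz_const k = (-2 * of_real pi * \<i>) ^ k / fact (k - 1)"

lemma lipschitz_const_nonzero [simp]: "lipschitz_const k \<noteq> 0"
  by (auto simp: lipschitz_const_def)

lemma norm_nome: "norm (nome z) = exp (- (2 * pi * Im z))"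
  by (simp add: nome_def)

lemma norm_nome_less_1: "Im z > 0 \<Longrightarrow> norm (nome z) < 1"
  by (simp add: norm_nome)

lemma nome_of_nat_mult: "nome (of_nat n * z) = nome z ^ n"
  unfolding nome_def exp_of_nat_mult [symmetric] by (simp add: mult_ac)

lemma nonreal_notin_nonpos_Ints: "Im z \<noteq> 0 \<Longrightarrow> z \<notin> \<int>\<^sub>\<le>\<^sub>0"
  by (auto elim!: nonpos_Ints_cases)

text \<open>
  Logarithmic differentiation of the reflection formula of the Gamma function gives \<open>-\<pi> cot \<pi>z\<close>, and
  \<open>cot \<pi>z = \<i> (t + 1) / (t - 1)\<close> for \<open>t = exp (2 \<pi> \<i> z)\<close>.
\<close>

lemma Digamma_reflection:
  assumes "Im z > 0"
  shows "Digamma z - Digamma (1 - z) = 2 * of_real pi * \<i> * polylog_neg 0 (nome z) - of_real pi * \<i>"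
proof -
  have nz: "z \<notin> \<int>\<^sub>\<le>\<^sub>0" "1 - z \<notin> \<int>\<^sub>\<le>\<^sub>0"
    using assms by (auto intro!: nonreal_notin_nonpos_Ints)
  define t where "t = nome z"
  have t: "norm t < 1" using norm_nome_less_1 [OF assms] by (simp add: t_def)
  hence t1: "t \<noteq> 1" by auto
  define E where "E = exp (\<i> * (of_real pi * z))"
  have E: "E \<noteq> 0" "E ^ 2 = t"
    by (auto simp: E_def t_def nome_def mult_ac simp flip: exp_of_nat_mult)
  have sin: "sin (of_real pi * z) = (E - inverse E) / (2 * \<i>)"
    and cos: "cos (of_real pi * z) = (E + inverse E) / 2"
    by (simp_all add: E_def sin_exp_eq cos_exp_eq exp_minus)
  have sin_nz: "sin (of_real pi * z) \<noteq> 0"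
  proof
    assume "sin (of_real pi * z) = 0"
    hence "E = inverse E" unfolding sin by simp
    hence "E ^ 2 = 1" using E by (simp add: power2_eq_square field_simps)
    thus False using t1 E by simp
  qed
  have "Gamma z * Gamma (1 - z) * (Digamma z - Digamma (1 - z)) =
          - (of_real pi * (of_real pi * cos (of_real pi * z))) / sin (of_real pi * z) ^ 2"
  proof (rule DERIV_unique)
    show "((\<lambda>z. Gamma z * Gamma (1 - z)) has_field_derivative
             Gamma z * Gamma (1 - z) * (Digamma z - Digamma (1 - z))) (at z)"
      using nz by (auto intro!: derivative_eq_intros simp: algebra_simps)
    have "((\<lambda>z. of_real pi / sin (of_real pi * z)) has_field_derivative
             - (of_real pi * (of_real pi * cos (of_real pi * z))) / sin (of_real pi * z) ^ 2) (at z)"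
      using sin_nz by (auto intro!: derivative_eq_intros simp: power2_eq_square)
    thus "((\<lambda>z. Gamma z * Gamma (1 - z)) has_field_derivative
             - (of_real pi * (of_real pi * cos (of_real pi * z))) / sin (of_real pi * z) ^ 2) (at z)"
      by (simp add: Gamma_reflection_complex)
  qed
  hence "of_real pi / sin (of_real pi * z) * (Digamma z - Digamma (1 - z)) =
           of_real pi / sin (of_real pi * z) * - (of_real pi * cos (of_real pi * z) / sin (of_real pi * z))"
    unfolding Gamma_reflection_complex by (simp add: power2_eq_square)
  hence "Digamma z - Digamma (1 - z) = - (of_real pi * cos (of_real pi * z) / sin (of_real pi * z))"
    using sin_nz by (subst (asm) mult_cancel_left) auto
  also have "cos (of_real pi * z) / sin (of_real pi * z) = \<i> * (t + 1) / (t - 1)"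
    using E t1 unfolding sin cos E(2) [symmetric] by (simp add: field_simps power2_eq_square)
  hence "of_real pi * cos (of_real pi * z) / sin (of_real pi * z) = of_real pi * (\<i> * (t + 1) / (t - 1))"
    by (metis times_divide_eq_right)
  also have "- (of_real pi * (\<i> * (t + 1) / (t - 1))) = 2 * of_real pi * \<i> * (1 / (1 - t)) - of_real pi * \<i>"
    using t1 by (simp add: divide_simps) (simp add: algebra_simps)
  also have "1 / (1 - t) = polylog_neg 0 t"
    using geometric_sums [OF t] by (simp add: polylog_neg_def sums_iff)
  finally show ?thesis by (simp add: t_def)
qed

text \<open>
  Both sides at \<open>j + 1\<close> are the derivatives of both sides at \<open>j\<close>. For \<open>j = 0\<close> they differ by the constant
  \<open>\<pi> \<i>\<close>, which disappears after one differentiation.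
\<close>

lemma Polygamma_reflection:
  assumes "Im z > 0" "j > 0"
  shows "Polygamma j z - (-1) ^ j * Polygamma j (1 - z) =
           (2 * of_real pi * \<i>) ^ Suc j * polylog_neg j (nome z)"
  using assms(2,1)
proof (induction j arbitrary: z rule: nat_induct_non_zero)
  have nz: "z \<notin> \<int>\<^sub>\<le>\<^sub>0" "1 - z \<notin> \<int>\<^sub>\<le>\<^sub>0" if "Im z > 0" for z
    using that by (auto intro!: nonreal_notin_nonpos_Ints)
  have op: "open {z. Im z > 0}" by (rule open_halfspace_Im_gt)
  let ?c = "2 * of_real pi * \<i> :: complex"
  have der: "((\<lambda>z. Polygamma j z - (-1) ^ j * Polygamma j (1 - z)) has_field_derivative
               Polygamma (Suc j) z - (-1) ^ Suc j * Polygamma (Suc j) (1 - z)) (at z)"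
    if "Im z > 0" for j z
    using nz [OF that] by (auto intro!: derivative_eq_intros)
  have der': "((\<lambda>z. ?c ^ Suc j * polylog_neg j (nome z)) has_field_derivative
               ?c ^ Suc (Suc j) * polylog_neg (Suc j) (nome z)) (at z)" if "Im z > 0" for j z
    using polylog_neg_exp_has_field_derivative [of ?c z j] norm_nome_less_1 [OF that]
    by (auto intro!: derivative_eq_intros simp: nome_def)
  {
    case 1
    show ?case
    proof (rule DERIV_unique)
      show "((\<lambda>z. Polygamma 0 z - (-1) ^ 0 * Polygamma 0 (1 - z)) has_field_derivative
               Polygamma 1 z - (-1) ^ 1 * Polygamma 1 (1 - z)) (at z)"
        using der [of z 0] 1 by simp
      have "((\<lambda>z. ?c ^ Suc 0 * polylog_neg 0 (nome z) - of_real pi * \<i>) has_field_derivative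
               ?c ^ Suc (Suc 0) * polylog_neg (Suc 0) (nome z) - 0) (at z)"
        by (intro derivative_intros der' 1)
      hence "((\<lambda>z. ?c ^ Suc 0 * polylog_neg 0 (nome z) - of_real pi * \<i>) has_field_derivative
               ?c ^ Suc 1 * polylog_neg 1 (nome z)) (at z)" by simp
      thus "((\<lambda>z. Polygamma 0 z - (-1) ^ 0 * Polygamma 0 (1 - z)) has_field_derivative
               ?c ^ Suc 1 * polylog_neg 1 (nome z)) (at z)"
        by (rule has_field_derivative_transform_within_open [OF _ op])
           (use 1 Digamma_reflection in auto)
    qed
  next
    case (Suc j)
    show ?case
    proof (rule DERIV_unique)
      show "((\<lambda>z. ?c ^ Suc j * polylog_neg j (nome z)) has_field_derivative
               ?c ^ Suc (Suc j) * polylog_neg (Suc j) (nome z)) (at z)" by (rule der' [OF Suc.prems])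
      show "((\<lambda>z. ?c ^ Suc j * polylog_neg j (nome z)) has_field_derivative
               Polygamma (Suc j) z - (-1) ^ Suc j * Polygamma (Suc j) (1 - z)) (at z)"
        by (rule has_field_derivative_transform_within_open [OF der op])
           (use Suc.prems Suc.IH in auto)
    qed
  }
qed

text \<open>
  The sums over \<open>n \<ge> 0\<close> and \<open>n < 0\<close> are polygamma values at \<open>z\<close> and \<open>1 - z\<close>.
\<close>

lemma lipschitz_formula:
  assumes z: "Im z > 0" and k: "k \<ge> 2"
  shows "((\<lambda>n::int. 1 / (z + of_int n) ^ k) has_sum lipschitz_const k * polylog_neg (k - 1) (nome z)) UNIV"
proof -
  obtain c where c: "c > 0" "\<And>x y. c * (\<bar>x\<bar> + \<bar>y\<bar>) \<le> norm (of_real x * z + of_real y)"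
    using norm_linear_form_lower_bound [of "Im z" "\<bar>Re z\<bar>"] z by auto
  have bound: "norm (1 / (z + of_int n) ^ k) \<le> (1 / c ^ k) * lattice_weight n" for n
  proof -
    have zn: "z + of_int n \<noteq> 0" using z by (auto simp: complex_eq_iff)
    have "1 / norm (z + of_int n) ^ k \<le> 1 / (c * (1 + \<bar>of_int n\<bar>)) ^ k"
      using c(2) [of 1 "of_int n"] c(1) by (intro divide_left_mono power_mono) (auto intro!: mult_pos_pos zero_less_power add_pos_nonneg zn)
    also have "\<dots> = 1 / c ^ k * (1 / (1 + \<bar>of_int n\<bar>) ^ k)"
      by (simp add: power_mult_distrib)
    also have "\<dots> \<le> 1 / c ^ k * lattice_weight n"
    proof (intro mult_left_mono)
      have "1 / (1 + \<bar>real_of_int n\<bar>) ^ k = (1 + \<bar>of_int n\<bar>) powr (- real k)"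
        by (simp add: powr_minus_divide powr_realpow add_pos_nonneg)
      also have "\<dots> \<le> lattice_weight n"
        unfolding lattice_weight_def using k by (intro powr_mono) auto
      finally show "1 / (1 + \<bar>real_of_int n\<bar>) ^ k \<le> lattice_weight n" .
    qed (use c in auto)
    finally show ?thesis by (simp add: norm_divide norm_power)
  qed
  have summ: "(\<lambda>n::int. norm (1 / (z + of_int n) ^ k)) summable_on UNIV"
    using summable_on_cmult_right [OF lattice_weight_summable, of "1 / c ^ k"] bound
    by (rule Infinite_Sum.abs_summable_on_comparison_test')
  have nz: "z \<noteq> 0" "1 - z \<noteq> 0" using z by auto
  define j where "j = k - 1"
  have j: "k = Suc j" "j > 0" using k by (auto simp: j_def)
  have 1: "((\<lambda>n::nat. 1 / (z + of_int (int n)) ^ k) has_sum ((-1) ^ Suc j * Polygamma j z / fact j)) UNIV"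
  proof (rule norm_summable_imp_has_sum)
    have "(\<lambda>n::nat. norm (1 / (z + of_int (int n)) ^ k)) summable_on UNIV"
      using summable_on_subset [OF summ subset_UNIV, of "range int"] by (subst (asm) summable_on_reindex) (auto simp: o_def)
    thus "summable (\<lambda>n::nat. norm (1 / (z + of_int (int n)) ^ k))"
      by (rule summable_on_imp_summable)
    show "(\<lambda>n::nat. 1 / (z + of_int (int n)) ^ k) sums ((-1) ^ Suc j * Polygamma j z / fact j)"
      using Polygamma_LIMSEQ [OF nz(1) j(2)] by (simp add: j field_simps)
  qed
  have 2: "((\<lambda>n::nat. 1 / (z + of_int (- int (Suc n))) ^ k) has_sum
              ((-1) ^ k * ((-1) ^ Suc j * Polygamma j (1 - z) / fact j))) UNIV"
  proof (rule norm_summable_imp_has_sum)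
    have "(\<lambda>n::nat. norm (1 / (z + of_int (- int (Suc n))) ^ k)) summable_on UNIV"
      using summable_on_subset [OF summ subset_UNIV, of "range (\<lambda>n. - int (Suc n))"]
      by (subst (asm) summable_on_reindex) (auto simp: o_def inj_def)
    thus "summable (\<lambda>n::nat. norm (1 / (z + of_int (- int (Suc n))) ^ k))"
      by (rule summable_on_imp_summable)
    have "(\<lambda>n::nat. (-1) ^ k * inverse ((1 - z + of_nat n) ^ Suc j)) sums
            ((-1) ^ k * ((-1) ^ Suc j * Polygamma j (1 - z) / fact j))"
      by (intro sums_mult Polygamma_LIMSEQ nz j)
    also have "(\<lambda>n::nat. (-1) ^ k * inverse ((1 - z + of_nat n) ^ Suc j)) = 
                 (\<lambda>n::nat. 1 / (z + of_int (- int (Suc n))) ^ k)"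
    proof
      fix n :: nat
      have "(-1) ^ k * inverse (w ^ k) = inverse ((- w) ^ k)" for w :: complex
        by (cases "even k") simp_all
      hence "(-1) ^ k * inverse ((1 - z + of_nat n) ^ k) = inverse ((- (1 - z + of_nat n)) ^ k)" .
      also have "- (1 - z + of_nat n) = z + of_int (- int (Suc n))" by simp
      finally show "(-1) ^ k * inverse ((1 - z + of_nat n) ^ Suc j) = 1 / (z + of_int (- int (Suc n))) ^ k"
        by (simp add: j field_simps)
    qed
    finally show "(\<lambda>n::nat. 1 / (z + of_int (- int (Suc n))) ^ k) sums
            ((-1) ^ k * ((-1) ^ Suc j * Polygamma j (1 - z) / fact j))" .
  qed
  have "((\<lambda>n::int. 1 / (z + of_int n) ^ k) has_sum
           ((-1) ^ Suc j * Polygamma j z / fact j + (-1) ^ k * ((-1) ^ Suc j * Polygamma j (1 - z) / fact j))) UNIV"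
    by (rule has_sum_int_split [OF 1 2])
  also have "(-1) ^ Suc j * Polygamma j z / fact j + (-1) ^ k * ((-1) ^ Suc j * Polygamma j (1 - z) / fact j) =
               (-1) ^ Suc j / fact j * (Polygamma j z - (-1) ^ j * Polygamma j (1 - z))"
    by (simp add: j field_simps)
  also have "\<dots> = (-1) ^ k * (2 * of_real pi * \<i>) ^ k / fact j * polylog_neg j (nome z)"
    unfolding Polygamma_reflection [OF z j(2)] j(1) by (simp del: power_Suc)
  also have "(-1) ^ k * (2 * of_real pi * \<i>) ^ k = (-2 * of_real pi * \<i>) ^ k"
    unfolding power_mult_distrib [symmetric] by simp
  also have "\<dots> / fact j * polylog_neg j (nome z) = lipschitz_const k * polylog_neg (k - 1) (nome z)"
    by (simp add: lipschitz_const_def j_def)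
  finally show ?thesis .
qed

section \<open>Lattice sums\<close>

text \<open>
  A term with vanishing denominator is 0, so the origin needs no special treatment. The parameter \<open>c\<close> is 0 for
  the usual Eisenstein series and 1 for the difference that is needed in weight 2.
\<close>

definition eis_term :: "nat \<Rightarrow> complex \<Rightarrow> int \<Rightarrow> int \<Rightarrow> complex \<Rightarrow> int \<times> int \<Rightarrow> complex" where
  "eis_term k c a b z = (\<lambda>(m, n). 1 / (of_int (m + a) * z + of_int (n + b)) ^ k -
                                   c * (1 / (of_int m * z + of_int n) ^ k))"

definition eis :: "nat \<Rightarrow> complex \<Rightarrow> (int \<times> int) set \<Rightarrow> int \<Rightarrow> int \<Rightarrow> complex \<Rightarrow> complex" where
  "eis k c \<Lambda> a b z = (\<Sum>\<^sub>\<infinity>p\<in>\<Lambda>. eis_term k c a b z p)"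

text \<open>
  The condition for absolute convergence on all of \<open>\<int>\<^sup>2\<close>: in weight 2 only the difference of two terms decays
  like the inverse cube.
\<close>

definition eis_admissible :: "nat \<Rightarrow> complex \<Rightarrow> bool" where
  "eis_admissible k c \<longleftrightarrow> k \<ge> 3 \<or> k = 2 \<and> c = 1"

text \<open>
  At the origin the left-hand side is 0.
\<close>

lemma inverse_linear_form_bound:
  assumes "\<epsilon> > 0" "R \<ge> 0"
  shows "\<exists>A\<ge>1. \<forall>z. \<epsilon> \<le> Im z \<longrightarrow> \<bar>Re z\<bar> \<le> R \<longrightarrow>
           (\<forall>m n::int. 1 / norm (of_int m * z + of_int n) \<le> A * (1 / (1 + \<bar>of_int m\<bar> + \<bar>of_int n\<bar>)))"
proof -
  obtain c where c: "c > 0" "\<And>z x y. Im z \<ge> \<epsilon> \<Longrightarrow> \<bar>Re z\<bar> \<le> R \<Longrightarrow>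
           c * (\<bar>x\<bar> + \<bar>y\<bar>) \<le> norm (of_real x * z + of_real y)"
    using norm_linear_form_lower_bound [OF assms] by blast
  show ?thesis
  proof (intro exI [of _ "max 1 (2 / c)"] conjI allI impI)
    fix z :: complex and m n :: int
    assume z: "\<epsilon> \<le> Im z" "\<bar>Re z\<bar> \<le> R"
    define S where "S = \<bar>of_int m :: real\<bar> + \<bar>of_int n\<bar>"
    define w where "w = of_int m * z + of_int n"
    show "1 / norm (of_int m * z + of_int n) \<le> max 1 (2 / c) * (1 / (1 + \<bar>of_int m\<bar> + \<bar>of_int n\<bar>))"
    proof (cases "m = 0 \<and> n = 0")
      case False
      hence "\<bar>m\<bar> + \<bar>n\<bar> \<ge> 1" by linarith
      hence "real_of_int (\<bar>m\<bar> + \<bar>n\<bar>) \<ge> 1" by linarith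
      hence S: "S \<ge> 1" by (simp add: S_def)
      have "c * ((1 + S) / 2) \<le> c * S"
        using S c by (intro mult_left_mono) auto
      also have "\<dots> \<le> norm w" unfolding w_def S_def using c(2) [OF z, of "of_int m" "of_int n"] by simp
      finally have "1 / norm w \<le> 1 / (c * ((1 + S) / 2))"
        using S c by (intro divide_left_mono) (auto intro!: mult_pos_pos intro: order.strict_trans2 [of 0 "c * ((1 + S) / 2)"])
      also have "\<dots> = 2 / c * (1 / (1 + S))" by simp
      also have "\<dots> \<le> max 1 (2 / c) * (1 / (1 + S))"
        using S by (intro mult_right_mono) auto
      finally show ?thesis by (simp add: w_def S_def add.assoc)
    qed auto
  qed auto
qed

text \<open>
  The delicate case is weight 2, where \<open>1/w'\<^sup>2 - 1/w\<^sup>2 = -u (1/w') (1/w) (1/w' + 1/w)\<close> for \<open>w' = w + u\<close>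
  and \<open>u = a z + b\<close>: the three inverse factors give the inverse cube, and the factor \<open>u\<close> accounts for the
  linear growth in \<open>z\<close>.
\<close>

lemma eis_term_bound:
  assumes "eis_admissible k c" "\<epsilon> > 0" "R \<ge> 0"
  shows "\<exists>C\<ge>0. \<forall>z. \<epsilon> \<le> Im z \<longrightarrow> \<bar>Re z\<bar> \<le> R \<longrightarrow>
           (\<forall>m n. norm (eis_term k c a b z (m, n)) \<le> C * (1 + norm z) * (lattice_weight m * lattice_weight n))"
proof -
  obtain A0 where A0: "A0 \<ge> 1" "\<And>z m n. \<epsilon> \<le> Im z \<Longrightarrow> \<bar>Re z\<bar> \<le> R \<Longrightarrow>
           1 / norm (of_int m * z + of_int n) \<le> A0 * (1 / (1 + \<bar>of_int m\<bar> + \<bar>of_int n\<bar>))"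
    using inverse_linear_form_bound [OF assms(2,3)] by blast
  define K where "K = 1 + \<bar>of_int a :: real\<bar> + \<bar>of_int b\<bar>"
  define A where "A = A0 * K"
  have K: "K \<ge> 1" by (simp add: K_def)
  have A: "A0 \<le> A" "A \<ge> 1"
    using A0(1) K by (auto simp: A_def mult_le_cancel_left1 intro: order.trans)
  define C where "C = (1 + norm c) * A ^ k + 2 * A ^ 3 * K + A ^ 2 * K"
  show ?thesis
  proof (intro exI [of _ C] conjI allI impI)
    show "C \<ge> 0" using A K by (simp add: C_def)
    fix z :: complex and m n :: int
    assume z: "\<epsilon> \<le> Im z" "\<bar>Re z\<bar> \<le> R"
    define T where "T = 1 / (1 + \<bar>of_int m :: real\<bar> + \<bar>of_int n\<bar>)"
    define u where "u = of_int a * z + of_int b"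
    define w where "w = of_int m * z + of_int n"
    define w' where "w' = of_int (m + a) * z + of_int (n + b)"
    have w': "w' = w + u" by (simp add: w_def u_def w'_def algebra_simps)
    have T: "T > 0" "T \<le> 1" by (auto simp: T_def add_pos_nonneg)
    have shift: "1 / (1 + \<bar>of_int (m + a)\<bar> + \<bar>of_int (n + b)\<bar>) \<le> K * T"
    proof -
      define S' where "S' = \<bar>of_int (m + a) :: real\<bar> + \<bar>of_int (n + b)\<bar>"
      have "1 + \<bar>of_int m :: real\<bar> + \<bar>of_int n\<bar> \<le> S' + K"
        by (simp add: S'_def K_def)
      also have "S' + K \<le> K * (1 + S')"
        using K mult_right_mono [of 1 K S'] by (simp add: S'_def algebra_simps)
      finally show ?thesis
        by (simp add: T_def S'_def [symmetric] add.assoc divide_simps add_pos_nonneg) (simp add: S'_def add_pos_nonneg divide_simps)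
    qed
    have i0: "1 / norm w \<le> A * T"
      using A0(2) [OF z, of m n] A T unfolding w_def T_def [symmetric]
      by (meson mult_right_mono order.trans less_imp_le)
    have "1 / norm w' \<le> A0 * (1 / (1 + \<bar>of_int (m + a)\<bar> + \<bar>of_int (n + b)\<bar>))"
      unfolding w'_def by (rule A0(2) [OF z])
    also have "\<dots> \<le> A0 * (K * T)"
      by (intro mult_left_mono shift) (use A0 in auto)
    finally have i1: "1 / norm w' \<le> A * T" by (simp add: A_def mult_ac)
    have term_eq: "eis_term k c a b z (m, n) = 1 / w' ^ k - c * (1 / w ^ k)"
      by (simp add: eis_term_def w'_def w_def)
    have "norm (eis_term k c a b z (m, n)) \<le> C * (1 + norm z) * T ^ 3"
    proof (cases "k \<ge> 3")
      case True
      have "norm (eis_term k c a b z (m, n)) \<le> norm (1 / w' ^ k) + norm (c * (1 / w ^ k))"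
        unfolding term_eq by (rule norm_triangle_ineq4)
      also have "\<dots> = (1 / norm w') ^ k + norm c * (1 / norm w) ^ k"
        by (simp add: norm_divide norm_mult norm_power power_one_over)
      also have "\<dots> \<le> (A * T) ^ k + norm c * (A * T) ^ k"
        by (intro add_mono mult_left_mono power_mono i0 i1) auto
      also have "\<dots> = (1 + norm c) * A ^ k * T ^ k"
        by (simp add: power_mult_distrib algebra_simps)
      also have "\<dots> \<le> (1 + norm c) * A ^ k * T ^ 3"
        using True T A by (intro mult_left_mono power_decreasing) auto
      also have "\<dots> \<le> C * (1 + norm z) * T ^ 3"
      proof (intro mult_right_mono)
        have "(1 + norm c) * A ^ k \<le> C * 1" using A K by (simp add: C_def)
        also have "\<dots> \<le> C * (1 + norm z)" using \<open>C \<ge> 0\<close> by (intro mult_left_mono) auto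
        finally show "(1 + norm c) * A ^ k \<le> C * (1 + norm z)" .
      qed (use T in auto)
      finally show ?thesis .
    next
      case False
      hence kc: "k = 2" "c = 1" using assms by (auto simp: eis_admissible_def)
      show ?thesis
      proof (cases "w = 0 \<or> w' = 0")
        case False
        hence "u * (1 / w' * (1 / w)) = 1 / w - 1 / w'"
          unfolding w' by (simp add: field_simps)
        hence "eis_term k c a b z (m, n) = - (u * ((1 / w') * (1 / w) * (1 / w' + 1 / w)))"
          using term_eq [unfolded kc power_one_over [symmetric]] unfolding kc by algebra
        hence "norm (eis_term k c a b z (m, n)) = norm u * ((1 / norm w') * (1 / norm w) * norm (1 / w' + 1 / w))"
          by (simp only: norm_minus_cancel norm_mult norm_divide norm_one)
        also have "\<dots> \<le> norm u * ((A * T) * (A * T) * (A * T + A * T))"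
        proof (intro mult_left_mono mult_mono i0 i1)
          have "norm (1 / w' + 1 / w) \<le> norm (1 / w') + norm (1 / w)" by (rule norm_triangle_ineq)
          also have "\<dots> \<le> A * T + A * T" using i0 i1 by (simp add: norm_divide)
          finally show "norm (1 / w' + 1 / w) \<le> A * T + A * T" .
        qed (use A T in auto)
        also have "\<dots> = norm u * (2 * A ^ 3 * T ^ 3)"
          by (simp add: power3_eq_cube)
        also have "norm u \<le> K * (1 + norm z)"
        proof -
          have "norm u \<le> norm (of_int a * z) + norm (of_int b :: complex)"
            unfolding u_def by (rule norm_triangle_ineq)
          also have "\<dots> = \<bar>of_int a\<bar> * norm z + \<bar>of_int b\<bar>" by (simp add: norm_mult)
          also have "\<dots> \<le> K * (1 + norm z)"
            unfolding K_def by (simp add: algebra_simps)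
          finally show ?thesis .
        qed
        hence "norm u * (2 * A ^ 3 * T ^ 3) \<le> K * (1 + norm z) * (2 * A ^ 3 * T ^ 3)"
          using A T by (intro mult_right_mono) auto
        also have "\<dots> = 2 * A ^ 3 * K * ((1 + norm z) * T ^ 3)" by simp
        also have "\<dots> \<le> C * ((1 + norm z) * T ^ 3)"
          using A K T by (intro mult_right_mono) (auto simp: C_def)
        finally show ?thesis by (simp add: mult.assoc)
      next
        case True
        \<comment> \<open>one of the two points is the origin, so the other is within a bounded distance of it\<close>
        have KT: "1 \<le> K * T"
        proof (cases "w = 0")
          case True
          have "m = 0" using z assms(2) True by (auto simp: w_def complex_eq_iff)
          moreover from this have "n = 0" using True by (auto simp: w_def)
          ultimately show ?thesis using K by (simp add: T_def)
        next
          case False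
          with \<open>w = 0 \<or> w' = 0\<close> have "w' = 0" by simp
          have "m + a = 0" using z assms(2) \<open>w' = 0\<close> by (auto simp: w'_def complex_eq_iff)
          moreover from this have "n + b = 0" using \<open>w' = 0\<close> by (auto simp: w'_def simp flip: of_int_add)
          ultimately show ?thesis using shift by simp
        qed
        have "norm (eis_term k c a b z (m, n)) \<le> (A * T) ^ 2"
        proof (cases "w = 0")
          case True
          thus ?thesis using term_eq power_mono [OF i1, of 2] kc
            by (simp add: norm_divide norm_power power_one_over)
        next
          case False
          with \<open>w = 0 \<or> w' = 0\<close> have "w' = 0" by simp
          thus ?thesis using term_eq power_mono [OF i0, of 2] kc
            by (simp add: norm_divide norm_power power_one_over)
        qed
        also have "\<dots> \<le> (A * T) ^ 2 * (K * T)"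
          using mult_left_mono [OF KT, of "(A * T) ^ 2"] by simp
        also have "\<dots> = A ^ 2 * K * T ^ 3" by (simp add: power2_eq_square power3_eq_cube)
        also have "\<dots> \<le> C * (1 + norm z) * T ^ 3"
        proof (intro mult_right_mono)
          have "A ^ 2 * K \<le> C * 1" using A K by (simp add: C_def)
          also have "\<dots> \<le> C * (1 + norm z)" using \<open>C \<ge> 0\<close> by (intro mult_left_mono) auto
          finally show "A ^ 2 * K \<le> C * (1 + norm z)" .
        qed (use T in auto)
        finally show ?thesis .
      qed
    qed
    also have "T ^ 3 \<le> lattice_weight m * lattice_weight n"
      using inverse_cube_le_lattice_weight [of m n] by (simp add: T_def power_one_over)
    hence "C * (1 + norm z) * T ^ 3 \<le> C * (1 + norm z) * (lattice_weight m * lattice_weight n)"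
      using \<open>C \<ge> 0\<close> by (intro mult_left_mono) auto
    finally show "norm (eis_term k c a b z (m, n)) \<le> C * (1 + norm z) * (lattice_weight m * lattice_weight n)" .
  qed
qed

lemma lattice_weight_prod_summable:
  "(\<lambda>p. lattice_weight (fst p) * lattice_weight (snd p)) summable_on \<Lambda>"
proof -
  have "(\<lambda>p. lattice_weight (fst p) * lattice_weight (snd p)) summable_on (UNIV \<times> UNIV)"
  proof (rule summable_on_SigmaI)
    fix x show "((\<lambda>y. lattice_weight (fst (x, y)) * lattice_weight (snd (x, y))) has_sum
                   lattice_weight x * infsum lattice_weight UNIV) UNIV"
      using has_sum_cmult_right [OF has_sum_infsum [OF lattice_weight_summable]] by simp
  qed (auto intro!: summable_on_cmult_left lattice_weight_summable)
  thus ?thesis by (rule summable_on_subset) auto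
qed

lemma eis_term_abs_summable:
  assumes "eis_admissible k c" "Im z > 0"
  shows "(\<lambda>p. norm (eis_term k c a b z p)) summable_on \<Lambda>"
proof -
  obtain C where C: "\<And>m n. norm (eis_term k c a b z (m, n)) \<le> C * (1 + norm z) * (lattice_weight m * lattice_weight n)"
    using eis_term_bound [OF assms(1,2), of "\<bar>Re z\<bar>" a b] by auto
  show ?thesis
    using summable_on_cmult_right [OF lattice_weight_prod_summable, of "C * (1 + norm z)"]
    by (rule Infinite_Sum.abs_summable_on_comparison_test') (use C in auto)
qed

lemma eis_term_summable:
  assumes "eis_admissible k c" "Im z > 0"
  shows "eis_term k c a b z summable_on \<Lambda>"
  using eis_term_abs_summable [OF assms] by (rule abs_summable_summable)

lemma holomorphic_inverse_linear_form:
  "(\<lambda>z. 1 / (of_int m * z + of_int n) ^ k) holomorphic_on upper_half_plane"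
proof (cases "m = 0")
  case False
  hence "of_int m * z + of_int n \<noteq> 0" if "z \<in> upper_half_plane" for z
    using that by (auto simp: upper_half_plane_def complex_eq_iff)
  thus ?thesis by (intro holomorphic_intros) auto
qed auto

lemma holomorphic_eis_term: "(\<lambda>z. eis_term k c a b z p) holomorphic_on upper_half_plane"
  unfolding eis_term_def case_prod_beta
  by (intro holomorphic_on_diff holomorphic_on_mult holomorphic_inverse_linear_form holomorphic_on_const)

lemma holomorphic_eis:
  assumes "eis_admissible k c"
  shows "eis k c \<Lambda> a b holomorphic_on upper_half_plane"
proof -
  have "\<exists>r>0. eis k c \<Lambda> a b holomorphic_on ball z0 r" if z0: "z0 \<in> upper_half_plane" for z0
  proof -
    define r where "r = Im z0 / 2"
    have r: "r > 0" using z0 by (simp add: r_def upper_half_plane_def)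
    define R where "R = \<bar>Re z0\<bar> + r"
    obtain C where C: "C \<ge> 0" "\<And>z m n. r \<le> Im z \<Longrightarrow> \<bar>Re z\<bar> \<le> R \<Longrightarrow>
        norm (eis_term k c a b z (m, n)) \<le> C * (1 + norm z) * (lattice_weight m * lattice_weight n)"
      using eis_term_bound [OF assms r, of R a b] r by (auto simp: R_def)
    have in_strip: "r \<le> Im z" "\<bar>Re z\<bar> \<le> R" "norm z \<le> norm z0 + r" if "z \<in> cball z0 r" for z
    proof -
      have d: "norm (z - z0) \<le> r" using that by (simp add: dist_norm norm_minus_commute)
      show "norm z \<le> norm z0 + r" using norm_triangle_ineq [of z0 "z - z0"] d by simp
      have "\<bar>Re (z - z0)\<bar> \<le> r" "\<bar>Im (z - z0)\<bar> \<le> r"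
        using abs_Re_le_cmod [of "z - z0"] abs_Im_le_cmod [of "z - z0"] d by linarith+
      moreover have "Im z0 = 2 * r" by (simp add: r_def)
      ultimately show "r \<le> Im z" "\<bar>Re z\<bar> \<le> R" by (simp_all add: R_def)
    qed
    have sub: "cball z0 r \<subseteq> upper_half_plane"
      using in_strip(1) r by (force simp: upper_half_plane_def)
    have unif: "uniform_limit (cball z0 r) (\<lambda>X z. \<Sum>p\<in>X. eis_term k c a b z p)
             (\<lambda>z. \<Sum>\<^sub>\<infinity>p\<in>\<Lambda>. eis_term k c a b z p) (finite_subsets_at_top \<Lambda>)"
    proof (rule Weierstrass_m_test_general)
      fix p :: "int \<times> int" and z assume z: "z \<in> cball z0 r"
      obtain m n where p: "p = (m, n)" by (cases p)
      have "norm (eis_term k c a b z (m, n)) \<le> C * (1 + norm z) * (lattice_weight m * lattice_weight n)"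
        by (rule C(2)) (use in_strip z in auto)
      also have "\<dots> \<le> C * (1 + (norm z0 + r)) * (lattice_weight m * lattice_weight n)"
        using in_strip(3) [OF z] C(1) by (intro mult_right_mono mult_left_mono add_left_mono) auto
      finally show "norm (eis_term k c a b z p) \<le> C * (1 + (norm z0 + r)) * (lattice_weight (fst p) * lattice_weight (snd p))"
        by (simp add: p)
    qed (intro summable_on_cmult_right lattice_weight_prod_summable)
    have ev: "eventually (\<lambda>X. continuous_on (cball z0 r) (\<lambda>z. \<Sum>p\<in>X. eis_term k c a b z p) \<and>
                     (\<lambda>z. \<Sum>p\<in>X. eis_term k c a b z p) holomorphic_on ball z0 r) (finite_subsets_at_top \<Lambda>)"
    proof (intro always_eventually allI conjI)
      fix X
      have hol: "(\<lambda>z. \<Sum>p\<in>X. eis_term k c a b z p) holomorphic_on upper_half_plane"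
        by (intro holomorphic_on_sum holomorphic_eis_term)
      show "continuous_on (cball z0 r) (\<lambda>z. \<Sum>p\<in>X. eis_term k c a b z p)"
        by (rule holomorphic_on_imp_continuous_on, rule holomorphic_on_subset [OF hol sub])
      show "(\<lambda>z. \<Sum>p\<in>X. eis_term k c a b z p) holomorphic_on ball z0 r"
        by (rule holomorphic_on_subset [OF hol]) (use sub in auto)
    qed
    have "(\<lambda>z. \<Sum>\<^sub>\<infinity>p\<in>\<Lambda>. eis_term k c a b z p) holomorphic_on ball z0 r"
      by (rule holomorphic_uniform_limit [OF ev unif finite_subsets_at_top_neq_bot])
    thus ?thesis using r unfolding eis_def [abs_def] by blast
  qed
  hence "eis k c \<Lambda> a b analytic_on upper_half_plane"
    by (auto simp: analytic_on_def)
  thus ?thesis by (rule analytic_imp_holomorphic)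
qed

text \<open>
  Linear growth is what the termwise bound gives directly, and it is enough for removing the singularity at
  a cusp.
\<close>

lemma eis_growth:
  assumes "eis_admissible k c" "\<epsilon> > 0" "R \<ge> 0"
  shows "\<exists>C. \<forall>z. \<epsilon> \<le> Im z \<longrightarrow> \<bar>Re z\<bar> \<le> R \<longrightarrow> norm (eis k c \<Lambda> a b z) \<le> C * (1 + norm z)"
proof -
  obtain C where C: "C \<ge> 0" "\<And>z m n. \<epsilon> \<le> Im z \<Longrightarrow> \<bar>Re z\<bar> \<le> R \<Longrightarrow>
      norm (eis_term k c a b z (m, n)) \<le> C * (1 + norm z) * (lattice_weight m * lattice_weight n)"
    using eis_term_bound [OF assms, of a b] by auto
  define L where "L = (\<Sum>\<^sub>\<infinity>p\<in>\<Lambda>. lattice_weight (fst p) * lattice_weight (snd p))"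
  show ?thesis
  proof (intro exI [of _ "C * L"] allI impI)
    fix z assume z: "\<epsilon> \<le> Im z" "\<bar>Re z\<bar> \<le> R"
    have z': "Im z > 0" using z assms by linarith
    have "norm (eis k c \<Lambda> a b z) \<le> (\<Sum>\<^sub>\<infinity>p\<in>\<Lambda>. norm (eis_term k c a b z p))"
      unfolding eis_def by (rule norm_infsum_bound [OF eis_term_abs_summable [OF assms(1) z']])
    also have "\<dots> \<le> (\<Sum>\<^sub>\<infinity>p\<in>\<Lambda>. C * (1 + norm z) * (lattice_weight (fst p) * lattice_weight (snd p)))"
      by (intro infsum_mono eis_term_abs_summable summable_on_cmult_right lattice_weight_prod_summable assms z')
         (use C(2) [OF z] in auto)
    also have "\<dots> = C * (1 + norm z) * L"
      unfolding L_def by (intro infsum_cmult_right lattice_weight_prod_summable)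
    finally show "norm (eis k c \<Lambda> a b z) \<le> C * L * (1 + norm z)" by (simp add: mult_ac)
  qed
qed

text \<open>
  Row vectors times the matrix with rows \<open>(\<alpha>, \<beta>)\<close> and \<open>(\<gamma>, \<delta>)\<close>.
\<close>

definition row_act :: "int \<Rightarrow> int \<Rightarrow> int \<Rightarrow> int \<Rightarrow> int \<times> int \<Rightarrow> int \<times> int" where
  "row_act \<alpha> \<beta> \<gamma> \<delta> = (\<lambda>(m, n). (m * \<alpha> + n * \<gamma>, m * \<beta> + n * \<delta>))"

lemma row_act_inverse:
  assumes "\<alpha> * \<delta> - \<beta> * \<gamma> = 1"
  shows "row_act \<alpha> \<beta> \<gamma> \<delta> (row_act \<delta> (-\<beta>) (-\<gamma>) \<alpha> p) = p" "row_act \<delta> (-\<beta>) (-\<gamma>) \<alpha> (row_act \<alpha> \<beta> \<gamma> \<delta> p) = p"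
proof -
  obtain m n where p: "p = (m, n)" by (cases p)
  have d: "\<alpha> * \<delta> = 1 + \<beta> * \<gamma>" using assms by simp
  have "m * \<alpha> * \<delta> = m * (\<alpha> * \<delta>)" "n * \<alpha> * \<delta> = n * (\<alpha> * \<delta>)" by simp_all
  thus "row_act \<alpha> \<beta> \<gamma> \<delta> (row_act \<delta> (-\<beta>) (-\<gamma>) \<alpha> p) = p" "row_act \<delta> (-\<beta>) (-\<gamma>) \<alpha> (row_act \<alpha> \<beta> \<gamma> \<delta> p) = p"
    unfolding p row_act_def using d by (auto simp: algebra_simps)
qed

text \<open>
  A linear form evaluated at a Moebius transform is, up to the automorphy factor, the transformed form at \<open>z\<close>.
  Since the sum is unordered, it is merely reindexed.
\<close>

lemma eis_moebius:
  assumes det: "\<alpha> * \<delta> - \<beta> * \<gamma> = 1" and z: "Im z > 0"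
  shows "1 / (of_int \<gamma> * z + of_int \<delta>) ^ k *
           eis k c \<Lambda> a b ((of_int \<alpha> * z + of_int \<beta>) / (of_int \<gamma> * z + of_int \<delta>)) =
         eis k c (row_act \<alpha> \<beta> \<gamma> \<delta> ` \<Lambda>) (a * \<alpha> + b * \<gamma>) (a * \<beta> + b * \<delta>) z"
proof -
  define j where "j = of_int \<gamma> * z + of_int \<delta>"
  have j: "j \<noteq> 0"
  proof
    assume "j = 0"
    hence "\<gamma> = 0" "\<delta> = 0" using z by (auto simp: j_def complex_eq_iff)
    thus False using det by simp
  qed
  have inj: "inj_on (row_act \<alpha> \<beta> \<gamma> \<delta>) \<Lambda>"
    by (rule inj_on_inverseI) (rule row_act_inverse(2) [OF det])
  define w where "w = (of_int \<alpha> * z + of_int \<beta>) / j"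
  have form: "1 / j ^ k * (1 / (of_int m * w + of_int n) ^ k) =
                1 / (of_int (m * \<alpha> + n * \<gamma>) * z + of_int (m * \<beta> + n * \<delta>)) ^ k" for m n
  proof -
    have "j * (of_int m * w + of_int n) = of_int (m * \<alpha> + n * \<gamma>) * z + of_int (m * \<beta> + n * \<delta>)"
      using j by (simp add: w_def field_simps) (simp add: j_def algebra_simps)
    thus ?thesis by (metis power_mult_distrib times_divide_times_eq mult_1)
  qed
  have "1 / j ^ k * eis k c \<Lambda> a b w = (\<Sum>\<^sub>\<infinity>p\<in>\<Lambda>. 1 / j ^ k * eis_term k c a b w p)"
    unfolding eis_def by (rule infsum_cmult_right' [symmetric])
  also have "\<dots> = (\<Sum>\<^sub>\<infinity>p\<in>\<Lambda>. eis_term k c (a * \<alpha> + b * \<gamma>) (a * \<beta> + b * \<delta>) z (row_act \<alpha> \<beta> \<gamma> \<delta> p))"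
  proof (rule infsum_cong)
    fix p :: "int \<times> int"
    obtain m n where p: "p = (m, n)" by (cases p)
    have "1 / j ^ k * eis_term k c a b w p =
            1 / j ^ k * (1 / (of_int (m + a) * w + of_int (n + b)) ^ k) - c * (1 / j ^ k * (1 / (of_int m * w + of_int n) ^ k))"
      by (simp add: eis_term_def p right_diff_distrib mult_ac)
    also have "\<dots> = eis_term k c (a * \<alpha> + b * \<gamma>) (a * \<beta> + b * \<delta>) z (row_act \<alpha> \<beta> \<gamma> \<delta> p)"
      unfolding form by (simp add: eis_term_def p row_act_def algebra_simps)
    finally show "1 / j ^ k * eis_term k c a b w p = eis_term k c (a * \<alpha> + b * \<gamma>) (a * \<beta> + b * \<delta>) z (row_act \<alpha> \<beta> \<gamma> \<delta> p)" .
  qed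
  also have "\<dots> = eis k c (row_act \<alpha> \<beta> \<gamma> \<delta> ` \<Lambda>) (a * \<alpha> + b * \<gamma>) (a * \<beta> + b * \<delta>) z"
    unfolding eis_def by (subst infsum_reindex [OF inj]) (simp add: o_def)
  finally show ?thesis by (simp add: j_def w_def)
qed

lemma summable_on_minus:
  fixes f g :: "'a \<Rightarrow> complex"
  assumes "f summable_on A" "g summable_on A"
  shows "(\<lambda>x. f x - g x) summable_on A"
  using summable_on_add [OF assms(1), of "\<lambda>x. - g x"] assms(2) by (simp add: summable_on_uminus)

lemma infsum_minus:
  fixes f g :: "'a \<Rightarrow> complex"
  assumes "f summable_on A" "g summable_on A"
  shows "(\<Sum>\<^sub>\<infinity>x\<in>A. f x - g x) = infsum f A - infsum g A"
  using infsum_add [OF assms(1), of "\<lambda>x. - g x"] assms(2) by (simp add: summable_on_uminus infsum_uminus)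

text \<open>
  Each row contributes 0, being the difference of two convergent sums that agree after a shift. In the
  application \<open>g\<close> is the inverse square of a linear form, for which only the difference can be summed over
  both variables at once.
\<close>

lemma infsum_int_shift:
  fixes g :: "int \<times> int \<Rightarrow> complex"
  assumes summ: "(\<lambda>(m, n). g (m, n + l) - g (m, n)) summable_on \<Lambda>"
    and rows: "\<And>m X. (\<lambda>n. g (m, n)) summable_on X"
    and closed: "\<And>m n. (m, n + l) \<in> \<Lambda> \<longleftrightarrow> (m, n) \<in> \<Lambda>"
  shows "(\<Sum>\<^sub>\<infinity>(m, n)\<in>\<Lambda>. g (m, n + l) - g (m, n)) = 0"
proof -
  define X where "X = (\<lambda>m. {n. (m, n) \<in> \<Lambda>})"
  have \<Lambda>: "\<Lambda> = Sigma UNIV X" by (auto simp: X_def)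
  have bij: "bij_betw (\<lambda>n. n + l) (X m) (X m)" for m
    by (rule bij_betwI [of _ _ _ "\<lambda>n. n - l"]) (use closed [of m] closed [of m "_ - l"] in \<open>auto simp: X_def\<close>)
  have "(\<Sum>\<^sub>\<infinity>(m, n)\<in>\<Lambda>. g (m, n + l) - g (m, n)) = (\<Sum>\<^sub>\<infinity>m. \<Sum>\<^sub>\<infinity>n\<in>X m. g (m, n + l) - g (m, n))"
    using summ unfolding \<Lambda> by (rule infsum_Sigma'_banach [symmetric])
  also have "\<dots> = (\<Sum>\<^sub>\<infinity>m::int. 0)"
  proof (rule infsum_cong)
    fix m
    have "(\<Sum>\<^sub>\<infinity>n\<in>X m. g (m, n + l) - g (m, n)) = (\<Sum>\<^sub>\<infinity>n\<in>X m. g (m, n + l)) - (\<Sum>\<^sub>\<infinity>n\<in>X m. g (m, n))"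
      using summable_on_reindex_bij_betw [OF bij, of "\<lambda>n. g (m, n)" m] rows by (intro infsum_minus) auto
    also have "(\<Sum>\<^sub>\<infinity>n\<in>X m. g (m, n + l)) = (\<Sum>\<^sub>\<infinity>n\<in>X m. g (m, n))"
      by (rule infsum_reindex_bij_betw [OF bij])
    finally show "(\<Sum>\<^sub>\<infinity>n\<in>X m. g (m, n + l) - g (m, n)) = 0" by simp
  qed
  finally show ?thesis by simp
qed

text \<open>
  On a line in the lattice the exponent 2 is enough for absolute convergence.
\<close>

lemma linear_form_lines_summable:
  assumes z: "Im z > 0" and k: "k \<ge> 2"
  shows "(\<lambda>n. 1 / (of_int (m + a) * z + of_int (n + b)) ^ k) summable_on X" (is ?rows)
    and "(\<lambda>m. 1 / (of_int (m + a) * z + of_int (n + b)) ^ k) summable_on X" (is ?cols)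
proof -
  obtain A where A: "A \<ge> 1" "\<And>m n. 1 / norm (of_int m * z + of_int n) \<le> A * (1 / (1 + \<bar>of_int m\<bar> + \<bar>of_int n\<bar>))"
    using inverse_linear_form_bound [OF z, of "\<bar>Re z\<bar>"] by auto
  have bound: "norm (1 / (of_int m * z + of_int n) ^ k) \<le> A ^ k * lattice_weight i"
    if "\<bar>of_int i :: real\<bar> \<le> \<bar>of_int m\<bar> + \<bar>of_int n\<bar>" for m n i
  proof -
    have "norm (1 / (of_int m * z + of_int n) ^ k) = (1 / norm (of_int m * z + of_int n)) ^ k"
      by (simp add: norm_divide norm_power power_one_over)
    also have "\<dots> \<le> (A * (1 / (1 + \<bar>of_int m\<bar> + \<bar>of_int n\<bar>))) ^ k"
      by (intro power_mono A) auto
    also have "\<dots> \<le> (A * (1 / (1 + \<bar>of_int i\<bar>))) ^ k"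
      using that A by (intro power_mono mult_left_mono divide_left_mono) (auto simp: add_pos_nonneg)
    also have "\<dots> = A ^ k * (1 + \<bar>of_int i\<bar>) powr (- real k)"
      by (simp add: power_divide powr_minus_divide powr_realpow add_pos_nonneg power_one_over)
    also have "\<dots> \<le> A ^ k * lattice_weight i"
      unfolding lattice_weight_def using k A by (intro mult_left_mono powr_mono) auto
    finally show ?thesis .
  qed
  have shifted: "(\<lambda>i. A ^ k * lattice_weight (i + l)) summable_on X" for l X
  proof -
    have "bij_betw (\<lambda>i. i + l) UNIV UNIV" by (rule bij_betwI [of _ _ _ "\<lambda>i. i - l"]) auto
    hence "(\<lambda>i. lattice_weight (i + l)) summable_on UNIV"
      by (subst summable_on_reindex_bij_betw) (auto intro: lattice_weight_summable)
    hence "(\<lambda>i. A ^ k * lattice_weight (i + l)) summable_on UNIV"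
      by (rule summable_on_cmult_right)
    thus ?thesis by (rule summable_on_subset) auto
  qed
  show ?rows
    by (rule abs_summable_summable, rule Infinite_Sum.abs_summable_on_comparison_test' [OF shifted [of b]], rule bound) auto
  show ?cols
    by (rule abs_summable_summable, rule Infinite_Sum.abs_summable_on_comparison_test' [OF shifted [of a]], rule bound) auto
qed

text \<open>
  In weight 2 the sum of \<open>1 / w\<^sup>2\<close> over the lattice is not absolutely convergent, so invariance under a
  shift is not a mere reindexing; it is one only row by row.
\<close>

lemma eis_shift_snd:
  assumes adm: "eis_admissible k c" and z: "Im z > 0"
    and closed: "\<And>m n. (m, n + l) \<in> \<Lambda> \<longleftrightarrow> (m, n) \<in> \<Lambda>"
  shows "eis k c \<Lambda> a (b + l) z = eis k c \<Lambda> a b z"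
proof -
  have k: "k \<ge> 2" using adm by (auto simp: eis_admissible_def)
  let ?g = "\<lambda>(m, n). 1 / (of_int (m + a) * z + of_int (n + b)) ^ k"
  have eq: "(\<lambda>p. eis_term k c a (b + l) z p - eis_term k c a b z p) = (\<lambda>(m, n). ?g (m, n + l) - ?g (m, n))"
    by (auto simp: eis_term_def algebra_simps)
  have "(\<lambda>p. eis_term k c a (b + l) z p - eis_term k c a b z p) summable_on \<Lambda>"
    by (intro summable_on_minus eis_term_summable adm z)
  hence "(\<lambda>(m, n). ?g (m, n + l) - ?g (m, n)) summable_on \<Lambda>" unfolding eq .
  hence "(\<Sum>\<^sub>\<infinity>(m, n)\<in>\<Lambda>. ?g (m, n + l) - ?g (m, n)) = 0"
    by (rule infsum_int_shift) (use linear_form_lines_summable(1) [OF z k] closed in auto)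
  hence "(\<Sum>\<^sub>\<infinity>p\<in>\<Lambda>. eis_term k c a (b + l) z p - eis_term k c a b z p) = 0"
    unfolding eq .
  moreover have "(\<Sum>\<^sub>\<infinity>p\<in>\<Lambda>. eis_term k c a (b + l) z p - eis_term k c a b z p) =
                   eis k c \<Lambda> a (b + l) z - eis k c \<Lambda> a b z"
    unfolding eis_def by (intro infsum_minus eis_term_summable adm z)
  ultimately show ?thesis by simp
qed

lemma eis_shift_fst:
  assumes adm: "eis_admissible k c" and z: "Im z > 0"
    and closed: "\<And>m n. (m + l, n) \<in> \<Lambda> \<longleftrightarrow> (m, n) \<in> \<Lambda>"
  shows "eis k c \<Lambda> (a + l) b z = eis k c \<Lambda> a b z"
proof -
  have k: "k \<ge> 2" using adm by (auto simp: eis_admissible_def)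
  let ?g = "\<lambda>(n, m). 1 / (of_int (m + a) * z + of_int (n + b)) ^ k"
  let ?\<Lambda> = "prod.swap ` \<Lambda>"
  have mem: "(n, m) \<in> ?\<Lambda> \<longleftrightarrow> (m, n) \<in> \<Lambda>" for m n by force
  have eq: "(\<lambda>p. eis_term k c (a + l) b z p - eis_term k c a b z p) =
              (\<lambda>(n, m). ?g (n, m + l) - ?g (n, m)) \<circ> prod.swap"
    by (auto simp: eis_term_def algebra_simps)
  have summ: "(\<lambda>p. eis_term k c (a + l) b z p - eis_term k c a b z p) summable_on \<Lambda>"
    by (intro summable_on_minus eis_term_summable adm z)
  hence "(\<lambda>(n, m). ?g (n, m + l) - ?g (n, m)) summable_on ?\<Lambda>"
    unfolding eq by (subst summable_on_reindex) auto
  hence "(\<Sum>\<^sub>\<infinity>(n, m)\<in>?\<Lambda>. ?g (n, m + l) - ?g (n, m)) = 0"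
    by (rule infsum_int_shift) (use linear_form_lines_summable(2) [OF z k] closed in \<open>auto simp: mem\<close>)
  hence "(\<Sum>\<^sub>\<infinity>p\<in>\<Lambda>. eis_term k c (a + l) b z p - eis_term k c a b z p) = 0"
    unfolding eq by (subst (asm) infsum_reindex) auto
  moreover have "(\<Sum>\<^sub>\<infinity>p\<in>\<Lambda>. eis_term k c (a + l) b z p - eis_term k c a b z p) =
                   eis k c \<Lambda> (a + l) b z - eis k c \<Lambda> a b z"
    unfolding eis_def by (intro infsum_minus eis_term_summable adm z)
  ultimately show ?thesis by simp
qed

lemma eis_uminus:
  assumes "even k" and closed: "\<And>m n. (m, n) \<in> \<Lambda> \<Longrightarrow> (-m, -n) \<in> \<Lambda>"
  shows "eis k c \<Lambda> (-a) (-b) z = eis k c \<Lambda> a b z"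
  unfolding eis_def
proof (rule infsum_reindex_bij_witness [where i = "\<lambda>(m, n). (-m, -n)" and j = "\<lambda>(m, n). (-m, -n)"])
  fix p assume "p \<in> \<Lambda>"
  obtain m n where p: "p = (m, n)" by (cases p)
  have "(of_int (-m + a) * z + of_int (-n + b)) ^ k = (of_int (m + -a) * z + of_int (n + -b)) ^ k"
    by (subst power_minus_even [OF assms(1), symmetric]) (simp add: algebra_simps)
  moreover have "(of_int (-m) * z + of_int (-n)) ^ k = (of_int m * z + of_int n) ^ k"
    by (subst power_minus_even [OF assms(1), symmetric]) (simp add: algebra_simps)
  ultimately show "eis_term k c a b z (case p of (m, n) \<Rightarrow> (-m, -n)) = eis_term k c (-a) (-b) z p"
    by (simp only: eis_term_def p prod.case)
qed (use closed in auto)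

section \<open>The algebra of quasi-modular forms\<close>

text \<open>
  In the coordinate \<open>w = exp (2 \<pi> \<i> z / h)\<close> the function is well defined on the punctured disc by
  periodicity. Near \<open>w = 0\<close> linear growth in \<open>z\<close> means growth like \<open>\<bar>ln \<bar>w\<bar>\<bar>\<close>, so that \<open>w\<close> times the function
  tends to 0 and the singularity is removable.
\<close>

lemma holomorphic_at_ii_infI:
  fixes h :: nat
  assumes hol: "f holomorphic_on upper_half_plane" and h: "h > 0"
    and per: "\<And>z. Im z > 0 \<Longrightarrow> f (z + of_nat h) = f z"
    and growth: "\<And>z. 1 \<le> Im z \<Longrightarrow> \<bar>Re z\<bar> \<le> of_nat h \<Longrightarrow> norm (f z) \<le> C * (1 + norm z)"
  shows "holomorphic_at_ii_inf f"
proof -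
  define K where "K = real h / (2 * pi)"
  have K: "K > 0" using h by (simp add: K_def)
  \<comment> \<open>periodicity under all multiples of the width is needed since the logarithm is only determined up to \<open>2 \<pi> \<i> \<int>\<close>\<close>
  have per_nat: "f (z + of_nat (j * h)) = f z" if "Im z > 0" for z j
  proof (induction j)
    case (Suc j)
    have "f (z + of_nat (Suc j * h)) = f ((z + of_nat (j * h)) + of_nat h)" by (simp add: algebra_simps)
    also have "\<dots> = f z" using that Suc by (subst per) auto
    finally show ?case .
  qed auto
  have per_int: "f (z + of_int (j * int h)) = f z" if "Im z > 0" for z j
  proof (cases "j \<ge> 0")
    case True
    thus ?thesis using per_nat [OF that, of "nat j"] by simp
  next
    case False
    thus ?thesis using per_nat [of "z + of_int (j * int h)" "nat (-j)"] that by simp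
  qed
  define \<psi> where "\<psi> = (\<lambda>w. of_real K * (- \<i> * Ln w))"
  define g where "g = (\<lambda>w. f (\<psi> w))"
  have nome_\<psi>: "nome (of_real K * (- \<i> * x) / of_nat h) = exp x" for x
    using h by (simp add: nome_def K_def)
  \<comment> \<open>the choice of the logarithm does not matter\<close>
  have g_nome: "g (nome (z / of_nat h)) = f z" if z: "Im z > 0" for z
  proof -
    define w where "w = nome (z / of_nat h)"
    have "exp (Ln w) = exp (2 * of_real pi * \<i> * (z / of_nat h))"
      by (simp add: w_def nome_def)
    then obtain j :: int where j: "Ln w = 2 * of_real pi * \<i> * (z / of_nat h) + of_real (2 * of_int j * pi) * \<i>"
      by (subst (asm) exp_eq) auto
    have "\<psi> w = z + of_int (j * int h)"
      unfolding \<psi>_def j using h by (simp add: K_def field_simps)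
    thus ?thesis using per_int [OF z] by (simp add: g_def w_def)
  qed
  have Im_\<psi>: "Im (\<psi> w) = K * (- ln (norm w))" if "w \<noteq> 0" for w
    using that by (simp add: \<psi>_def Re_Ln)
  have Re_\<psi>: "Re (\<psi> w) = K * Im (Ln w)" for w
    by (simp add: \<psi>_def)
  have "g analytic_on (ball 0 1 - {0})"
    unfolding analytic_on_def
  proof
    fix w0 :: complex assume w0: "w0 \<in> ball 0 1 - {0}"
    define r where "r = min (norm w0) (1 - norm w0)"
    have r: "r > 0" using w0 by (auto simp: r_def)
    have *: "w \<noteq> 0" "norm w < 1" "w / w0 \<notin> \<real>\<^sub>\<le>\<^sub>0" if w: "w \<in> ball w0 r" for w
    proof -
      have d: "norm (w - w0) < norm w0" "norm (w - w0) < 1 - norm w0"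
        using w by (auto simp: r_def dist_norm norm_minus_commute)
      show "w \<noteq> 0" using d by auto
      show "norm w < 1" using d norm_triangle_ineq [of w0 "w - w0"] by simp
      have "norm (w / w0 - 1) < 1"
        using d w0 by (simp add: divide_simps flip: norm_divide) (metis diff_divide_distrib div_self divide_less_eq_1_pos norm_divide zero_less_norm_iff)
      hence "\<bar>Re (w / w0 - 1)\<bar> < 1" using abs_Re_le_cmod order.strict_trans1 by blast
      hence "Re (w / w0) > 0" by simp
      thus "w / w0 \<notin> \<real>\<^sub>\<le>\<^sub>0" using complex_nonpos_Reals_iff by fastforce
    qed
    \<comment> \<open>near \<open>w0\<close> a holomorphic branch of the logarithm is \<open>Ln w0 + Ln (w / w0)\<close>, whether or not \<open>w0\<close> lies on the branch cut\<close>
    have Ln_eq: "g w = f (\<psi> w0 + of_real K * (- \<i> * Ln (w / w0)))"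
      and in_H: "\<psi> w0 + of_real K * (- \<i> * Ln (w / w0)) \<in> upper_half_plane" if w: "w \<in> ball w0 r" for w
    proof -
      define z where "z = of_real K * (- \<i> * (Ln w0 + Ln (w / w0)))"
      have z: "z = \<psi> w0 + of_real K * (- \<i> * Ln (w / w0))"
        by (simp add: z_def \<psi>_def algebra_simps)
      have "Im z = K * (- (ln (norm w0) + ln (norm (w / w0))))"
        using w0 *(1) [OF w] by (simp add: z_def Re_Ln algebra_simps)
      also have "ln (norm w0) + ln (norm (w / w0)) = ln (norm w)"
        using w0 *(1) [OF w] by (simp add: norm_divide ln_div)
      finally have Im: "Im z > 0" using *(1,2) [OF w] K by (simp add: mult_pos_neg)
      thus "\<psi> w0 + of_real K * (- \<i> * Ln (w / w0)) \<in> upper_half_plane"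
        using Im unfolding z [symmetric] upper_half_plane_def by simp
      have "nome (z / of_nat h) = w"
        unfolding z_def nome_\<psi> exp_add using w0 *(1) [OF w] by simp
      thus "g w = f (\<psi> w0 + of_real K * (- \<i> * Ln (w / w0)))"
        using g_nome [OF Im] unfolding z [symmetric] by (simp only:)
    qed
    have "(f \<circ> (\<lambda>w. \<psi> w0 + of_real K * (- \<i> * Ln (w / w0)))) holomorphic_on ball w0 r"
    proof (rule holomorphic_on_compose_gen [OF _ hol])
      show "(\<lambda>w. \<psi> w0 + of_real K * (- \<i> * Ln (w / w0))) holomorphic_on ball w0 r"
        by (intro holomorphic_intros) (use * w0 in auto)
    qed (use in_H in auto)
    hence "g holomorphic_on ball w0 r"
      by (rule holomorphic_transform) (simp add: Ln_eq)
    thus "\<exists>r>0. g holomorphic_on ball w0 r" using r by blast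
  qed
  hence hol_g: "g holomorphic_on ball 0 1 - {0}" by (rule analytic_imp_holomorphic)
  have C: "C \<ge> 0"
  proof -
    have "0 \<le> norm (f \<i>)" by simp
    also have "\<dots> \<le> C * (1 + norm \<i>)" by (rule growth) auto
    finally show ?thesis by simp
  qed
  have "((\<lambda>w. (w - 0) * g w) \<longlongrightarrow> 0) (at 0)"
  proof (rule Lim_null_comparison)
    have "eventually (\<lambda>w::complex. w \<in> ball 0 (exp (- 1 / K)) - {0}) (at 0)"
      by (intro eventually_at_in_open) auto
    thus "eventually (\<lambda>w::complex. norm ((w - 0) * g w) \<le> norm w * (C * (1 + K * (pi - ln (norm w))))) (at 0)"
    proof eventually_elim
      case (elim w)
      have w: "w \<noteq> 0" "norm w < exp (- 1 / K)" using elim by auto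
      have "ln (norm w) < ln (exp (- 1 / K))" using w by (subst ln_less_cancel_iff) auto
      hence ln: "ln (norm w) < - 1 / K" by simp
      hence "1 \<le> Im (\<psi> w)" using K w by (simp add: Im_\<psi> field_simps)
      moreover have "\<bar>Re (\<psi> w)\<bar> \<le> of_nat h"
      proof -
        have "\<bar>Im (Ln w)\<bar> \<le> pi" using mpi_less_Im_Ln [OF w(1)] Im_Ln_le_pi [OF w(1)] by linarith
        hence "\<bar>Re (\<psi> w)\<bar> \<le> K * pi" using K by (simp add: Re_\<psi> abs_mult)
        also have "\<dots> \<le> of_nat h" using h by (simp add: K_def)
        finally show ?thesis .
      qed
      ultimately have "norm (g w) \<le> C * (1 + norm (\<psi> w))"
        unfolding g_def by (rule growth)
      also have "norm (\<psi> w) = K * norm (Ln w)" using K by (simp add: \<psi>_def norm_mult)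
      also have "norm (Ln w) \<le> \<bar>Re (Ln w)\<bar> + \<bar>Im (Ln w)\<bar>" by (rule cmod_le)
      also have "\<dots> \<le> pi - ln (norm w)"
      proof -
        have "\<bar>Im (Ln w)\<bar> \<le> pi" using mpi_less_Im_Ln [OF w(1)] Im_Ln_le_pi [OF w(1)] by linarith
        moreover have "- 1 / K < 0" using K by simp
        hence "ln (norm w) < 0" using ln by linarith
        ultimately show ?thesis using w by (simp add: Re_Ln)
      qed
      finally have "norm (g w) \<le> C * (1 + K * (pi - ln (norm w)))"
        using K C by (simp add: mult_left_mono)
      thus ?case by (simp add: norm_mult mult_left_mono)
    qed
  next
    have "((\<lambda>x::real. x * (C * (1 + K * (pi - ln x)))) \<longlongrightarrow> 0) (at_right 0)"
      by real_asymp
    moreover have "filterlim (norm :: complex \<Rightarrow> real) (at_right 0) (at 0)"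
      by (auto simp: filterlim_at eventually_at_filter intro!: tendsto_norm_zero tendsto_ident_at)
    ultimately show "((\<lambda>w::complex. norm w * (C * (1 + K * (pi - ln (norm w))))) \<longlongrightarrow> 0) (at 0)"
      by (rule filterlim_compose)
  qed
  hence "\<exists>G. G holomorphic_on ball 0 1 \<and> (\<forall>w\<in>ball 0 1 - {0}. G w = g w)"
    by (subst holomorphic_on_extend_lim [OF hol_g]) auto
  then obtain G where G: "G holomorphic_on ball 0 1" "\<And>w. w \<in> ball 0 1 - {0} \<Longrightarrow> G w = g w"
    by blast
  show ?thesis
    unfolding holomorphic_at_ii_inf_def
  proof (intro exI [of _ h] conjI exI [of _ G] ballI h G(1))
    fix z assume "z \<in> upper_half_plane"
    hence z: "Im z > 0" by (simp add: upper_half_plane_def)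
    have "norm (nome (z / of_nat h)) < 1" using z h by (simp add: nome_def)
    hence "nome (z / of_nat h) \<in> ball 0 1 - {0}" by (simp add: nome_def)
    thus "f z = G (nome (z / of_nat h))" using G(2) g_nome [OF z] by simp
  qed
qed

lemma holomorphic_at_ii_inf_cong:
  assumes "\<And>z. z \<in> upper_half_plane \<Longrightarrow> f z = f' z"
  shows "holomorphic_at_ii_inf f \<longleftrightarrow> holomorphic_at_ii_inf f'"
  unfolding holomorphic_at_ii_inf_def using assms by simp

lemma holomorphic_at_ii_inf_const: "holomorphic_at_ii_inf (\<lambda>_. c)"
  unfolding holomorphic_at_ii_inf_def
  by (intro exI [of _ 1] conjI exI [of _ "\<lambda>_. c"]) auto

text \<open>
  If \<open>h = m h'\<close> then the nome of \<open>z / h'\<close> is the \<open>m\<close>-th power of the nome of \<open>z / h\<close>.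
\<close>

lemma holomorphic_at_ii_inf_common_width:
  assumes "holomorphic_at_ii_inf f" "holomorphic_at_ii_inf f'"
  obtains h :: nat and g g' where "h > 0" "g holomorphic_on ball 0 1" "g' holomorphic_on ball 0 1"
    "\<And>z. z \<in> upper_half_plane \<Longrightarrow> f z = g (nome (z / of_nat h))"
    "\<And>z. z \<in> upper_half_plane \<Longrightarrow> f' z = g' (nome (z / of_nat h))"
proof -
  obtain h1 :: nat and g1 where 1: "h1 > 0" "g1 holomorphic_on ball 0 1"
    "\<And>z. z \<in> upper_half_plane \<Longrightarrow> f z = g1 (nome (z / of_nat h1))"
    using assms(1) unfolding holomorphic_at_ii_inf_def by blast
  obtain h2 :: nat and g2 where 2: "h2 > 0" "g2 holomorphic_on ball 0 1"
    "\<And>z. z \<in> upper_half_plane \<Longrightarrow> f' z = g2 (nome (z / of_nat h2))"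
    using assms(2) unfolding holomorphic_at_ii_inf_def by blast
  have pow: "(g \<circ> (\<lambda>w. w ^ m)) holomorphic_on ball 0 1"
    if "g holomorphic_on ball 0 1" "m > 0" for g :: "complex \<Rightarrow> complex" and m :: nat
    by (rule holomorphic_on_compose_gen [OF _ that(1)])
       (use that(2) in \<open>auto intro!: holomorphic_intros simp: norm_power power_less_one_iff\<close>)
  have nome_pow: "nome (z / of_nat (m * h)) ^ m = nome (z / of_nat h)" if "m > 0" for m h :: nat and z
    using that by (simp add: nome_def flip: exp_of_nat_mult)
  show thesis
  proof (rule that [of "h2 * h1" "g1 \<circ> (\<lambda>w. w ^ h2)" "g2 \<circ> (\<lambda>w. w ^ h1)"])
    show "f z = (g1 \<circ> (\<lambda>w. w ^ h2)) (nome (z / of_nat (h2 * h1)))" if "z \<in> upper_half_plane" for z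
      using 1(3) [OF that] nome_pow [OF 2(1), of z h1] by simp
    show "f' z = (g2 \<circ> (\<lambda>w. w ^ h1)) (nome (z / of_nat (h2 * h1)))" if "z \<in> upper_half_plane" for z
      using 2(3) [OF that] nome_pow [OF 1(1), of z h2] by (simp add: mult.commute)
  qed (use 1 2 pow in auto)
qed

lemma holomorphic_at_ii_inf_add:
  assumes "holomorphic_at_ii_inf f" "holomorphic_at_ii_inf f'"
  shows "holomorphic_at_ii_inf (\<lambda>z. f z + f' z)"
proof -
  obtain h :: nat and g g' where h: "h > 0" and g: "g holomorphic_on ball 0 1" "g' holomorphic_on ball 0 1"
    and eq: "\<And>z. z \<in> upper_half_plane \<Longrightarrow> f z = g (nome (z / of_nat h))"
      "\<And>z. z \<in> upper_half_plane \<Longrightarrow> f' z = g' (nome (z / of_nat h))"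
    by (rule holomorphic_at_ii_inf_common_width [OF assms]) (rule that)
  show ?thesis
    unfolding holomorphic_at_ii_inf_def
    by (intro exI [of _ h] conjI exI [of _ "\<lambda>w. g w + g' w"] h ballI holomorphic_on_add g) (simp add: eq)
qed

lemma holomorphic_at_ii_inf_mult:
  assumes "holomorphic_at_ii_inf f" "holomorphic_at_ii_inf f'"
  shows "holomorphic_at_ii_inf (\<lambda>z. f z * f' z)"
proof -
  obtain h :: nat and g g' where h: "h > 0" and g: "g holomorphic_on ball 0 1" "g' holomorphic_on ball 0 1"
    and eq: "\<And>z. z \<in> upper_half_plane \<Longrightarrow> f z = g (nome (z / of_nat h))"
      "\<And>z. z \<in> upper_half_plane \<Longrightarrow> f' z = g' (nome (z / of_nat h))"
    by (rule holomorphic_at_ii_inf_common_width [OF assms]) (rule that)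
  show ?thesis
    unfolding holomorphic_at_ii_inf_def
    by (intro exI [of _ h] conjI exI [of _ "\<lambda>w. g w * g' w"] h ballI holomorphic_on_mult g) (simp add: eq)
qed

lemma SL2Z_iff: "A \<in> SL2Z \<longleftrightarrow> A$1$1 * A$2$2 - A$1$2 * A$2$1 = 1"
  by (simp add: SL2Z_def det_2)

lemma SL2Z_denominator_nonzero:
  assumes "A \<in> SL2Z" "z \<in> upper_half_plane"
  shows "of_int (A$2$1) * z + of_int (A$2$2) \<noteq> 0"
proof
  assume "of_int (A$2$1) * z + of_int (A$2$2) = 0"
  hence "A$2$1 = 0" "A$2$2 = 0"
    using assms(2) by (auto simp: complex_eq_iff upper_half_plane_def)
  thus False using assms(1) by (simp add: SL2Z_iff)
qed

lemma slash_add: "slash k (\<lambda>z. f z + g z) A = (\<lambda>z. slash k f A z + slash k g A z)"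
  by (simp add: slash_def ring_distribs fun_eq_iff)

lemma slash_mult:
  assumes "A \<in> SL2Z" "z \<in> upper_half_plane"
  shows "slash (k + l) (\<lambda>z. f z * g z) A z = slash k f A z * slash l g A z"
  using SL2Z_denominator_nonzero [OF assms]
  by (simp add: slash_def power_int_add power_int_diff power_int_minus divide_inverse mult_ac)

lemma slash_zero_const: "slash 0 (\<lambda>_. c) A = (\<lambda>_. c)"
  by (simp add: slash_def fun_eq_iff)

lemma modular_forms_add:
  assumes "f \<in> modular_forms k \<Gamma>" "g \<in> modular_forms k \<Gamma>"
  shows "(\<lambda>z. f z + g z) \<in> modular_forms k \<Gamma>"
  using assms
  by (simp add: modular_forms_def slash_add holomorphic_at_ii_inf_add holomorphic_on_add)

lemma modular_forms_mult:
  assumes "f \<in> modular_forms k \<Gamma>" "g \<in> modular_forms l \<Gamma>" "\<Gamma> \<subseteq> SL2Z"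
  shows "(\<lambda>z. f z * g z) \<in> modular_forms (k + l) \<Gamma>"
proof -
  have "holomorphic_at_ii_inf (slash (k + l) (\<lambda>z. f z * g z) A)" if A: "A \<in> SL2Z" for A
  proof -
    have "holomorphic_at_ii_inf (\<lambda>z. slash k f A z * slash l g A z)"
      using assms A unfolding modular_forms_def by (intro holomorphic_at_ii_inf_mult) auto
    thus ?thesis
      by (subst holomorphic_at_ii_inf_cong) (simp_all add: slash_mult [OF A])
  qed
  moreover have "slash (k + l) (\<lambda>z. f z * g z) A z = f z * g z" if "A \<in> \<Gamma>" "z \<in> upper_half_plane" for A z
    using assms that by (subst slash_mult) (auto simp: modular_forms_def)
  ultimately show ?thesis using assms unfolding modular_forms_def
    by (auto intro!: holomorphic_intros)
qed

lemma modular_forms_const: "(\<lambda>_. c) \<in> modular_forms 0 \<Gamma>"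
  by (simp add: modular_forms_def slash_zero_const holomorphic_at_ii_inf_const)

lemma modular_forms_zero: "(\<lambda>_. 0) \<in> modular_forms k \<Gamma>"
  unfolding modular_forms_def by (auto simp: slash_def [abs_def] holomorphic_at_ii_inf_const)

lemma mixed_weight_modular_formsI:
  assumes "f \<in> modular_forms k \<Gamma>"
  shows "f \<in> mixed_weight_modular_forms \<Gamma>"
  unfolding mixed_weight_modular_forms_def
  by (intro CollectI exI [of _ "{k}"] exI [of _ "\<lambda>_. f"]) (use assms in auto)

lemma mixed_weight_modular_forms_add:
  assumes "f \<in> mixed_weight_modular_forms \<Gamma>" "f' \<in> mixed_weight_modular_forms \<Gamma>"
  shows "(\<lambda>z. f z + f' z) \<in> mixed_weight_modular_forms \<Gamma>"
proof -
  obtain K g where 1: "finite K" "\<And>k. k \<in> K \<Longrightarrow> g k \<in> modular_forms k \<Gamma>"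
    "\<And>z. z \<in> upper_half_plane \<Longrightarrow> f z = (\<Sum>k\<in>K. g k z)"
    using assms(1) unfolding mixed_weight_modular_forms_def by blast
  obtain K' g' where 2: "finite K'" "\<And>k. k \<in> K' \<Longrightarrow> g' k \<in> modular_forms k \<Gamma>"
    "\<And>z. z \<in> upper_half_plane \<Longrightarrow> f' z = (\<Sum>k\<in>K'. g' k z)"
    using assms(2) unfolding mixed_weight_modular_forms_def by blast
  define G where "G = (\<lambda>k z. (if k \<in> K then g k else (\<lambda>_. 0)) z + (if k \<in> K' then g' k else (\<lambda>_. 0)) z)"
  show ?thesis unfolding mixed_weight_modular_forms_def
  proof (intro CollectI exI [of _ "K \<union> K'"] exI [of _ G] conjI ballI)
    show "finite (K \<union> K')" using 1 2 by simp
    show "G k \<in> modular_forms k \<Gamma>" for k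
      unfolding G_def by (intro modular_forms_add) (use 1 2 in \<open>auto simp: modular_forms_zero\<close>)
    fix z assume z: "z \<in> upper_half_plane"
    have "(\<Sum>k\<in>K \<union> K'. (if k \<in> K then g k else (\<lambda>_. 0)) z) = (\<Sum>k\<in>K. g k z)"
      by (rule sum.mono_neutral_cong_right) (use 1 2 in auto)
    moreover have "(\<Sum>k\<in>K \<union> K'. (if k \<in> K' then g' k else (\<lambda>_. 0)) z) = (\<Sum>k\<in>K'. g' k z)"
      by (rule sum.mono_neutral_cong_right) (use 1 2 in auto)
    ultimately show "f z + f' z = (\<Sum>k\<in>K \<union> K'. G k z)"
      using 1(3) [OF z] 2(3) [OF z] by (simp add: G_def sum.distrib)
  qed
qed

lemma mixed_weight_modular_forms_cong:
  assumes "f \<in> mixed_weight_modular_forms \<Gamma>" "\<And>z. z \<in> upper_half_plane \<Longrightarrow> f z = f' z"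
  shows "f' \<in> mixed_weight_modular_forms \<Gamma>"
  using assms unfolding mixed_weight_modular_forms_def by simp

lemma mixed_weight_modular_forms_const: "(\<lambda>_. c) \<in> mixed_weight_modular_forms \<Gamma>"
  by (rule mixed_weight_modular_formsI [OF modular_forms_const])

lemma mixed_weight_modular_forms_sum:
  assumes "\<And>i. i \<in> I \<Longrightarrow> f i \<in> mixed_weight_modular_forms \<Gamma>"
  shows "(\<lambda>z. \<Sum>i\<in>I. f i z) \<in> mixed_weight_modular_forms \<Gamma>"
  using assms
  by (induction I rule: infinite_finite_induct)
     (auto intro: mixed_weight_modular_forms_add mixed_weight_modular_forms_const)

lemma mixed_weight_modular_forms_mult:
  assumes "f \<in> mixed_weight_modular_forms \<Gamma>" "f' \<in> mixed_weight_modular_forms \<Gamma>" "\<Gamma> \<subseteq> SL2Z"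
  shows "(\<lambda>z. f z * f' z) \<in> mixed_weight_modular_forms \<Gamma>"
proof -
  obtain K g where 1: "finite K" "\<And>k. k \<in> K \<Longrightarrow> g k \<in> modular_forms k \<Gamma>"
    "\<And>z. z \<in> upper_half_plane \<Longrightarrow> f z = (\<Sum>k\<in>K. g k z)"
    using assms(1) unfolding mixed_weight_modular_forms_def by blast
  obtain K' g' where 2: "finite K'" "\<And>k. k \<in> K' \<Longrightarrow> g' k \<in> modular_forms k \<Gamma>"
    "\<And>z. z \<in> upper_half_plane \<Longrightarrow> f' z = (\<Sum>k\<in>K'. g' k z)"
    using assms(2) unfolding mixed_weight_modular_forms_def by blast
  have "(\<lambda>z. \<Sum>k\<in>K. \<Sum>l\<in>K'. g k z * g' l z) \<in> mixed_weight_modular_forms \<Gamma>"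
    by (intro mixed_weight_modular_forms_sum
          mixed_weight_modular_formsI [OF modular_forms_mult [OF 1(2) 2(2) assms(3)]])
  thus ?thesis
    by (rule mixed_weight_modular_forms_cong) (simp add: 1 2 sum_product)
qed

lemma quasimodular_forms_cong:
  assumes "f \<in> quasimodular_forms \<Gamma>" "\<And>z. z \<in> upper_half_plane \<Longrightarrow> f z = f' z"
  shows "f' \<in> quasimodular_forms \<Gamma>"
  using assms unfolding quasimodular_forms_def by simp

lemma quasimodular_forms_monomial:
  assumes "c \<in> mixed_weight_modular_forms \<Gamma>"
  shows "(\<lambda>z. c z * eisenstein_phi z ^ j) \<in> quasimodular_forms \<Gamma>"
proof -
  define d where "d = (\<lambda>i::nat. if i = j then c else (\<lambda>_. 0))"
  have "(\<Sum>i\<le>j. d i z * eisenstein_phi z ^ i) = c z * eisenstein_phi z ^ j" for z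
    by (simp add: d_def if_distrib [of "\<lambda>f. f z * _"] sum.delta cong: if_cong)
  thus ?thesis unfolding quasimodular_forms_def
    by (intro CollectI exI [of _ j] exI [of _ d])
       (use assms in \<open>auto simp: d_def mixed_weight_modular_forms_const\<close>)
qed

lemma quasimodular_forms_add:
  assumes "f \<in> quasimodular_forms \<Gamma>" "f' \<in> quasimodular_forms \<Gamma>"
  shows "(\<lambda>z. f z + f' z) \<in> quasimodular_forms \<Gamma>"
proof -
  obtain n c where 1: "\<And>j. j \<le> n \<Longrightarrow> c j \<in> mixed_weight_modular_forms \<Gamma>"
    "\<And>z. z \<in> upper_half_plane \<Longrightarrow> f z = (\<Sum>j\<le>n. c j z * eisenstein_phi z ^ j)"
    using assms(1) unfolding quasimodular_forms_def by blast
  obtain n' c' where 2: "\<And>j. j \<le> n' \<Longrightarrow> c' j \<in> mixed_weight_modular_forms \<Gamma>"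
    "\<And>z. z \<in> upper_half_plane \<Longrightarrow> f' z = (\<Sum>j\<le>n'. c' j z * eisenstein_phi z ^ j)"
    using assms(2) unfolding quasimodular_forms_def by blast
  define d where "d = (\<lambda>j z. (if j \<le> n then c j else (\<lambda>_. 0)) z + (if j \<le> n' then c' j else (\<lambda>_. 0)) z)"
  show ?thesis unfolding quasimodular_forms_def
  proof (intro CollectI exI [of _ "max n n'"] exI [of _ d] conjI ballI allI impI)
    show "d j \<in> mixed_weight_modular_forms \<Gamma>" for j
      unfolding d_def by (intro mixed_weight_modular_forms_add)
        (use 1 2 in \<open>auto simp: mixed_weight_modular_forms_const\<close>)
    fix z assume z: "z \<in> upper_half_plane"
    have "(\<Sum>j\<le>max n n'. (if j \<le> n then c j else (\<lambda>_. 0)) z * eisenstein_phi z ^ j) = (\<Sum>j\<le>n. c j z * eisenstein_phi z ^ j)"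
      by (rule sum.mono_neutral_cong_right) auto
    moreover have "(\<Sum>j\<le>max n n'. (if j \<le> n' then c' j else (\<lambda>_. 0)) z * eisenstein_phi z ^ j) = (\<Sum>j\<le>n'. c' j z * eisenstein_phi z ^ j)"
      by (rule sum.mono_neutral_cong_right) auto
    ultimately show "f z + f' z = (\<Sum>j\<le>max n n'. d j z * eisenstein_phi z ^ j)"
      using 1(2) [OF z] 2(2) [OF z] by (simp add: d_def sum.distrib ring_distribs)
  qed
qed

lemma quasimodular_forms_const: "(\<lambda>_. c) \<in> quasimodular_forms \<Gamma>"
  using quasimodular_forms_monomial [OF mixed_weight_modular_forms_const, where j = 0] by simp

lemma quasimodular_forms_sum:
  assumes "\<And>i. i \<in> I \<Longrightarrow> f i \<in> quasimodular_forms \<Gamma>"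
  shows "(\<lambda>z. \<Sum>i\<in>I. f i z) \<in> quasimodular_forms \<Gamma>"
  using assms
  by (induction I rule: infinite_finite_induct)
     (auto intro: quasimodular_forms_add quasimodular_forms_const)

lemma quasimodular_forms_mult:
  assumes "f \<in> quasimodular_forms \<Gamma>" "f' \<in> quasimodular_forms \<Gamma>" "\<Gamma> \<subseteq> SL2Z"
  shows "(\<lambda>z. f z * f' z) \<in> quasimodular_forms \<Gamma>"
proof -
  obtain n c where 1: "\<And>j. j \<le> n \<Longrightarrow> c j \<in> mixed_weight_modular_forms \<Gamma>"
    "\<And>z. z \<in> upper_half_plane \<Longrightarrow> f z = (\<Sum>j\<le>n. c j z * eisenstein_phi z ^ j)"
    using assms(1) unfolding quasimodular_forms_def by blast
  obtain n' c' where 2: "\<And>j. j \<le> n' \<Longrightarrow> c' j \<in> mixed_weight_modular_forms \<Gamma>"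
    "\<And>z. z \<in> upper_half_plane \<Longrightarrow> f' z = (\<Sum>j\<le>n'. c' j z * eisenstein_phi z ^ j)"
    using assms(2) unfolding quasimodular_forms_def by blast
  have "(\<lambda>z. \<Sum>i\<le>n. \<Sum>j\<le>n'. c i z * c' j z * eisenstein_phi z ^ (i + j)) \<in> quasimodular_forms \<Gamma>"
    by (intro quasimodular_forms_sum quasimodular_forms_monomial mixed_weight_modular_forms_mult 1 2 assms) auto
  thus ?thesis
  proof (rule quasimodular_forms_cong)
    fix z assume z: "z \<in> upper_half_plane"
    show "(\<Sum>i\<le>n. \<Sum>j\<le>n'. c i z * c' j z * eisenstein_phi z ^ (i + j)) = f z * f' z"
      unfolding 1(2) [OF z] 2(2) [OF z] sum_product by (simp add: power_add mult_ac)
  qed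
qed

lemma quasimodular_forms_modular:
  "f \<in> modular_forms k \<Gamma> \<Longrightarrow> f \<in> quasimodular_forms \<Gamma>"
  using quasimodular_forms_monomial [OF mixed_weight_modular_formsI, where j = 0] by simp

lemma quasimodular_forms_phi: "eisenstein_phi \<in> quasimodular_forms \<Gamma>"
  using quasimodular_forms_monomial [OF mixed_weight_modular_forms_const [of 1], where j = 1] by simp

lemma quasimodular_forms_cmult:
  assumes "f \<in> quasimodular_forms \<Gamma>" "\<Gamma> \<subseteq> SL2Z"
  shows "(\<lambda>z. c * f z) \<in> quasimodular_forms \<Gamma>"
  by (intro quasimodular_forms_mult quasimodular_forms_const assms)

lemma quasimodular_forms_diff:
  assumes "f \<in> quasimodular_forms \<Gamma>" "g \<in> quasimodular_forms \<Gamma>" "\<Gamma> \<subseteq> SL2Z"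
  shows "(\<lambda>z. f z - g z) \<in> quasimodular_forms \<Gamma>"
  using quasimodular_forms_add [OF assms(1) quasimodular_forms_cmult [OF assms(2,3), of "-1"]] by simp

section \<open>Lattice sums as modular forms\<close>

lemma slash_eis:
  fixes A :: "int^2^2"
  assumes "A \<in> SL2Z" "z \<in> upper_half_plane"
  shows "slash (int k) (eis k c \<Lambda> a b) A z =
           eis k c (row_act (A$1$1) (A$1$2) (A$2$1) (A$2$2) ` \<Lambda>)
             (a * A$1$1 + b * A$2$1) (a * A$1$2 + b * A$2$2) z"
  using eis_moebius [of "A$1$1" "A$2$2" "A$1$2" "A$2$1" z k c \<Lambda> a b] assms
  by (simp add: slash_def moebius_def SL2Z_iff upper_half_plane_def power_int_minus_divide)

text \<open>
  Evaluated at \<open>z\<close>, this is the lattice \<open>\<int> D z + \<int>\<close>.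
\<close>

definition strip_lattice :: "nat \<Rightarrow> (int \<times> int) set" where
  "strip_lattice D = {(m, n). int D dvd m}"

lemma mem_strip_lattice [simp]: "(m, n) \<in> strip_lattice D \<longleftrightarrow> int D dvd m"
  by (simp add: strip_lattice_def)

lemma mem_row_act_strip_lattice:
  assumes "\<alpha> * \<delta> - \<beta> * \<gamma> = 1"
  shows "(m, n) \<in> row_act \<alpha> \<beta> \<gamma> \<delta> ` strip_lattice D \<longleftrightarrow> int D dvd m * \<delta> - n * \<gamma>"
proof
  assume "(m, n) \<in> row_act \<alpha> \<beta> \<gamma> \<delta> ` strip_lattice D"
  then obtain p where p: "p \<in> strip_lattice D" "(m, n) = row_act \<alpha> \<beta> \<gamma> \<delta> p" by auto
  have "row_act \<delta> (-\<beta>) (-\<gamma>) \<alpha> (m, n) = p"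
    unfolding p(2) by (rule row_act_inverse(2) [OF assms])
  thus "int D dvd m * \<delta> - n * \<gamma>" using p(1) by (auto simp: row_act_def strip_lattice_def)
next
  assume *: "int D dvd m * \<delta> - n * \<gamma>"
  show "(m, n) \<in> row_act \<alpha> \<beta> \<gamma> \<delta> ` strip_lattice D"
  proof (rule image_eqI)
    show "(m, n) = row_act \<alpha> \<beta> \<gamma> \<delta> (row_act \<delta> (-\<beta>) (-\<gamma>) \<alpha> (m, n))"
      by (rule row_act_inverse(1) [OF assms, symmetric])
    show "row_act \<delta> (-\<beta>) (-\<gamma>) \<alpha> (m, n) \<in> strip_lattice D"
      using * by (simp add: row_act_def strip_lattice_def)
  qed
qed

text \<open>
  The group is contained in \<open>\<plusminus>\<Gamma>\<^sub>1(D)\<close>: the remaining congruence for the lower right entry follows from the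
  determinant.
\<close>

definition within_pm_Gamma1 :: "nat \<Rightarrow> (int^2^2) set \<Rightarrow> bool" where
  "within_pm_Gamma1 D \<Gamma> \<longleftrightarrow> \<Gamma> \<subseteq> SL2Z \<and>
     (\<forall>A\<in>\<Gamma>. int D dvd A$2$1 \<and> (int D dvd A$1$1 - 1 \<or> int D dvd A$1$1 + 1))"

text \<open>
  Write \<open>(\<alpha>, \<beta>)\<close> and \<open>(\<gamma>, \<delta>)\<close> for the rows of the matrix. It maps the lattice to itself because \<open>D\<close> divides
  \<open>\<gamma>\<close> and is prime to \<open>\<delta>\<close>. The shift \<open>(a, 0)\<close> becomes \<open>(a \<alpha>, a \<beta>)\<close>, which differs from \<open>(a, 0)\<close> or \<open>(-a, 0)\<close>
  by a lattice vector.
\<close>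

lemma eis_strip_lattice_invariant:
  fixes A :: "int^2^2"
  assumes adm: "eis_admissible k c" and "even k" and z: "z \<in> upper_half_plane"
    and A: "A \<in> SL2Z" "int D dvd A$2$1" "int D dvd A$1$1 - 1 \<or> int D dvd A$1$1 + 1"
  shows "slash (int k) (eis k c (strip_lattice D) a 0) A z = eis k c (strip_lattice D) a 0 z"
proof -
  define \<alpha> \<beta> \<gamma> \<delta> where "\<alpha> = A$1$1" and "\<beta> = A$1$2" and "\<gamma> = A$2$1" and "\<delta> = A$2$2"
  have det: "\<alpha> * \<delta> - \<beta> * \<gamma> = 1" using A(1) by (simp add: SL2Z_iff \<alpha>_def \<beta>_def \<gamma>_def \<delta>_def)
  have Imz: "Im z > 0" using z by (simp add: upper_half_plane_def)
  obtain u where u: "\<gamma> = int D * u" using A(2) by (auto simp: \<gamma>_def)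
  let ?\<Lambda> = "strip_lattice D"
  have "int D dvd m * \<delta> - n * \<gamma> \<longleftrightarrow> int D dvd m" for m n
  proof -
    have "coprime (int D) \<delta>"
    proof (rule coprimeI)
      fix c assume c: "c dvd int D" "c dvd \<delta>"
      hence "c dvd \<alpha> * \<delta> - \<beta> * \<gamma>" unfolding u by (intro dvd_diff) auto
      thus "is_unit c" by (simp add: det)
    qed
    moreover have "int D dvd m * \<delta> - n * \<gamma> \<longleftrightarrow> int D dvd m * \<delta>"
      unfolding u by (metis dvd_diff_right_iff dvd_triv_left mult.left_commute dvd_diff_left_iff)
    ultimately show ?thesis by (simp add: coprime_dvd_mult_left_iff)
  qed
  hence \<Lambda>: "row_act \<alpha> \<beta> \<gamma> \<delta> ` ?\<Lambda> = ?\<Lambda>"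
    by (intro set_eqI) (metis surj_pair mem_row_act_strip_lattice [OF det] mem_strip_lattice)
  have "slash (int k) (eis k c ?\<Lambda> a 0) A z = eis k c ?\<Lambda> (a * \<alpha>) (0 + a * \<beta>) z"
    using slash_eis [OF A(1) z, of k c ?\<Lambda> a 0] \<Lambda> by (simp add: \<alpha>_def \<beta>_def \<gamma>_def \<delta>_def)
  also have "\<dots> = eis k c ?\<Lambda> (a * \<alpha>) 0 z"
    by (rule eis_shift_snd [OF adm Imz]) (simp add: strip_lattice_def)
  also have "\<dots> = eis k c ?\<Lambda> a 0 z"
  proof (cases "int D dvd \<alpha> - 1")
    case True
    have "eis k c ?\<Lambda> (a + a * (\<alpha> - 1)) 0 z = eis k c ?\<Lambda> a 0 z"
      by (rule eis_shift_fst [OF adm Imz]) (use True in \<open>simp add: strip_lattice_def dvd_add_left_iff\<close>)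
    thus ?thesis by (simp add: algebra_simps)
  next
    case False
    hence "int D dvd \<alpha> + 1" using A(3) by (simp add: \<alpha>_def)
    hence "eis k c ?\<Lambda> (- a + a * (\<alpha> + 1)) 0 z = eis k c ?\<Lambda> (- a) 0 z"
      by (intro eis_shift_fst [OF adm Imz]) (simp add: strip_lattice_def dvd_add_left_iff)
    also have "\<dots> = eis k c ?\<Lambda> a 0 z"
      using eis_uminus [OF \<open>even k\<close>, of ?\<Lambda> c a 0] by (simp add: strip_lattice_def)
    finally show ?thesis by (simp add: algebra_simps)
  qed
  finally show ?thesis .
qed

text \<open>
  The transformed lattice contains \<open>D \<int>\<^sup>2\<close>. Translation of \<open>z\<close> by \<open>D\<close> therefore preserves the lattice and
  changes the shift by a lattice vector, so the sum has period \<open>D\<close>.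
\<close>

lemma eis_holomorphic_at_cusps:
  assumes adm: "eis_admissible k c" and D: "D > 0" and det: "\<alpha> * \<delta> - \<beta> * \<gamma> = 1"
  shows "holomorphic_at_ii_inf (eis k c (row_act \<alpha> \<beta> \<gamma> \<delta> ` strip_lattice D) a b)"
proof -
  define \<Lambda> where "\<Lambda> = row_act \<alpha> \<beta> \<gamma> \<delta> ` strip_lattice D"
  have mem: "(m, n) \<in> \<Lambda> \<longleftrightarrow> int D dvd m * \<delta> - n * \<gamma>" for m n
    unfolding \<Lambda>_def by (rule mem_row_act_strip_lattice [OF det])
  have shift: "(m, n + int D * l) \<in> \<Lambda> \<longleftrightarrow> (m, n) \<in> \<Lambda>" for m n l
  proof -
    have "m * \<delta> - (n + int D * l) * \<gamma> = (m * \<delta> - n * \<gamma>) - int D * (l * \<gamma>)"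
      by (simp add: algebra_simps)
    thus ?thesis unfolding mem by (metis dvd_diff_left_iff dvd_triv_left)
  qed
  have translate: "row_act 1 (int D) 0 1 ` \<Lambda> = \<Lambda>"
  proof (intro equalityI subsetI)
    fix p assume "p \<in> row_act 1 (int D) 0 1 ` \<Lambda>"
    then obtain m n where "(m, n) \<in> \<Lambda>" "p = (m, n + int D * m)"
      by (auto simp: row_act_def mult.commute add.commute)
    thus "p \<in> \<Lambda>" using shift by simp
  next
    fix p assume p: "p \<in> \<Lambda>"
    obtain m n where mn: "p = (m, n)" by (cases p)
    have "(m, n + int D * (-m)) \<in> \<Lambda>" using p shift unfolding mn by blast
    moreover have "p = row_act 1 (int D) 0 1 (m, n + int D * (-m))"
      by (simp add: row_act_def mn)
    ultimately show "p \<in> row_act 1 (int D) 0 1 ` \<Lambda>" by blast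
  qed
  obtain C where C: "\<And>z. 1 \<le> Im z \<Longrightarrow> \<bar>Re z\<bar> \<le> of_nat D \<Longrightarrow> norm (eis k c \<Lambda> a b z) \<le> C * (1 + norm z)"
    using eis_growth [OF adm, of 1 "of_nat D" \<Lambda> a b] by auto
  show ?thesis
    unfolding \<Lambda>_def [symmetric]
  proof (rule holomorphic_at_ii_infI [OF holomorphic_eis [OF adm] D _ C])
    fix z :: complex assume z: "Im z > 0"
    have "eis k c \<Lambda> a b (z + of_nat D) = eis k c \<Lambda> a (a * int D + b) z"
      using eis_moebius [of 1 1 "int D" 0 z k c \<Lambda> a b] z by (simp add: translate)
    also have "\<dots> = eis k c \<Lambda> a (b + int D * a) z" by (simp add: algebra_simps)
    also have "\<dots> = eis k c \<Lambda> a b z"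
      by (rule eis_shift_snd [OF adm z shift])
    finally show "eis k c \<Lambda> a b (z + of_nat D) = eis k c \<Lambda> a b z" .
  qed
qed

theorem eis_in_modular_forms:
  assumes adm: "eis_admissible k c" and "even k" and D: "D > 0" and \<Gamma>: "within_pm_Gamma1 D \<Gamma>"
  shows "eis k c (strip_lattice D) a 0 \<in> modular_forms (int k) \<Gamma>"
  unfolding modular_forms_def
proof (intro CollectI conjI ballI)
  show "eis k c (strip_lattice D) a 0 holomorphic_on upper_half_plane"
    by (rule holomorphic_eis [OF adm])
  fix A assume A: "A \<in> \<Gamma>"
  fix z assume z: "z \<in> upper_half_plane"
  show "slash (int k) (eis k c (strip_lattice D) a 0) A z = eis k c (strip_lattice D) a 0 z"
    using \<Gamma> A by (intro eis_strip_lattice_invariant adm \<open>even k\<close> z) (auto simp: within_pm_Gamma1_def)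
next
  fix A assume A: "A \<in> SL2Z"
  have det: "A$1$1 * A$2$2 - A$1$2 * A$2$1 = 1" using A by (simp add: SL2Z_iff)
  show "holomorphic_at_ii_inf (slash (int k) (eis k c (strip_lattice D) a 0) A)"
    using eis_holomorphic_at_cusps [OF adm D det, of "a * A$1$1 + 0 * A$2$1" "a * A$1$2 + 0 * A$2$2"]
    by (subst holomorphic_at_ii_inf_cong [OF slash_eis [OF A]])
qed

section \<open>Fourier expansions of lattice sums\<close>

text \<open>
  The two-sided series \<open>T(a)\<close>. Taking negative \<open>m\<close> along makes it the expansion of a single lattice sum.
\<close>

definition residue_class_sum :: "nat \<Rightarrow> nat \<Rightarrow> int \<Rightarrow> complex \<Rightarrow> complex" where
  "residue_class_sum i D a q = (\<Sum>\<^sub>\<infinity>m\<in>{m::int. m \<noteq> 0 \<and> [m = a] (mod int D)}. polylog_neg i (q ^ nat \<bar>m\<bar>))"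

lemma polylog_neg_int_summable:
  assumes "norm q < 1" "i > 0" "X \<subseteq> - {0::int}"
  shows "(\<lambda>m. polylog_neg i (q ^ nat \<bar>m\<bar>)) summable_on X"
proof -
  have *: "(\<lambda>m. polylog_neg i (q ^ m)) summable_on {0<..}"
    using abs_summable_summable [OF abs_summable_polylog_neg_power [of q i "{0<..}" 1]] assms by simp
  have "(\<lambda>m. polylog_neg i (q ^ nat \<bar>m\<bar>)) summable_on (int ` {0<..})"
    using * by (subst summable_on_reindex) (auto simp: o_def)
  moreover have "(\<lambda>m. polylog_neg i (q ^ nat \<bar>m\<bar>)) summable_on ((\<lambda>m. - int m) ` {0<..})"
    using * by (subst summable_on_reindex) (auto simp: o_def inj_on_def)
  ultimately have "(\<lambda>m. polylog_neg i (q ^ nat \<bar>m\<bar>)) summable_on (int ` {0<..} \<union> (\<lambda>m. - int m) ` {0<..})"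
    by (rule summable_on_Un_disjoint) auto
  moreover have "X \<subseteq> int ` {0<..} \<union> (\<lambda>m. - int m) ` {0<..}"
  proof
    fix m assume "m \<in> X"
    hence "m \<noteq> 0" using assms by auto
    thus "m \<in> int ` {0<..} \<union> (\<lambda>m. - int m) ` {0<..}"
      by (cases "m > 0") (auto intro: image_eqI [of _ _ "nat m"] image_eqI [of _ _ "nat (-m)"])
  qed
  ultimately show ?thesis by (rule summable_on_subset)
qed

text \<open>
  For negative \<open>m\<close> the row is the negative of the row of \<open>\<bar>m\<bar>\<close>, and \<open>k\<close> is even.
\<close>

lemma row_sum_eq_polylog_neg:
  assumes "even k" "k \<ge> 2" "Im z > 0" "m \<noteq> 0"
  shows "(\<Sum>\<^sub>\<infinity>n::int. 1 / (of_int m * z + of_int n) ^ k) =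
           lipschitz_const k * polylog_neg (k - 1) (nome z ^ nat \<bar>m\<bar>)"
proof -
  have pos: "(\<Sum>\<^sub>\<infinity>n::int. 1 / (of_nat m * z + of_int n) ^ k) =
               lipschitz_const k * polylog_neg (k - 1) (nome z ^ m)" if "m > 0" for m :: nat
    using lipschitz_formula [of "of_nat m * z" k] that assms
    by (intro infsumI) (simp add: nome_of_nat_mult)
  show ?thesis
  proof (cases "m > 0")
    case True
    thus ?thesis using pos [of "nat m"] by simp
  next
    case False
    have "(\<Sum>\<^sub>\<infinity>n::int. 1 / (of_int m * z + of_int n) ^ k) =
            (\<Sum>\<^sub>\<infinity>n::int. 1 / (of_nat (nat (-m)) * z + of_int n) ^ k)"
    proof (rule infsum_reindex_bij_witness [where i = uminus and j = uminus])
      fix n :: int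
      have "of_nat (nat (-m)) * z + of_int (-n) = - (of_int m * z + of_int n)"
        using False by simp
      thus "1 / (of_nat (nat (-m)) * z + of_int (-n)) ^ k = 1 / (of_int m * z + of_int n) ^ k"
        using \<open>even k\<close> by (simp only: power_minus_even)
    qed auto
    also have "\<dots> = lipschitz_const k * polylog_neg (k - 1) (nome z ^ nat \<bar>m\<bar>)"
      using pos [of "nat (-m)"] False assms by simp
    finally show ?thesis .
  qed
qed

text \<open>
  For even \<open>k\<close> this is \<open>2 \<zeta>(k)\<close>, the contribution of the row through the origin.
\<close>

definition even_zeta :: "nat \<Rightarrow> complex" where
  "even_zeta k = (\<Sum>\<^sub>\<infinity>n::int. 1 / of_int n ^ k)"

lemma residue_class_row_sums:
  assumes "even k" "k \<ge> 2" "Im z > 0"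
  shows "((\<lambda>m. \<Sum>\<^sub>\<infinity>n::int. 1 / (of_int m * z + of_int n) ^ k) has_sum
           (lipschitz_const k * residue_class_sum (k - 1) D a (nome z) + (if int D dvd a then even_zeta k else 0)))
         {m. [m = a] (mod int D)}"
proof -
  let ?H = "\<lambda>m. \<Sum>\<^sub>\<infinity>n::int. 1 / (of_int m * z + of_int n) ^ k"
  let ?X = "{m::int. m \<noteq> 0 \<and> [m = a] (mod int D)}"
  let ?Y = "{m::int. m = 0 \<and> [m = a] (mod int D)}"
  have "((\<lambda>m. lipschitz_const k * polylog_neg (k - 1) (nome z ^ nat \<bar>m\<bar>)) has_sum
           (lipschitz_const k * residue_class_sum (k - 1) D a (nome z))) ?X"
    unfolding residue_class_sum_def
    by (intro has_sum_cmult_right has_sum_infsum polylog_neg_int_summable norm_nome_less_1) (use assms in auto)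
  hence 1: "(?H has_sum (lipschitz_const k * residue_class_sum (k - 1) D a (nome z))) ?X"
    by (rule has_sum_cong [THEN iffD1, rotated]) (use assms in \<open>auto simp: row_sum_eq_polylog_neg\<close>)
  have "?Y = (if int D dvd a then {0} else {})"
    by (auto simp: cong_def dvd_eq_mod_eq_0)
  moreover have "(?H has_sum even_zeta k) {0}"
    by (rule has_sum_finiteI) (simp_all add: even_zeta_def)
  ultimately have 2: "(?H has_sum (if int D dvd a then even_zeta k else 0)) ?Y"
    by (simp split: if_split)
  have "?X \<union> ?Y = {m. [m = a] (mod int D)}" by blast
  moreover have "?X \<inter> ?Y = {}" by blast
  ultimately show ?thesis using has_sum_Un_disjoint [OF 1 2] by (simp only:)
qed

text \<open>
  The double sum converges absolutely, so it may be taken row by row. Only then is each row split into its two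
  parts, to which the Lipschitz formula applies.
\<close>

theorem eis_fourier_expansion:
  assumes adm: "eis_admissible k c" and "even k" and z: "Im z > 0"
  shows "eis k c (strip_lattice D) a 0 z =
           lipschitz_const k * residue_class_sum (k - 1) D a (nome z) + (if int D dvd a then even_zeta k else 0)
           - c * (lipschitz_const k * residue_class_sum (k - 1) D 0 (nome z) + even_zeta k)"
proof -
  have k: "k \<ge> 2" using adm by (auto simp: eis_admissible_def)
  let ?H = "\<lambda>m. \<Sum>\<^sub>\<infinity>n::int. 1 / (of_int m * z + of_int n) ^ k"
  let ?X = "{m::int. int D dvd m}"
  have "strip_lattice D = Sigma ?X (\<lambda>_. UNIV)"
    by (auto simp: strip_lattice_def)
  hence "eis k c (strip_lattice D) a 0 z = infsum (eis_term k c a 0 z) (Sigma ?X (\<lambda>_. UNIV))"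
    by (simp add: eis_def)
  also have "\<dots> = (\<Sum>\<^sub>\<infinity>m\<in>?X. \<Sum>\<^sub>\<infinity>n\<in>UNIV. eis_term k c a 0 z (m, n))"
    by (rule infsum_Sigma_banach [OF eis_term_summable [OF adm z], symmetric])
  also have "\<dots> = (\<Sum>\<^sub>\<infinity>m\<in>?X. ?H (m + a) - c * ?H m)"
  proof (rule infsum_cong)
    fix m
    have "(\<lambda>n. 1 / (of_int (m + a) * z + of_int n) ^ k) summable_on UNIV"
      "(\<lambda>n. 1 / (of_int m * z + of_int n) ^ k) summable_on UNIV"
      using linear_form_lines_summable(1) [OF z k, of m a 0] linear_form_lines_summable(1) [OF z k, of m 0 0] by auto
    note summ = this
    have "(\<Sum>\<^sub>\<infinity>n\<in>UNIV. eis_term k c a 0 z (m, n)) =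
            (\<Sum>\<^sub>\<infinity>n::int. 1 / (of_int (m + a) * z + of_int n) ^ k - c * (1 / (of_int m * z + of_int n) ^ k))"
      by (simp add: eis_term_def)
    also have "\<dots> = ?H (m + a) - (\<Sum>\<^sub>\<infinity>n::int. c * (1 / (of_int m * z + of_int n) ^ k))"
      by (intro infsum_minus summable_on_cmult_right summ)
    also have "(\<Sum>\<^sub>\<infinity>n::int. c * (1 / (of_int m * z + of_int n) ^ k)) = c * ?H m"
      by (rule infsum_cmult_right')
    finally show "(\<Sum>\<^sub>\<infinity>n\<in>UNIV. eis_term k c a 0 z (m, n)) = ?H (m + a) - c * ?H m" .
  qed
  also have "\<dots> = lipschitz_const k * residue_class_sum (k - 1) D a (nome z) + (if int D dvd a then even_zeta k else 0)
           - c * (lipschitz_const k * residue_class_sum (k - 1) D 0 (nome z) + even_zeta k)"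
  proof (rule infsumI)
    have bij: "bij_betw (\<lambda>m. m + a) ?X {m. [m = a] (mod int D)}"
      by (rule bij_betwI [of _ _ _ "\<lambda>m. m - a"]) (auto simp: cong_iff_dvd_diff)
    have 1: "((\<lambda>m. ?H (m + a)) has_sum
           (lipschitz_const k * residue_class_sum (k - 1) D a (nome z) + (if int D dvd a then even_zeta k else 0))) ?X"
      using residue_class_row_sums [OF \<open>even k\<close> k z] has_sum_reindex_bij_betw [OF bij, of ?H] by blast
    have "?X = {m. [m = 0] (mod int D)}" by (auto simp: cong_0_iff)
    hence "(?H has_sum (lipschitz_const k * residue_class_sum (k - 1) D 0 (nome z) + even_zeta k)) ?X"
      using residue_class_row_sums [OF \<open>even k\<close> k z, where D = D and a = 0] by simp
    hence 2: "((\<lambda>m. - (c * ?H m)) has_sum - (c * (lipschitz_const k * residue_class_sum (k - 1) D 0 (nome z) + even_zeta k))) ?X"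
      by (intro has_sum_uminusI has_sum_cmult_right)
    show "((\<lambda>m. ?H (m + a) - c * ?H m) has_sum
             (lipschitz_const k * residue_class_sum (k - 1) D a (nome z) + (if int D dvd a then even_zeta k else 0)
              - c * (lipschitz_const k * residue_class_sum (k - 1) D 0 (nome z) + even_zeta k))) ?X"
      using has_sum_add [OF 1 2] by simp
  qed
  finally show ?thesis .
qed

lemma sum_residue_class_sum:
  assumes "norm q < 1" "i > 0" "D > 0" "R \<subseteq> {0..<int D}"
  shows "(\<Sum>a\<in>R. residue_class_sum i D a q) = (\<Sum>\<^sub>\<infinity>m\<in>{m::int. m \<noteq> 0 \<and> m mod int D \<in> R}. polylog_neg i (q ^ nat \<bar>m\<bar>))"
proof -
  have fin: "finite R" using assms(4) finite_subset by blast
  have "((\<lambda>m. polylog_neg i (q ^ nat \<bar>m\<bar>)) has_sum (\<Sum>a\<in>R. residue_class_sum i D a q))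
          (\<Union>a\<in>R. {m::int. m \<noteq> 0 \<and> [m = a] (mod int D)})"
  proof (rule sum_has_sum [OF fin])
    fix a show "((\<lambda>m. polylog_neg i (q ^ nat \<bar>m\<bar>)) has_sum residue_class_sum i D a q) {m::int. m \<noteq> 0 \<and> [m = a] (mod int D)}"
      unfolding residue_class_sum_def by (intro has_sum_infsum polylog_neg_int_summable assms) auto
  next
    fix a b assume "a \<in> R" "b \<in> R" "a \<noteq> b"
    hence "a mod int D \<noteq> b mod int D" using assms(4) by (auto simp: subset_iff)
    thus "{m::int. m \<noteq> 0 \<and> [m = a] (mod int D)} \<inter> {m. m \<noteq> 0 \<and> [m = b] (mod int D)} = {}"
      by (auto simp: cong_def)
  qed
  moreover have "(\<Union>a\<in>R. {m::int. m \<noteq> 0 \<and> [m = a] (mod int D)}) = {m. m \<noteq> 0 \<and> m mod int D \<in> R}"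
  proof -
    have "[m = a] (mod int D) \<longleftrightarrow> m mod int D = a" if "a \<in> R" for m a
      using that assms(4) by (auto simp: cong_def subset_iff)
    thus ?thesis by auto
  qed
  ultimately show ?thesis by (simp add: infsumI)
qed

lemma symmetric_int_sum:
  assumes "norm q < 1" "i > 0" "\<And>m. m \<in> J \<Longrightarrow> - m \<in> J" "0 \<notin> J"
  shows "(\<Sum>\<^sub>\<infinity>m\<in>J. polylog_neg i (q ^ nat \<bar>m\<bar>)) = 2 * (\<Sum>\<^sub>\<infinity>m\<in>{m. 0 < m \<and> int m \<in> J}. polylog_neg i (q ^ m))"
proof -
  let ?P = "J \<inter> {0<..}" and ?N = "J \<inter> {..<0}"
  let ?f = "\<lambda>m. polylog_neg i (q ^ nat \<bar>m\<bar>)"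
  have "m \<in> J \<longleftrightarrow> m \<in> ?P \<union> ?N" for m
    using assms(4) by (cases m "0::int" rule: linorder_cases) auto
  hence "J = ?P \<union> ?N" by blast
  hence "infsum ?f J = infsum ?f (?P \<union> ?N)" by simp
  also have "\<dots> = infsum ?f ?P + infsum ?f ?N"
    by (intro infsum_Un_disjoint polylog_neg_int_summable assms) auto
  also have "infsum ?f ?N = infsum ?f ?P"
    by (rule infsum_reindex_bij_witness [where i = uminus and j = uminus]) (use assms(3) in fastforce)+
  also have "infsum ?f ?P = (\<Sum>\<^sub>\<infinity>m\<in>{m. 0 < m \<and> int m \<in> J}. polylog_neg i (q ^ m))"
    by (rule infsum_reindex_bij_witness [where i = int and j = nat]) auto
  finally show ?thesis by simp
qed

lemma residue_class_sum_square:
  "residue_class_sum i N a (q\<^sup>2) = residue_class_sum i (2 * N) (2 * a) q"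
  unfolding residue_class_sum_def
proof (rule infsum_reindex_bij_witness [where j = "\<lambda>m. 2 * m" and i = "\<lambda>m. m div 2"])
  fix m :: int assume m: "m \<in> {m. m \<noteq> 0 \<and> [m = 2 * a] (mod int (2 * N))}"
  have "even m"
  proof -
    have "int (2 * N) dvd m - 2 * a" using m by (simp add: cong_iff_dvd_diff)
    hence "2 dvd m - 2 * a" by (rule dvd_trans [rotated]) simp
    thus ?thesis by simp
  qed
  thus "2 * (m div 2) = m" by simp
  obtain j where j: "m = 2 * j" using \<open>even m\<close> by (rule evenE)
  have "int (2 * N) dvd m - 2 * a" using m by (simp add: cong_iff_dvd_diff)
  also have "m - 2 * a = 2 * (j - a)" by (simp add: j)
  finally have "2 * int N dvd 2 * (j - a)" by (simp only: of_nat_mult of_nat_numeral)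
  hence "int N dvd j - a" by (simp only: dvd_mult_cancel_left) simp
  thus "m div 2 \<in> {m. m \<noteq> 0 \<and> [m = a] (mod int N)}"
    using m by (simp add: j cong_iff_dvd_diff)
next
  fix m :: int assume m: "m \<in> {m. m \<noteq> 0 \<and> [m = a] (mod int N)}"
  hence "2 * int N dvd 2 * m - 2 * a"
    unfolding right_diff_distrib [symmetric] by (intro mult_dvd_mono) (auto simp: cong_iff_dvd_diff)
  thus "2 * m \<in> {m. m \<noteq> 0 \<and> [m = 2 * a] (mod int (2 * N))}"
    using m by (simp add: cong_iff_dvd_diff)
  have "nat \<bar>2 * m\<bar> = 2 * nat \<bar>m\<bar>" by (simp add: abs_mult nat_mult_distrib)
  thus "polylog_neg i (q ^ nat \<bar>2 * m\<bar>) = polylog_neg i ((q\<^sup>2) ^ nat \<bar>m\<bar>)" by (simp add: power_mult)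
qed auto

lemma residue_class_sum_phi:
  assumes "Im z > 0"
  shows "residue_class_sum 1 1 0 (nome z) = 1 / 12 - 1 / 12 * eisenstein_phi z"
proof -
  have q: "norm (nome z) < 1" by (rule norm_nome_less_1 [OF assms])
  have "residue_class_sum 1 1 0 (nome z) = (\<Sum>\<^sub>\<infinity>m\<in>- {0::int}. polylog_neg 1 (nome z ^ nat \<bar>m\<bar>))"
    unfolding residue_class_sum_def by (intro infsum_cong_neutral) auto
  also have "\<dots> = 2 * (\<Sum>\<^sub>\<infinity>m\<in>{m. 0 < m \<and> int m \<in> - {0}}. polylog_neg 1 (nome z ^ m))"
    by (rule symmetric_int_sum) (use q in auto)
  also have "{m. 0 < m \<and> int m \<in> - {0}} = {1..}" by auto
  also have "(\<Sum>\<^sub>\<infinity>m\<in>{1..}. polylog_neg 1 (nome z ^ m)) = (\<Sum>\<^sub>\<infinity>n\<in>{1..}. of_nat (\<Sum>d | d dvd n. d) * nome z ^ n)"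
    by (rule infsum_divisor_sum_eq_polylog_neg [OF q, symmetric])
  finally show ?thesis by (simp add: eisenstein_phi_def field_simps)
qed

text \<open>
  For \<open>i \<ge> 3\<close> the series is a modular form up to a constant. For \<open>i = 1\<close> the lattice sums only give the differences
  \<open>T(a) - T(0)\<close>. Their sum over all residues \<open>a\<close> is \<open>\<Sum>T(a) - D T(0)\<close>, where \<open>\<Sum>T(a)\<close> is the sum
  over all \<open>m \<noteq> 0\<close>, hence \<open>(1 - \<phi>) / 12\<close>; this determines \<open>T(0)\<close>.
\<close>

theorem residue_class_sum_quasimodular:
  assumes D: "D > 0" and \<Gamma>: "within_pm_Gamma1 D \<Gamma>" and "odd i"
  shows "(\<lambda>z. residue_class_sum i D a (nome z)) \<in> quasimodular_forms \<Gamma>"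
proof -
  define k where "k = i + 1"
  have k: "even k" "k - 1 = i" "k \<ge> 2" using \<open>odd i\<close> by (auto simp: k_def elim: oddE)
  have sub: "\<Gamma> \<subseteq> SL2Z" using \<Gamma> by (simp add: within_pm_Gamma1_def)
  define L where "L = lipschitz_const k"
  have L: "L \<noteq> 0" by (simp add: L_def)
  have eis: "eis k c (strip_lattice D) a 0 \<in> quasimodular_forms \<Gamma>" if "eis_admissible k c" for c a
    by (rule quasimodular_forms_modular [OF eis_in_modular_forms [OF that k(1) D \<Gamma>]])
  define e where "e = (\<lambda>a. if int D dvd a then even_zeta k else 0)"
  note qm = quasimodular_forms_add quasimodular_forms_diff quasimodular_forms_cmult
    quasimodular_forms_const quasimodular_forms_sum
  show ?thesis
  proof (cases "i = 1")
    case False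
    hence adm: "eis_admissible k 0" using \<open>odd i\<close> by (auto simp: eis_admissible_def k_def elim: oddE)
    have "(\<lambda>z. 1 / L * (eis k 0 (strip_lattice D) a 0 z - e a)) \<in> quasimodular_forms \<Gamma>"
      by (intro qm eis adm sub)
    thus ?thesis
    proof (rule quasimodular_forms_cong)
      fix z assume "z \<in> upper_half_plane"
      hence z: "Im z > 0" by (simp add: upper_half_plane_def)
      show "1 / L * (eis k 0 (strip_lattice D) a 0 z - e a) = residue_class_sum i D a (nome z)"
        using L by (simp add: eis_fourier_expansion [OF adm k(1) z] e_def L_def flip: k(2))
    qed
  next
    case True
    hence adm: "eis_admissible k 1" by (simp add: eis_admissible_def k_def)
    have expansion: "eis k 1 (strip_lattice D) a 0 z =
        L * residue_class_sum i D a (nome z) + e a - (L * residue_class_sum i D 0 (nome z) + even_zeta k)"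
      if "z \<in> upper_half_plane" for a z
      using eis_fourier_expansion [OF adm k(1), of z D a] that
      by (simp add: upper_half_plane_def e_def L_def flip: k(2))
    have "(\<lambda>z. 1 / of_nat D * ((1 / 12 - 1 / 12 * eisenstein_phi z) -
             1 / L * ((\<Sum>a\<in>{0..<int D}. eis k 1 (strip_lattice D) a 0 z) -
                      ((\<Sum>a\<in>{0..<int D}. e a) - of_nat D * even_zeta k)))) \<in> quasimodular_forms \<Gamma>"
      by (intro qm eis adm sub quasimodular_forms_phi)
    hence zero: "(\<lambda>z. residue_class_sum i D 0 (nome z)) \<in> quasimodular_forms \<Gamma>"
    proof (rule quasimodular_forms_cong)
      fix z assume z: "z \<in> upper_half_plane"
      hence Imz: "Im z > 0" by (simp add: upper_half_plane_def)
      have q: "norm (nome z) < 1" by (rule norm_nome_less_1 [OF Imz])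
      define T where "T = residue_class_sum i D 0 (nome z)"
      have "(\<Sum>a\<in>{0..<int D}. residue_class_sum i D a (nome z)) = residue_class_sum 1 1 0 (nome z)"
        by (subst sum_residue_class_sum) (use q D True in \<open>auto simp: residue_class_sum_def intro!: infsum_cong_neutral\<close>)
      hence all: "(\<Sum>a\<in>{0..<int D}. residue_class_sum i D a (nome z)) = 1 / 12 - 1 / 12 * eisenstein_phi z"
        using residue_class_sum_phi [OF Imz] by simp
      have "(\<Sum>a\<in>{0..<int D}. eis k 1 (strip_lattice D) a 0 z) =
              L * (\<Sum>a\<in>{0..<int D}. residue_class_sum i D a (nome z)) + (\<Sum>a\<in>{0..<int D}. e a)
               - of_nat D * (L * T + even_zeta k)"
        unfolding expansion [OF z] T_def by (simp add: sum.distrib sum_subtractf sum_distrib_left)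
      hence "(\<Sum>a\<in>{0..<int D}. eis k 1 (strip_lattice D) a 0 z) - ((\<Sum>a\<in>{0..<int D}. e a) - of_nat D * even_zeta k)
               = L * ((1 / 12 - 1 / 12 * eisenstein_phi z) - of_nat D * T)"
        unfolding all by (simp add: algebra_simps)
      thus "1 / of_nat D * ((1 / 12 - 1 / 12 * eisenstein_phi z) -
             1 / L * ((\<Sum>a\<in>{0..<int D}. eis k 1 (strip_lattice D) a 0 z) -
                      ((\<Sum>a\<in>{0..<int D}. e a) - of_nat D * even_zeta k))) = residue_class_sum i D 0 (nome z)"
        using L D by (simp add: T_def)
    qed
    have "(\<lambda>z. residue_class_sum i D 0 (nome z) +
             1 / L * (eis k 1 (strip_lattice D) a 0 z - (e a - even_zeta k))) \<in> quasimodular_forms \<Gamma>"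
      by (intro qm eis adm sub zero)
    thus ?thesis
      by (rule quasimodular_forms_cong) (use L in \<open>simp add: expansion field_simps\<close>)
  qed
qed

section \<open>MacMahon's functions\<close>

definition symmetric_mod :: "nat \<Rightarrow> nat set \<Rightarrow> bool" where
  "symmetric_mod N S \<longleftrightarrow> (\<forall>s\<in>S. \<exists>s'\<in>S. [s + s' = 0] (mod N))"

text \<open>
  Symmetry of \<open>S\<close> means that the integers \<open>m\<close> and \<open>-m\<close> lie in \<open>S\<close> simultaneously, whence the factor \<open>1/2\<close>.
\<close>

lemma symmetric_residue_sum:
  assumes "symmetric_mod N S" "N > 0" "i > 0" "norm q < 1"
  shows "(\<Sum>\<^sub>\<infinity>m\<in>{m. 0 < m \<and> (\<exists>s\<in>S. [m = s] (mod N))}. polylog_neg i (q ^ m)) =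
           1 / 2 * (\<Sum>a\<in>{a\<in>{0..<int N}. \<exists>s\<in>S. [a = int s] (mod int N)}. residue_class_sum i N a q)"
proof -
  define R where "R = {a\<in>{0..<int N}. \<exists>s\<in>S. [a = int s] (mod int N)}"
  define J where "J = {m::int. m \<noteq> 0 \<and> m mod int N \<in> R}"
  have J: "m \<in> J \<longleftrightarrow> m \<noteq> 0 \<and> (\<exists>s\<in>S. [m = int s] (mod int N))" for m
    using \<open>N > 0\<close> by (simp add: J_def R_def)
  have "- m \<in> J" if m: "m \<in> J" for m
  proof -
    obtain s where s: "s \<in> S" "[m = int s] (mod int N)" using m J by blast
    then obtain s' where s': "s' \<in> S" "[s + s' = 0] (mod N)"
      using assms(1) unfolding symmetric_mod_def by blast
    have "int N dvd int (s + s')" using s'(2) by (simp only: cong_0_iff int_dvd_int_iff)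
    moreover have "int N dvd m - int s" using s(2) by (simp add: cong_iff_dvd_diff)
    ultimately have "int N dvd - (int (s + s') + (m - int s))" by (simp only: dvd_minus_iff dvd_add)
    hence "[- m = int s'] (mod int N)" by (simp add: cong_iff_dvd_diff algebra_simps)
    thus ?thesis using m s'(1) J by auto
  qed
  moreover have "0 \<notin> J" by (simp add: J_def)
  ultimately have "infsum (\<lambda>m. polylog_neg i (q ^ nat \<bar>m\<bar>)) J = 2 * (\<Sum>\<^sub>\<infinity>m\<in>{m. 0 < m \<and> int m \<in> J}. polylog_neg i (q ^ m))"
    using assms by (intro symmetric_int_sum) auto
  moreover have "(\<Sum>a\<in>R. residue_class_sum i N a q) = infsum (\<lambda>m. polylog_neg i (q ^ nat \<bar>m\<bar>)) J"
    unfolding J_def by (rule sum_residue_class_sum) (use assms in \<open>auto simp: R_def\<close>)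
  moreover have "{m. 0 < m \<and> int m \<in> J} = {m. 0 < m \<and> (\<exists>s\<in>S. [m = s] (mod N))}"
    by (auto simp: J cong_int_iff)
  ultimately show ?thesis by (simp add: R_def)
qed

lemma has_sum_finite_sum:
  fixes f :: "'b \<Rightarrow> 'a \<Rightarrow> complex"
  assumes "\<And>j. j \<in> J \<Longrightarrow> (f j has_sum s j) I"
  shows "((\<lambda>m. \<Sum>j\<in>J. f j m) has_sum (\<Sum>j\<in>J. s j)) I"
  using assms by (induction J rule: infinite_finite_induct) (auto intro: has_sum_add)

text \<open>
  Newton's identities determine the elementary symmetric functions recursively from the power sums, and the
  power sums are linear combinations of the series in the hypothesis.
\<close>

lemma mac_sum_quasimodular_if_odd_series:
  assumes sub: "\<Gamma> \<subseteq> SL2Z" and \<epsilon>: "norm \<epsilon> = 1"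
    and I: "I = {m. 0 < m \<and> (\<exists>s\<in>S. [m = s] (mod N))}"
    and odd: "\<And>i. odd i \<Longrightarrow> (\<lambda>z. \<Sum>\<^sub>\<infinity>m\<in>I. polylog_neg i (\<epsilon> * nome z ^ m)) \<in> quasimodular_forms \<Gamma>"
  shows "(\<lambda>z. mac_sum S N \<epsilon> k (nome z)) \<in> quasimodular_forms \<Gamma>"
proof -
  define x where "x = (\<lambda>z m. \<epsilon> * nome z ^ m / (1 - \<epsilon> * nome z ^ m)\<^sup>2)"
  have norm_lt: "norm (\<epsilon> * nome z ^ m) < 1" if "z \<in> upper_half_plane" "m \<in> I" for z m
  proof -
    have "norm (nome z) < 1" using that by (intro norm_nome_less_1) (simp add: upper_half_plane_def)
    thus ?thesis using that I \<epsilon> by (auto simp: norm_mult norm_power power_less_one_iff)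
  qed
  have polylog_neg_summable: "(\<lambda>m. norm (polylog_neg i (\<epsilon> * nome z ^ m))) summable_on I" if "z \<in> upper_half_plane" "i > 0" for i z
    using that I \<epsilon> norm_nome_less_1 [of z]
    by (intro abs_summable_polylog_neg_power) (auto simp: upper_half_plane_def)
  have power_sum: "(\<lambda>z. \<Sum>\<^sub>\<infinity>m\<in>I. x z m ^ Suc r) \<in> quasimodular_forms \<Gamma>" for r
  proof -
    obtain c where c: "\<And>t. norm t < 1 \<Longrightarrow> (t / (1 - t)\<^sup>2) ^ Suc r = (\<Sum>j<Suc r. c j * polylog_neg (2 * j + 1) t)"
      using power_polylog_neg_1_eq_combination [of "Suc r"] by auto
    have "(\<lambda>z. \<Sum>j<Suc r. c j * (\<Sum>\<^sub>\<infinity>m\<in>I. polylog_neg (2 * j + 1) (\<epsilon> * nome z ^ m))) \<in> quasimodular_forms \<Gamma>"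
      by (intro quasimodular_forms_sum quasimodular_forms_cmult odd sub) auto
    thus ?thesis
    proof (rule quasimodular_forms_cong)
      fix z assume z: "z \<in> upper_half_plane"
      have "((\<lambda>m. \<Sum>j<Suc r. c j * polylog_neg (2 * j + 1) (\<epsilon> * nome z ^ m)) has_sum
               (\<Sum>j<Suc r. c j * (\<Sum>\<^sub>\<infinity>m\<in>I. polylog_neg (2 * j + 1) (\<epsilon> * nome z ^ m)))) I"
        by (intro has_sum_finite_sum has_sum_cmult_right has_sum_infsum abs_summable_summable [OF polylog_neg_summable] z) auto
      hence "((\<lambda>m. x z m ^ Suc r) has_sum
               (\<Sum>j<Suc r. c j * (\<Sum>\<^sub>\<infinity>m\<in>I. polylog_neg (2 * j + 1) (\<epsilon> * nome z ^ m)))) I"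
        by (rule has_sum_cong [THEN iffD1, rotated]) (use c norm_lt [OF z] in \<open>simp add: x_def\<close>)
      thus "(\<Sum>j<Suc r. c j * (\<Sum>\<^sub>\<infinity>m\<in>I. polylog_neg (2 * j + 1) (\<epsilon> * nome z ^ m))) = (\<Sum>\<^sub>\<infinity>m\<in>I. x z m ^ Suc r)"
        by (rule infsumI [symmetric])
    qed
  qed
  have "(\<lambda>z. elem_sym (x z) I k) \<in> quasimodular_forms \<Gamma>"
  proof (induction k rule: less_induct)
    case (less k)
    show ?case
    proof (cases k)
      case 0
      thus ?thesis by (simp add: quasimodular_forms_const)
    next
      case (Suc l)
      have "(\<lambda>z. 1 / of_nat (Suc l) * (\<Sum>i\<le>l. elem_sym (x z) I (l - i) * ((-1) ^ i * (\<Sum>\<^sub>\<infinity>m\<in>I. x z m ^ Suc i))))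
              \<in> quasimodular_forms \<Gamma>"
        using less.IH Suc
        by (intro quasimodular_forms_sum quasimodular_forms_cmult quasimodular_forms_mult power_sum sub) auto
      thus ?thesis
      proof (rule quasimodular_forms_cong)
        fix z assume z: "z \<in> upper_half_plane"
        have "(\<lambda>m. norm (x z m)) summable_on I"
          by (rule summable_on_cong [THEN iffD1, OF _ polylog_neg_summable [OF z, of 1]])
             (use norm_lt [OF z] in \<open>simp_all add: x_def polylog_neg_1 [unfolded One_nat_def]\<close>)
        note newton = newton_identity [OF this, of l]
        have "of_nat (Suc l) \<noteq> (0 :: complex)" by (rule of_nat_neq_0)
        thus "1 / of_nat (Suc l) * (\<Sum>i\<le>l. elem_sym (x z) I (l - i) * ((-1) ^ i * (\<Sum>\<^sub>\<infinity>m\<in>I. x z m ^ Suc i)))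
                = elem_sym (x z) I k"
          unfolding Suc newton [symmetric] by (simp del: of_nat_Suc)
      qed
    qed
  qed
  thus ?thesis by (simp add: mac_sum_eq_elem_sym x_def I)
qed

theorem mac_sum_quasimodular:
  assumes "symmetric_mod N S" "N > 0" "within_pm_Gamma1 N \<Gamma>"
  shows "(\<lambda>z. mac_sum S N 1 k (nome z)) \<in> quasimodular_forms \<Gamma>"
proof (rule mac_sum_quasimodular_if_odd_series [OF _ _ refl])
  show sub: "\<Gamma> \<subseteq> SL2Z" using assms by (simp add: within_pm_Gamma1_def)
  fix i :: nat assume i: "odd i"
  let ?R = "{a\<in>{0..<int N}. \<exists>s\<in>S. [a = int s] (mod int N)}"
  have "(\<lambda>z. 1 / 2 * (\<Sum>a\<in>?R. residue_class_sum i N a (nome z))) \<in> quasimodular_forms \<Gamma>"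
    by (intro quasimodular_forms_cmult quasimodular_forms_sum residue_class_sum_quasimodular assms i sub)
  thus "(\<lambda>z. \<Sum>\<^sub>\<infinity>m\<in>{m. 0 < m \<and> (\<exists>s\<in>S. [m = s] (mod N))}. polylog_neg i (1 * nome z ^ m)) \<in> quasimodular_forms \<Gamma>"
    by (rule quasimodular_forms_cong)
       (use i assms in \<open>auto simp: symmetric_residue_sum odd_pos upper_half_plane_def norm_nome_less_1\<close>)
qed auto

text \<open>
  The even terms of \<open>\<Sum>n. n\<^sup>i (-q\<^sup>m)\<^sup>n\<close> bring in the classes \<open>2 a\<close> modulo \<open>2 N\<close>, whence the doubled level.
\<close>

theorem mac_sum_minus_quasimodular:
  assumes "symmetric_mod N S" "N > 0" "within_pm_Gamma1 (2 * N) \<Gamma>"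
  shows "(\<lambda>z. mac_sum S N (-1) k (nome z)) \<in> quasimodular_forms \<Gamma>"
proof (rule mac_sum_quasimodular_if_odd_series [OF _ _ refl])
  show sub: "\<Gamma> \<subseteq> SL2Z" using assms by (simp add: within_pm_Gamma1_def)
  have "within_pm_Gamma1 N \<Gamma>"
    using assms(3) unfolding within_pm_Gamma1_def by (auto dest: dvd_mult_right)
  fix i :: nat assume i: "odd i"
  let ?R = "{a\<in>{0..<int N}. \<exists>s\<in>S. [a = int s] (mod int N)}"
  let ?I = "{m. 0 < m \<and> (\<exists>s\<in>S. [m = s] (mod N))}"
  have "(\<lambda>z. 2 ^ Suc i * (1 / 2 * (\<Sum>a\<in>?R. residue_class_sum i (2 * N) (2 * a) (nome z))) -
             1 / 2 * (\<Sum>a\<in>?R. residue_class_sum i N a (nome z))) \<in> quasimodular_forms \<Gamma>"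
    by (intro quasimodular_forms_diff quasimodular_forms_cmult quasimodular_forms_sum
          residue_class_sum_quasimodular assms i sub \<open>within_pm_Gamma1 N \<Gamma>\<close>) (use assms in auto)
  thus "(\<lambda>z. \<Sum>\<^sub>\<infinity>m\<in>?I. polylog_neg i (-1 * nome z ^ m)) \<in> quasimodular_forms \<Gamma>"
  proof (rule quasimodular_forms_cong)
    fix z assume "z \<in> upper_half_plane"
    hence q: "norm (nome z) < 1" by (simp add: upper_half_plane_def norm_nome_less_1)
    hence q2: "norm ((nome z)\<^sup>2) < 1" by (simp add: norm_power power_less_one_iff)
    have summ: "(\<lambda>m. polylog_neg i (q ^ m)) summable_on ?I" if "norm q < 1" for q
      using abs_summable_summable [OF abs_summable_polylog_neg_power [of q i ?I 1]] that i by (auto simp: odd_pos)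
    have "(\<Sum>\<^sub>\<infinity>m\<in>?I. polylog_neg i (-1 * nome z ^ m)) =
            (\<Sum>\<^sub>\<infinity>m\<in>?I. 2 ^ Suc i * polylog_neg i (((nome z)\<^sup>2) ^ m) - polylog_neg i (nome z ^ m))"
    proof (rule infsum_cong)
      fix m assume "m \<in> ?I"
      hence "norm (nome z ^ m) < 1" using q by (simp add: norm_power power_less_one_iff)
      from polylog_neg_minus [OF this, of i]
      show "polylog_neg i (-1 * nome z ^ m) = 2 ^ Suc i * polylog_neg i (((nome z)\<^sup>2) ^ m) - polylog_neg i (nome z ^ m)"
        by (simp add: power2_eq_square power_mult_distrib)
    qed
    also have "\<dots> = 2 ^ Suc i * (\<Sum>\<^sub>\<infinity>m\<in>?I. polylog_neg i (((nome z)\<^sup>2) ^ m)) - (\<Sum>\<^sub>\<infinity>m\<in>?I. polylog_neg i (nome z ^ m))"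
      by (subst infsum_minus) (auto intro!: summ summable_on_cmult_right simp: q q2 infsum_cmult_right')
    finally show "2 ^ Suc i * (1 / 2 * (\<Sum>a\<in>?R. residue_class_sum i (2 * N) (2 * a) (nome z))) -
             1 / 2 * (\<Sum>a\<in>?R. residue_class_sum i N a (nome z)) = (\<Sum>\<^sub>\<infinity>m\<in>?I. polylog_neg i (-1 * nome z ^ m))"
      using symmetric_residue_sum [OF assms(1,2) odd_pos [OF i] q]
        symmetric_residue_sum [OF assms(1,2) odd_pos [OF i] q2]
      by (simp add: residue_class_sum_square)
  qed
qed auto

lemma within_pm_Gamma1_SL2Z: "within_pm_Gamma1 1 SL2Z"
  by (simp add: within_pm_Gamma1_def)

text \<open>
  The upper left entry is odd, hence \<open>\<plusminus>1\<close> modulo 4.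
\<close>

lemma within_pm_Gamma1_Gamma0:
  assumes "N = 2 \<or> N = 4"
  shows "within_pm_Gamma1 N (Gamma0 N)"
  unfolding within_pm_Gamma1_def
proof (intro conjI ballI)
  show "Gamma0 N \<subseteq> SL2Z" by (auto simp: Gamma0_def)
  fix A assume A: "A \<in> Gamma0 N"
  show N: "int N dvd A$2$1" using A by (simp add: Gamma0_def cong_0_iff)
  hence "2 dvd A$2$1" using assms by (auto intro: dvd_trans [rotated])
  moreover have "A$1$1 * A$2$2 - A$1$2 * A$2$1 = 1" using A by (auto simp: Gamma0_def SL2Z_iff)
  ultimately have "odd (A$1$1)" by (metis dvd_diff dvd_mult dvd_mult2 odd_one)
  thus "int N dvd A$1$1 - 1 \<or> int N dvd A$1$1 + 1"
    using assms by (elim disjE) (simp, presburger)+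
qed

lemma within_pm_Gamma1_Gamma1: "within_pm_Gamma1 N (Gamma1 N)"
  by (auto simp: within_pm_Gamma1_def Gamma1_def Gamma0_def cong_0_iff cong_iff_dvd_diff)

theorem corollary3p9:
  fixes k :: nat
  assumes "k > 0"
  shows "(\<lambda>z. mac_A k (nome z)) \<in> quasimodular_forms SL2Z
       \<and> (\<lambda>z. mac_B k (nome z)) \<in> quasimodular_forms (Gamma0 2)
       \<and> (\<lambda>z. mac_C k (nome z)) \<in> quasimodular_forms (Gamma0 2)
       \<and> (\<lambda>z. mac_D k (nome z)) \<in> quasimodular_forms (Gamma0 4)
       \<and> (\<lambda>z. mac_E k (nome z)) \<in> quasimodular_forms (Gamma1 5)
       \<and> (\<lambda>z. mac_F k (nome z)) \<in> quasimodular_forms (Gamma1 10)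
       \<and> (\<lambda>z. mac_G k (nome z)) \<in> quasimodular_forms (Gamma1 5)
       \<and> (\<lambda>z. mac_H k (nome z)) \<in> quasimodular_forms (Gamma1 10)"
proof -
  have sym: "symmetric_mod 1 {0}" "symmetric_mod 2 {1}" "symmetric_mod 5 {1, 4}" "symmetric_mod 5 {2, 3}"
    by (simp_all add: symmetric_mod_def cong_def)
  have sub: "Gamma0 N \<subseteq> SL2Z" "Gamma1 N \<subseteq> SL2Z" for N
    by (auto simp: Gamma0_def Gamma1_def)
  show ?thesis
    unfolding mac_A_def [abs_def] mac_B_def [abs_def] mac_C_def [abs_def] mac_D_def [abs_def]
      mac_E_def [abs_def] mac_F_def [abs_def] mac_G_def [abs_def] mac_H_def [abs_def]
    by (intro conjI quasimodular_forms_cmult mac_sum_quasimodular mac_sum_minus_quasimodular sym sub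
          within_pm_Gamma1_SL2Z)
       (use within_pm_Gamma1_Gamma0 [of 2] within_pm_Gamma1_Gamma0 [of 4] within_pm_Gamma1_Gamma1 [of 5]
          within_pm_Gamma1_Gamma1 [of 10] in simp_all)
qed

end
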